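(* Let $(\mathbb{G}^N)_{N\in\mathbb{N}}$ be a sequence of games as described in the context, with horizon $T\in\mathbb{N}\cup\{\infty\}$, satisfying conditions (A1)–(A3) listed in the context, and let $\mathbb{G}^\infty$ be the associated game with countably many DMs. Let $(\gamma^{*,N})_{N\in\mathbb{N}}$ be such that $\gamma^{*,N}=(\gamma^{1,N},\dots,\gamma^{N,N})$ is an SEBEU in mixed strategies in $\mathbb{G}^N$ for each $N\in\mathbb{N}$. Suppose that there exists a joint mixed strategy $\gamma^{*,\infty}=(\gamma^{1,\infty},\gamma^{2,\infty},\dots)$ in $\mathbb{G}^\infty$ such that $$\lim_{N\to\infty}m_{\mathcal{P}(\mathbb{I}_T^i\times\mathbb{Y}^{[0,T)})}\big(\mu^{i,\gamma^{*,N}},\mu^{i,(\gamma^{1,\infty},\dots,\gamma^{N,\infty})}\big)=0,\qquad\forall i\in\mathbb{N},$$ where $m_{\mathcal{P}(\cdot)}$ is the Prokhorov metric and, for a joint mixed strategy $\gamma$ in $\mathbb{G}^N$ ($N\ge i$), $\mu^{i,\gamma}$ denotes the probability measure on the Borel sets of $\mathbb{I}_T^i\times\mathbb{Y}^{[0,T)}$ induced by $\gamma$ in $\mathbb{G}^N$. Then $\gamma^{*,\infty}$ is a Nash equilibrium in $\mathbb{G}^\infty$.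
   Context: Notation: $[1,N]=\{1,\dots,N\}$, $[0,T)=\{0,\dots,T-1\}$ if $T\in\mathbb{N}$ and $[0,T)=\mathbb{N}_0$ if $T=\infty$. $\mathcal{P}(\mathbb{T})$ is the set of Borel probability measures on $\mathbb{T}$; $m_{\mathbb{M}}$ is the metric of a metric space $\mathbb{M}$. Countable products of metric spaces carry the product metric $m(a,b)=\sum_t2^{-t}\frac{m_t(a_t,b_t)}{1+m_t(a_t,b_t)}$. The Prokhorov metric on $\mathcal{P}(\mathbb{M})$ is $m_{\mathcal{P}(\mathbb{M})}(\mu,\nu)=\inf\{\epsilon>0:\mu(B)\le\nu(B_\epsilon)+\epsilon\ \forall\text{ Borel }B\}$, $B_\epsilon$ the open $\epsilon$-neighborhood of $B$. Games: $\mathbb{G}^N$ has decision makers DM$^1,\dots,$DM$^N$. At time $t$, DM$^i$ has state $x_t^i\in\mathbb{X}^i$, control $u_t^i\in\mathbb{U}^i$, random disturbance $w_t^i\in\mathbb{W}^i$; there is an environment variable $y_t\in\mathbb{Y}$, an environment state $x_t^0\in\mathbb{X}^0$, random disturbances $w_t^0\in\mathbb{W}^0$, $\xi_t\in\Xi$, and aggregate statistics $d_t^N(x_t,u_t)\in\mathbb{D}$, where $d_t^N:\mathbb{X}^1\times\cdots\times\mathbb{X}^N\times\mathbb{U}^1\times\cdots\times\mathbb{U}^N\to\mathbb{D}$, $x_t=(x_t^1,\dots,x_t^N)$, $u_t=(u_t^1,\dots,u_t^N)$, and $\mathbb{D}$ is a compact metric space. The dynamics for $t\in[0,T)$ are $x_{t+1}^i=f_t^i(x_t^i,u_t^i,y_t,w_t^i)$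 for $i\in[1,N]$, $y_t=g_t(x_t^0,d_t^N(x_t,u_t),\xi_t)$, $x_{t+1}^0=f_t^0(x_t^0,d_t^N(x_t,u_t),w_t^0)$, with $g_t:\mathbb{X}^0\times\mathbb{D}\times\Xi\to\mathbb{Y}$, $f_t^0:\mathbb{X}^0\times\mathbb{D}\times\mathbb{W}^0\to\mathbb{X}^0$, and possibly random initial states $x_0^0,\dots,x_0^N$. All games share $T,\mathbb{Y},\mathbb{X}^0,\mathbb{D},\mathbb{W}^0,\Xi,(f_t^0)_t,(g_t)_t$ (and the law of the environment's random parameters), and the data of DM$^i$, namely $\mathbb{X}^i,\mathbb{U}^i,\mathbb{W}^i,(f_t^i)_t,(c_t^i)_t,\beta^i,\mathbb{S}^i$ and the law of $(x_0^i,(w_t^i)_{t\in[0,T)})$, is the same in all games $\mathbb{G}^i,\mathbb{G}^{i+1},\dots$; only the maps $d_t^N$ depend on $N$. Strategies: $I_t^i=((x_k^i)_{k\in[0,t]},(u_k^i)_{k\in[0,t)})\in\mathbb{I}_t^i:=(\mathbb{X}^i)^{[0,t]}\times(\mathbb{U}^i)^{[0,t)}$, $Y_{t-1}=(y_k)_{k\in[0,t)}$ ($Y_{-1}=\emptyset$). $(I_T^i,Y_{T-1})\in\mathbb{I}_T^i\times\mathbb{Y}^{[0,T)}$ denotes DM$^i$'s entire history (all states, controls and environment variables; for $T=\infty$, over all times in $\mathbb{N}_0$); $\mu^{i,\gamma}$ is its law in $\mathbb{G}^N$ under $\gamma$. A pure strategy of DM$^i$ is $s^i=(s_t^i)_{t\in[0,T)}$,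 $s_t^i:\mathbb{I}_t^i\times\mathbb{Y}^{[0,t)}\to\mathbb{U}^i$, used as $u_t^i=s_t^i(I_t^i,Y_{t-1})$; $\mathbb{S}^i$ is the set of admissible pure strategies. Mixed strategies: $\Gamma^i=\mathcal{P}(\mathbb{S}^i)$; under $\gamma=(\gamma^1,\dots,\gamma^N)\in\Gamma^1\times\cdots\times\Gamma^N$ each DM$^i$ draws $s^i\sim\gamma^i$ independently (of the other DMs and of all primitive random variables) and uses it. Costs: DM$^i$ has discount factor $\beta^i\in(0,1]$ ($\beta^i\in(0,1)$ if $T=\infty$), stage costs $c_t^i:\mathbb{X}^i\times\mathbb{U}^i\times\mathbb{Y}\to\mathbb{R}$ ($t\in[0,T)$), terminal cost $c_T^i:\mathbb{X}^i\to\mathbb{R}$ ($c_T^i\equiv0$ if $T=\infty$). For a joint pure strategy $s$ in $\mathbb{G}^N$, $\bar J^{i,N}(s)=E[\sum_{t\in[0,T)}(\beta^i)^tc_t^i(x_t^i,u_t^i,y_t)+(\beta^i)^Tc_T^i(x_T^i)]$ under the dynamics of $\mathbb{G}^N$; $E^\gamma[\bar J^{i,N}]$ is its average over $s\sim\gamma$. For $s^i\in\mathbb{S}^i$ and deterministic $\bar Z=(\bar z_t)_t\in\mathbb{Y}^{[0,T)}$, $J^i(s^i,\bar Z)=E[\sum_{t\in[0,T)}(\beta^i)^tc_t^i(x_t^i,u_t^i,\bar z_t)+(\beta^i)^Tc_T^i(x_T^i)]$ where $x_{t+1}^i=f_t^i(x_t^i,u_t^i,\bar z_t,w_t^i)$,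 $u_t^i=s_t^i(I_t^i,(\bar z_0,\dots,\bar z_{t-1}))$. For $\zeta\in\mathcal{P}(\mathbb{Y}^{[0,T)})$, $E^{(\gamma^i,\zeta)}[J^i]=\int\int J^i(s^i,z)\gamma^i(ds^i)\zeta(dz)$. SEBEU in mixed strategies in $\mathbb{G}^N$: a profile $\gamma=(\gamma^1,\dots,\gamma^N)$ such that $E^{(\gamma^i,\zeta_\gamma)}[J^i]\le E^{(\tilde\gamma^i,\zeta_\gamma)}[J^i]$ for all $i\in[1,N]$, $\tilde\gamma^i\in\Gamma^i$, where $\zeta_\gamma\in\mathcal{P}(\mathbb{Y}^{[0,T)})$ is the distribution of $(y_t)_{t\in[0,T)}$ generated in $\mathbb{G}^N$ under $\gamma$. Game $\mathbb{G}^\infty$: the set of DMs is $\mathbb{N}$; joint mixed strategies are $\gamma=(\gamma^j)_{j\in\mathbb{N}}\in\times_{j\in\mathbb{N}}\Gamma^j$; the cost of DM$^i$ is $\bar J^{i,\infty}(\gamma)=\limsup_{N\to\infty}E^{(\gamma^1,\dots,\gamma^N)}[\bar J^{i,N}]$. A joint strategy $\bar\gamma$ is a Nash equilibrium in (mixed strategies in) $\mathbb{G}^\infty$ if $\bar J^{i,\infty}(\bar\gamma^i,\bar\gamma^{-i})\le\bar J^{i,\infty}(\gamma^i,\bar\gamma^{-i})$ for all $i\in\mathbb{N}$, $\gamma^i\in\Gamma^i$. Conditions: (A1) All the spaces $\mathbb{X}^0,\mathbb{W}^0,\mathbb{Y},\Xi$ and $\mathbb{X}^i,\mathbb{U}^i,\mathbb{W}^i$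 ($i\in\mathbb{N}$) are nonempty compact metric spaces; all $c_t^i,f_t^i$ ($i\in\mathbb{N}$), $f_t^0$, $g_t$ are continuous; for each $i\in\mathbb{N}$, $\mathbb{S}^i=\times_{t\in[0,T)}\mathbb{S}_t^i$ with each $\mathbb{S}_t^i$ a nonempty compact subset of the space of continuous functions $\mathbb{I}_t^i\times\mathbb{Y}^{[0,t)}\to\mathbb{U}^i$ with the supremum metric. Moreover: (a) for all $i\in\mathbb{N}$, $\mathbb{X}^i=\mathbb{X}^1$, $\mathbb{U}^i=\mathbb{U}^1$, $\mathbb{W}^i=\mathbb{W}^1$, $\mathbb{S}^i=\mathbb{S}^1$; (b) for each $t$, the families $(c_t^i)_{i\in\mathbb{N}}$ and $(f_t^i)_{i\in\mathbb{N}}$ are uniformly equi-continuous; (c) for some $\bar c<\infty$, $\bar\beta<1$: $\sup_{i\in\mathbb{N},t\in[0,T],x^i,u^i,y}|c_t^i(x^i,u^i,y)|<\bar c$ (for $t=T$ read $c_T^i(x^i)$) and $\sup_{i\in\mathbb{N}}\beta^i<\bar\beta$. (A2) For all $t\in[0,T)$ and $\epsilon>0$ there is $\delta_\epsilon>0$ such that, in all games $\mathbb{G}^N$, $N\in\mathbb{N}$: $\sup_{i\in[1,N]}m_{\mathbb{X}^i\times\mathbb{U}^i}((x^i,u^i),(\tilde x^i,\tilde u^i))<\delta_\epsilon$ implies $m_{\mathbb{D}}(d_t^N(x,u),d_t^N(\tilde x,\tilde u))<\epsilon$; and, for all $t\in[0,T)$, $\lim_{N\to\infty}\sup_{i\in[1,N]}\sup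 m_{\mathbb{D}}(d_t^N(x,u),d_t^N(\tilde x,\tilde u))=0$, the inner supremum being over all $(x,u),(\tilde x,\tilde u)$ with $(x^j,u^j)=(\tilde x^j,\tilde u^j)$ for all $j\ne i$. (A3) The random variables $\omega^0:=(x_0^0,(w_t^0)_{t\in[0,T)},(\xi_t)_{t\in[0,T)})$ and $\omega^i:=(x_0^i,(w_t^i)_{t\in[0,T)})$, $i\in\mathbb{N}$, are mutually independent. *)

theory Defs
  imports "HOL-Probability.Probability"
begin

text \<open>
  Conventions. Decision makers are numbered 1, 2, ...; the families below are functions on
  \<^typ>\<open>nat\<close> whose value at 0 (and, in the game with N decision makers, beyond N) is never used.
  All decision makers are assumed to have the same state, control and disturbance spaces; these and
  all other spaces are types, and their compactness is a condition on \<^term>\<open>UNIV\<close>. Where such a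
  type is moreover required to be of class \<^class>\<open>second_countable_topology\<close>, this is implied
  by compactness and metrizability; it makes the Borel sets of countable products product-measurable.
  A sequence indexed by a set of times is a function on \<^typ>\<open>nat\<close> that takes the value
  \<^term>\<open>undefined\<close> outside that set, so that sets of sequences are of the form
  \<^term>\<open>Pi\<^sub>E I X\<close>. A Borel measure on such a set lives on the trace of the Borel sets of the product
  topology (class instance for functions).
\<close>

text \<open>A history is a triple ((states, controls), environment variables).\<close>

type_synonym ('x, 'u, 'y) hist = "((nat \<Rightarrow> 'x) \<times> (nat \<Rightarrow> 'u)) \<times> (nat \<Rightarrow> 'y)"

text \<open>
  A pure strategy assigns to time t a bounded continuous function on sequences, which is required
  (in \<open>strategy_maps\<close>) to depend only on the states up to time t and on the controls and
  environment variables before time t. For compact control space this is the space of continuous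
  functions on the finite product of observations available at time t, and the metric of
  \<^term>\<open>\<lambda>f g :: 'a::topological_space \<Rightarrow>\<^sub>C 'b::metric_space. dist f g\<close> is the supremum metric.
\<close>

type_synonym ('x, 'u, 'y) pure = "nat \<Rightarrow> (('x, 'u, 'y) hist \<Rightarrow>\<^sub>C 'u)"

text \<open>
  The data of the whole sequence of games. The random variables of all games live on one
  probability space, so that their laws do not depend on the game.
  \<open>aggr G N t\<close> is the aggregate statistic of the game with N decision makers; its argument
  consists of sequences on \<^term>\<open>{1..N}\<close>.
  \<open>tcost\<close> is the terminal cost (at time T), \<open>init\<close>, \<open>noise\<close> are the initial states and
  disturbances of the decision makers, \<open>env_init\<close>, \<open>env_noise\<close>, \<open>out_noise\<close> those of the
  environment (the latter two enter \<open>env_dyn\<close> and \<open>env_out\<close>, respectively).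
\<close>

record (overloaded) ('x::metric_space, 'u::metric_space, 'w::metric_space, 'x0::metric_space,
    'w0::metric_space, 'y::metric_space, 'k::metric_space, 'd::metric_space, 'z) game_seq =
  horizon :: enat
  dyn :: "nat \<Rightarrow> nat \<Rightarrow> 'x \<times> 'u \<times> 'y \<times> 'w \<Rightarrow> 'x"
  env_dyn :: "nat \<Rightarrow> 'x0 \<times> 'd \<times> 'w0 \<Rightarrow> 'x0"
  env_out :: "nat \<Rightarrow> 'x0 \<times> 'd \<times> 'k \<Rightarrow> 'y"
  aggr :: "nat \<Rightarrow> nat \<Rightarrow> (nat \<Rightarrow> 'x) \<times> (nat \<Rightarrow> 'u) \<Rightarrow> 'd"
  cost :: "nat \<Rightarrow> nat \<Rightarrow> 'x \<times> 'u \<times> 'y \<Rightarrow> real"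
  tcost :: "nat \<Rightarrow> 'x \<Rightarrow> real"
  discount :: "nat \<Rightarrow> real"
  strats :: "nat \<Rightarrow> nat \<Rightarrow> (('x, 'u, 'y) hist \<Rightarrow>\<^sub>C 'u) set"
  prob_sp :: "'z measure"
  init :: "nat \<Rightarrow> 'z \<Rightarrow> 'x"
  noise :: "nat \<Rightarrow> nat \<Rightarrow> 'z \<Rightarrow> 'w"
  env_init :: "'z \<Rightarrow> 'x0"
  env_noise :: "nat \<Rightarrow> 'z \<Rightarrow> 'w0"
  out_noise :: "nat \<Rightarrow> 'z \<Rightarrow> 'k"

definition ctrl_times where "ctrl_times G = {t. enat t < horizon G}"

definition state_times where "state_times G = {t. enat t \<le> horizon G}"

definition strategy_maps :: "nat \<Rightarrow> (('x::metric_space, 'u::metric_space, 'y::metric_space) hist \<Rightarrow>\<^sub>C 'u) set"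
  where "strategy_maps t = {\<phi>. \<forall>x x' u u' y y'.
    (\<forall>k\<le>t. x k = x' k) \<and> (\<forall>k<t. u k = u' k \<and> y k = y' k)
      \<longrightarrow> apply_bcontfun \<phi> ((x, u), y) = apply_bcontfun \<phi> ((x', u'), y')}"

definition pures where "pures G i = Pi\<^sub>E (ctrl_times G) (strats G i)"

definition joint_acts :: "nat \<Rightarrow> ((nat \<Rightarrow> 'x) \<times> (nat \<Rightarrow> 'u)) set"
  where "joint_acts N = ({1..N} \<rightarrow>\<^sub>E UNIV) \<times> ({1..N} \<rightarrow>\<^sub>E UNIV)"

definition env_seqs where "env_seqs G = (ctrl_times G \<rightarrow>\<^sub>E UNIV)"

definition histories where
  "histories G = ((state_times G \<rightarrow>\<^sub>E UNIV) \<times> (ctrl_times G \<rightarrow>\<^sub>E UNIV)) \<times> env_seqs G"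

subsection \<open>Metrics\<close>

definition weighted_pair_dist ::
    "('a \<Rightarrow> 'a \<Rightarrow> real) \<Rightarrow> ('b \<Rightarrow> 'b \<Rightarrow> real) \<Rightarrow> 'a \<times> 'b \<Rightarrow> 'a \<times> 'b \<Rightarrow> real"
  where "weighted_pair_dist m m' p q =
    m (fst p) (fst q) / (1 + m (fst p) (fst q))
    + (1/2) * (m' (snd p) (snd q) / (1 + m' (snd p) (snd q)))"

definition weighted_seq_dist :: "nat set \<Rightarrow> (nat \<Rightarrow> 'a::metric_space) \<Rightarrow> (nat \<Rightarrow> 'a) \<Rightarrow> real"
  where "weighted_seq_dist I a b =
    (\<Sum>\<^sub>\<infinity>t\<in>I. (1/2) ^ t * (dist (a t) (b t) / (1 + dist (a t) (b t))))"

definition hist_dist where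
  "hist_dist G = weighted_pair_dist
     (weighted_pair_dist (weighted_seq_dist (state_times G)) (weighted_seq_dist (ctrl_times G)))
     (weighted_seq_dist (ctrl_times G))"

definition prokhorov :: "('a \<Rightarrow> 'a \<Rightarrow> real) \<Rightarrow> 'a measure \<Rightarrow> 'a measure \<Rightarrow> real"
  where "prokhorov m \<mu> \<nu> = Inf {\<epsilon>. \<epsilon> > 0 \<and>
    (\<forall>B\<in>sets \<mu>. measure \<mu> B \<le> measure \<nu> {a \<in> space \<nu>. \<exists>b\<in>B. m b a < \<epsilon>} + \<epsilon>)}"

subsection \<open>Dynamics and costs\<close>

text \<open>
  State of the game with N decision makers at time t under the joint pure strategy s at the
  sample point z: the environment state at time t, the states up to time t, and the controls and
  environment variables before time t.
\<close>

primrec play where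
  "play G N s z 0 =
     (env_init G z, \<lambda>i. (\<lambda>_. undefined)(0 := init G i z), \<lambda>i _. undefined, \<lambda>_. undefined)"
| "play G N s z (Suc t) =
     (case play G N s z t of (x0, x, u, y) \<Rightarrow>
       let ut = (\<lambda>i. apply_bcontfun (s i t) ((x i, u i), y));
           d = aggr G N t (\<lambda>i\<in>{1..N}. x i t, \<lambda>i\<in>{1..N}. ut i);
           yt = env_out G t (x0, d, out_noise G t z)
       in (env_dyn G t (x0, d, env_noise G t z),
           \<lambda>i. (x i)(Suc t := dyn G i t (x i t, ut i, yt, noise G i t z)),
           \<lambda>i. (u i)(t := ut i),
           y(t := yt)))"

definition state where "state G N s z i t = (case play G N s z t of (x0, x, u, y) \<Rightarrow> x i t)"

definition control where
  "control G N s z i t = (case play G N s z (Suc t) of (x0, x, u, y) \<Rightarrow> u i t)"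

definition env_var where
  "env_var G N s z t = (case play G N s z (Suc t) of (x0, x, u, y) \<Rightarrow> y t)"

definition env_path where "env_path G N s z = (\<lambda>t\<in>ctrl_times G. env_var G N s z t)"

definition hist_path where
  "hist_path G N s z i =
     ((\<lambda>t\<in>state_times G. state G N s z i t, \<lambda>t\<in>ctrl_times G. control G N s z i t), env_path G N s z)"

definition terminal_cost where
  "terminal_cost G i x = (case horizon G of enat n \<Rightarrow> discount G i ^ n * tcost G i (x n) | \<infinity> \<Rightarrow> 0)"

definition path_cost where
  "path_cost G i x u y =
     (\<Sum>\<^sub>\<infinity>t\<in>ctrl_times G. discount G i ^ t * cost G i t (x t, u t, y t)) + terminal_cost G i x"

definition game_cost where
  "game_cost G N i s = (\<integral>z. path_cost G i (state G N s z i) (control G N s z i) (env_var G N s z)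
                           \<partial>prob_sp G)"

text \<open>
  A single decision maker facing the exogenous sequence zs: the states up to time t and the
  controls before time t.
\<close>

primrec solo where
  "solo G i si zs z 0 = ((\<lambda>_. undefined)(0 := init G i z), \<lambda>_. undefined)"
| "solo G i si zs z (Suc t) =
     (case solo G i si zs z t of (x, u) \<Rightarrow>
       let ut = apply_bcontfun (si t) ((x, u), \<lambda>k\<in>{..<t}. zs k)
       in (x(Suc t := dyn G i t (x t, ut, zs t, noise G i t z)), u(t := ut)))"

definition solo_cost where
  "solo_cost G i si zs =
     (\<integral>z. path_cost G i (\<lambda>t. fst (solo G i si zs z t) t) (\<lambda>t. snd (solo G i si zs z (Suc t)) t) zs
        \<partial>prob_sp G)"

subsection \<open>Mixed strategies and equilibria\<close>

definition mixed where
  "mixed G i = {\<gamma>. prob_space \<gamma> \<and> sets \<gamma> = sets (restrict_space borel (pures G i))}"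

definition joint_space where "joint_space G N \<gamma> = Pi\<^sub>M {1..N} \<gamma> \<Otimes>\<^sub>M prob_sp G"

definition hist_law where
  "hist_law G N \<gamma> i = distr (joint_space G N \<gamma>) (restrict_space borel (histories G))
     (\<lambda>(s, z). hist_path G N s z i)"

definition env_law where
  "env_law G N \<gamma> = distr (joint_space G N \<gamma>) (restrict_space borel (env_seqs G))
     (\<lambda>(s, z). env_path G N s z)"

definition mixed_game_cost where
  "mixed_game_cost G N i \<gamma> = (\<integral>s. game_cost G N i s \<partial>Pi\<^sub>M {1..N} \<gamma>)"

definition mixed_solo_cost where
  "mixed_solo_cost G i \<gamma>i \<zeta> = (\<integral>zs. (\<integral>si. solo_cost G i si zs \<partial>\<gamma>i) \<partial>\<zeta>)"

definition sebeu where
  "sebeu G N \<gamma> \<longleftrightarrow> (\<forall>i\<in>{1..N}. \<gamma> i \<in> mixed G i) \<and>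
     (\<forall>i\<in>{1..N}. \<forall>\<gamma>'\<in>mixed G i.
        mixed_solo_cost G i (\<gamma> i) (env_law G N \<gamma>) \<le> mixed_solo_cost G i \<gamma>' (env_law G N \<gamma>))"

definition joint_mixed_inf where "joint_mixed_inf G \<gamma> \<longleftrightarrow> (\<forall>i\<ge>1. \<gamma> i \<in> mixed G i)"

definition cost_inf where
  "cost_inf G i \<gamma> = limsup (\<lambda>N. ereal (mixed_game_cost G N i \<gamma>))"

definition nash_inf where
  "nash_inf G \<gamma> \<longleftrightarrow> joint_mixed_inf G \<gamma> \<and>
     (\<forall>i\<ge>1. \<forall>\<gamma>'\<in>mixed G i. cost_inf G i \<gamma> \<le> cost_inf G i (\<gamma>(i := \<gamma>')))"

subsection \<open>Standing assumptions and conditions\<close>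

definition valid_games ::
    "('x::metric_space, 'u::metric_space, 'w::metric_space, 'x0::metric_space,
      'w0::metric_space, 'y::metric_space, 'k::metric_space, 'd::metric_space, 'z) game_seq \<Rightarrow> bool"
  where "valid_games G \<longleftrightarrow>
    horizon G > 0 \<and>
    compact (UNIV :: 'd set) \<and>
    prob_space (prob_sp G) \<and>
    env_init G \<in> borel_measurable (prob_sp G) \<and>
    (\<forall>t\<in>ctrl_times G. env_noise G t \<in> borel_measurable (prob_sp G)
       \<and> out_noise G t \<in> borel_measurable (prob_sp G)) \<and>
    (\<forall>i\<ge>1. init G i \<in> borel_measurable (prob_sp G)) \<and>
    (\<forall>i\<ge>1. \<forall>t\<in>ctrl_times G. noise G i t \<in> borel_measurable (prob_sp G)) \<and>
    (\<forall>i\<ge>1. 0 < discount G i \<and> discount G i \<le> 1) \<and>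
    (horizon G = \<infinity> \<longrightarrow> (\<forall>i\<ge>1. discount G i < 1 \<and> (\<forall>x. tcost G i x = 0))) \<and>
    (\<forall>i\<ge>1. \<forall>t\<in>ctrl_times G. strats G i t \<subseteq> strategy_maps t)"

text \<open>
  On finite products of spaces, \<^term>\<open>dist\<close> is the library's Euclidean product metric, which is
  uniformly equivalent to the weighted one, so that uniform equicontinuity is unaffected.
\<close>

definition unif_equicont :: "'i set \<Rightarrow> ('i \<Rightarrow> 'a::metric_space \<Rightarrow> 'b::metric_space) \<Rightarrow> bool"
  where "unif_equicont I F \<longleftrightarrow>
    (\<forall>\<epsilon>>0. \<exists>\<delta>>0. \<forall>i\<in>I. \<forall>p q. dist p q < \<delta> \<longrightarrow> dist (F i p) (F i q) < \<epsilon>)"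

definition A1 ::
    "('x::metric_space, 'u::metric_space, 'w::metric_space, 'x0::metric_space,
      'w0::metric_space, 'y::metric_space, 'k::metric_space, 'd::metric_space, 'z) game_seq \<Rightarrow> bool"
  where "A1 G \<longleftrightarrow>
    compact (UNIV :: 'x0 set) \<and> compact (UNIV :: 'w0 set) \<and> compact (UNIV :: 'y set) \<and>
    compact (UNIV :: 'k set) \<and>
    compact (UNIV :: 'x set) \<and> compact (UNIV :: 'u set) \<and> compact (UNIV :: 'w set) \<and>
    (\<forall>i\<ge>1. \<forall>t\<in>ctrl_times G. continuous_on UNIV (cost G i t) \<and> continuous_on UNIV (dyn G i t)) \<and>
    (\<forall>i\<ge>1. continuous_on UNIV (tcost G i)) \<and>
    (\<forall>t\<in>ctrl_times G. continuous_on UNIV (env_dyn G t) \<and> continuous_on UNIV (env_out G t)) \<and>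
    (\<forall>i\<ge>1. \<forall>t\<in>ctrl_times G. strats G i t \<noteq> {} \<and> compact (strats G i t)) \<and>
    (\<forall>i\<ge>1. pures G i = pures G 1) \<and>
    (\<forall>t\<in>ctrl_times G. unif_equicont {1..} (\<lambda>i. cost G i t) \<and> unif_equicont {1..} (\<lambda>i. dyn G i t)) \<and>
    unif_equicont {1..} (tcost G) \<and>
    (\<exists>C. (\<forall>i\<ge>1. \<forall>t\<in>ctrl_times G. \<forall>p. \<bar>cost G i t p\<bar> < C) \<and> (\<forall>i\<ge>1. \<forall>x. \<bar>tcost G i x\<bar> < C)) \<and>
    (\<exists>b<1. \<forall>i\<ge>1. discount G i < b)"

definition A2 where
  "A2 G \<longleftrightarrow>
    (\<forall>t\<in>ctrl_times G. \<forall>\<epsilon>>0. \<exists>\<delta>>0. \<forall>N\<ge>1. \<forall>(x, u)\<in>joint_acts N. \<forall>(x', u')\<in>joint_acts N.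
       (SUP i\<in>{1..N}. weighted_pair_dist dist dist (x i, u i) (x' i, u' i)) < \<delta>
         \<longrightarrow> dist (aggr G N t (x, u)) (aggr G N t (x', u')) < \<epsilon>) \<and>
    (\<forall>t\<in>ctrl_times G. (\<lambda>N. SUP i\<in>{1..N}.
       SUP (p, q) \<in> {((x, u), (x', u')). (x, u) \<in> joint_acts N \<and> (x', u') \<in> joint_acts N \<and>
                        (\<forall>j\<in>{1..N} - {i}. x j = x' j \<and> u j = u' j)}.
         dist (aggr G N t p) (aggr G N t q)) \<longlonglongrightarrow> 0)"

text \<open>
  The random variables whose independence is required take values in different spaces, so
  independence is stated for the generated sigma-algebras; index 0 is the environment.
\<close>

definition generated where "generated M X = {X -` A \<inter> space M | A. A \<in> sets borel}"

definition A3 where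
  "A3 G \<longleftrightarrow> prob_space.indep_sets (prob_sp G)
     (\<lambda>i. if i = 0
        then generated (prob_sp G)
               (\<lambda>z. (env_init G z, \<lambda>t\<in>ctrl_times G. env_noise G t z, \<lambda>t\<in>ctrl_times G. out_noise G t z))
        else generated (prob_sp G) (\<lambda>z. (init G i z, \<lambda>t\<in>ctrl_times G. noise G i t z)))
     (UNIV :: nat set)"

end

theory Submission
  imports Defs
begin

text \<open>
  Freeze decision maker i, i.e. replace its initial state, disturbances and strategy by constants.
  By (A2) and the equicontinuity of the dynamics and of the strategies, an induction
  on time shows that this changes the environment variables by an amount that tends to 0 with the
  number N of decision makers, uniformly in the sample point and in all strategies. By (A3) the
  frozen environment variables are independent of the strategy and the disturbances of i. Hence
  both the true expected cost of i and the cost that i subjectively expects against the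
  distribution of the environment variables are close to the mean cost against the frozen
  environment, which does not change when i deviates. The Prokhorov convergence of the laws of the
  histories makes the costs under the SEBEU and under the limit profile asymptotically equal, so
  that optimality of the SEBEU carries over to the limit.
\<close>

subsection \<open>Metrics and the Prokhorov distance\<close>

text \<open>The convergence hypothesis concerns undeviated histories only; about the laws after a
  deviation of i it says nothing. The deviation is therefore never played along the SEBEU profiles:
  it is evaluated against their environment law, where its cost is the integral of one fixed
  function of the environment path, so that Prokhorov convergence applies. It meets the true game
  only under the limit profile, through \<open>frozen_mean\<close>. The SEBEU strategies, in
  contrast, change with N, so every comparison has to be uniform in the strategies: compactness of
  the strategy sets is turned into equicontinuity, and thresholds on N are chosen before the
  profiles. With an infinite horizon only finitely many times can be controlled at once; the filter
  \<open>seq_uniformity\<close> records this kind of closeness, and discounting makes it sufficient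
  for costs. Convergence of integrals is derived from the definition of the Prokhorov distance by
  comparing level sets.\<close>

text \<open>The map r / (1 + r) is increasing on the nonnegative reals, so its value at e is a
  threshold. This turns smallness in the bounded product metrics back into smallness of the
  underlying distances.\<close>

lemma fraction_le_imp_small:
  fixes e :: real
  assumes "e > 0"
  shows "\<exists>d>0. \<forall>r\<ge>0. r / (1 + r) < d \<longrightarrow> r < e"
proof (intro exI conjI allI impI)
  show "e / (1 + e) > 0" using assms by simp
  fix r :: real assume "0 \<le> r" "r / (1 + r) < e / (1 + e)"
  then show "r < e" using assms by (auto simp: field_simps)
qed

text \<open>The arguments \<open>m\<close> and \<open>m'\<close> are arbitrary functions so that the
  lemma can be nested; nonnegativity at the pair in question is therefore a premise.\<close>

lemma weighted_pair_dist_small: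
  fixes e :: real and m :: "'a \<Rightarrow> 'a \<Rightarrow> real" and m' :: "'c \<Rightarrow> 'c \<Rightarrow> real"
  assumes "e > 0"
  shows "\<exists>d>0. \<forall>p q. 0 \<le> m (fst p) (fst q) \<and> 0 \<le> m' (snd p) (snd q)
    \<and> weighted_pair_dist m m' p q < d
    \<longrightarrow> m (fst p) (fst q) < e \<and> m' (snd p) (snd q) < e"
proof -
  obtain d where d: "d > 0" "\<And>r. r \<ge> 0 \<Longrightarrow> r / (1 + r) < d \<Longrightarrow> r < e"
    using fraction_le_imp_small[OF assms] by blast
  \<comment> \<open>The second component carries weight 1/2, hence half of the threshold
    \<open>d\<close>.\<close>
  show ?thesis
  proof (intro exI[of _ "d / 2"] conjI allI impI)
    fix p q
    assume "0 \<le> m (fst p) (fst q) \<and> 0 \<le> m' (snd p) (snd q) \<and> weighted_pair_dist m m' p q < d / 2"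
    then have *: "0 \<le> m (fst p) (fst q)" "0 \<le> m' (snd p) (snd q)" "weighted_pair_dist m m' p q < d / 2"
      by auto
    then have "m (fst p) (fst q) / (1 + m (fst p) (fst q)) \<ge> 0"
      "m' (snd p) (snd q) / (1 + m' (snd p) (snd q)) \<ge> 0" by simp_all
    then have "m (fst p) (fst q) / (1 + m (fst p) (fst q)) < d"
      "m' (snd p) (snd q) / (1 + m' (snd p) (snd q)) < d"
      using *(3) d(1) unfolding weighted_pair_dist_def by linarith+
    with d * show "m (fst p) (fst q) < e" "m' (snd p) (snd q) < e" by auto
  qed (use d in auto)
qed

text \<open>An \<open>infsum\<close> over a family that is not summable is 0 by convention; only
  with summability does a single term bound \<open>weighted_seq_dist\<close> from below.\<close>

lemma weighted_seq_dist_summable: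
  fixes a b :: "nat \<Rightarrow> 'a::metric_space"
  shows "(\<lambda>t. (1/2) ^ t * (dist (a t) (b t) / (1 + dist (a t) (b t)))) summable_on I"
proof -
  have "(\<lambda>t. (1/2::real) ^ t) summable_on UNIV"
    by (rule norm_summable_imp_summable_on) (simp add: summable_geometric)
  then have "(\<lambda>t. (1/2::real) ^ t) summable_on I"
    by (rule summable_on_subset_banach) auto
  then show ?thesis
  proof (rule summable_on_comparison_test)
    fix t
    have "dist (a t) (b t) / (1 + dist (a t) (b t)) \<le> 1"
      using zero_le_dist[of "a t" "b t"] by (subst divide_le_eq_1_pos) linarith+
    then show "(1/2) ^ t * (dist (a t) (b t) / (1 + dist (a t) (b t))) \<le> (1/2) ^ t"
      using mult_left_mono[of _ 1 "(1/2) ^ t :: real"] by fastforce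
  qed simp
qed

lemma weighted_seq_dist_nonneg: "0 \<le> weighted_seq_dist I a b"
  unfolding weighted_seq_dist_def by (rule infsum_nonneg) simp

lemma weighted_seq_dist_ge:
  assumes "t \<in> I"
  shows "(1/2) ^ t * (dist (a t) (b t) / (1 + dist (a t) (b t))) \<le> weighted_seq_dist I a b"
proof -
  have "infsum (\<lambda>t. (1/2) ^ t * (dist (a t) (b t) / (1 + dist (a t) (b t)))) {t} \<le> weighted_seq_dist I a b"
    unfolding weighted_seq_dist_def
    by (rule infsum_mono_neutral) (use assms weighted_seq_dist_summable in auto)
  then show ?thesis by simp
qed

lemma weighted_seq_dist_small:
  fixes e :: real
  assumes "e > 0"
  shows "\<exists>d>0. \<forall>I (a::nat\<Rightarrow>'a::metric_space) b. weighted_seq_dist I a b < d \<longrightarrow> (\<forall>t\<in>I. t \<le> n \<longrightarrow> dist (a t) (b t) < e)"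
proof -
  obtain d where d: "d > 0" "\<And>r. r \<ge> 0 \<Longrightarrow> r / (1 + r) < d \<Longrightarrow> r < e"
    using fraction_le_imp_small[OF assms] by blast
  \<comment> \<open>The smallest weight among the coordinates up to n is (1/2)^n.\<close>
  show ?thesis
  proof (intro exI[of _ "(1/2)^n * d"] conjI allI impI ballI)
    fix I :: "nat set" and a b :: "nat \<Rightarrow> 'a" and t
    assume w: "weighted_seq_dist I a b < (1/2)^n * d" and t: "t \<in> I" "t \<le> n"
    let ?r = "dist (a t) (b t) / (1 + dist (a t) (b t))"
    have "(1/2)^n * ?r \<le> (1/2)^t * ?r"
      using t by (intro mult_right_mono power_decreasing) auto
    also have "\<dots> < (1/2)^n * d" using weighted_seq_dist_ge[OF t(1), of a b] w by simp
    finally have "?r < d" by (subst (asm) mult_less_cancel_left_pos) auto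
    then show "dist (a t) (b t) < e" using d by auto
  qed (use d in auto)
qed

lemma weighted_pair_seq_dist_nonneg:
  "0 \<le> weighted_pair_dist (weighted_seq_dist I) (weighted_seq_dist J) p q"
  unfolding weighted_pair_dist_def by (auto intro!: add_nonneg_nonneg divide_nonneg_nonneg weighted_seq_dist_nonneg)

text \<open>Uniform continuity of costs is established in terms of finitely many coordinates; this
  translates it to the metric that the Prokhorov distance uses.\<close>

lemma hist_dist_small:
  fixes e :: real
    and G :: "('x::metric_space, 'u::metric_space,
      'w::metric_space, 'x0::metric_space, 'w0::metric_space, 'y::metric_space, 'k::metric_space, 'd::metric_space, 'z) game_seq"
  assumes "e > 0"
  shows "\<exists>d>0. \<forall>(x::nat \<Rightarrow> 'x) (u::nat \<Rightarrow> 'u) (y::nat \<Rightarrow> 'y) x' u' y'. hist_dist G ((x,u),y) ((x',u'),y') < d \<longrightarrow>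
    (\<forall>t\<in>state_times G. t \<le> n \<longrightarrow> dist (x t) (x' t) < e) \<and>
    (\<forall>t\<in>ctrl_times G. t \<le> n \<longrightarrow> dist (u t) (u' t) < e \<and> dist (y t) (y' t) < e)"
proof -
  obtain dx where dx: "dx > 0" "\<And>I (a::nat\<Rightarrow>'x) b. weighted_seq_dist I a b < dx \<longrightarrow> (\<forall>t\<in>I. t \<le> n \<longrightarrow> dist (a t) (b t) < e)"
    using weighted_seq_dist_small[OF assms, where 'a='x] by metis
  obtain du where du: "du > 0" "\<And>I (a::nat\<Rightarrow>'u) b. weighted_seq_dist I a b < du \<longrightarrow> (\<forall>t\<in>I. t \<le> n \<longrightarrow> dist (a t) (b t) < e)"
    using weighted_seq_dist_small[OF assms, where 'a='u] by metis
  obtain dy where dy: "dy > 0" "\<And>I (a::nat\<Rightarrow>'y) b. weighted_seq_dist I a b < dy \<longrightarrow> (\<forall>t\<in>I. t \<le> n \<longrightarrow> dist (a t) (b t) < e)"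
    using weighted_seq_dist_small[OF assms, where 'a='y] by metis
  define S where "S = (weighted_seq_dist (state_times G) :: (nat \<Rightarrow> 'x) \<Rightarrow> _)"
  define C where "C = (weighted_seq_dist (ctrl_times G) :: (nat \<Rightarrow> 'u) \<Rightarrow> _)"
  define Y where "Y = (weighted_seq_dist (ctrl_times G) :: (nat \<Rightarrow> 'y) \<Rightarrow> _)"
  have "min dx du > 0" using dx du by simp
  from weighted_pair_dist_small[OF this, of S C] obtain d1 where d1: "d1 > 0"
    "\<And>p q. 0 \<le> S (fst p) (fst q) \<and> 0 \<le> C (snd p) (snd q)
    \<and> weighted_pair_dist S C p q < d1 \<Longrightarrow> S (fst p) (fst q) < min dx du \<and> C (snd p) (snd q) < min dx du"
    by blast
  have "min d1 dy > 0" using d1 dy by simp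
  from weighted_pair_dist_small[OF this, of "weighted_pair_dist S C" Y] obtain d2 where d2: "d2 > 0"
    "\<And>p q. 0 \<le> weighted_pair_dist S C (fst p) (fst q) \<and> 0 \<le> Y (snd p) (snd q)
    \<and> weighted_pair_dist (weighted_pair_dist S C) Y p q < d2 \<Longrightarrow> 
    weighted_pair_dist S C (fst p) (fst q) < min d1 dy \<and> Y (snd p) (snd q) < min d1 dy"
    by blast
  show ?thesis
  proof (intro exI[of _ d2] conjI allI impI)
    show "d2 > 0" by fact
    fix x x' :: "nat \<Rightarrow> 'x" and u u' :: "nat \<Rightarrow> 'u" and y y' :: "nat \<Rightarrow> 'y"
    assume h: "hist_dist G ((x,u),y) ((x',u'),y') < d2"
    then have "weighted_pair_dist (weighted_pair_dist S C) Y ((x,u),y) ((x',u'),y') < d2"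
      unfolding hist_dist_def S_def C_def Y_def .
    then have a: "weighted_pair_dist S C (x,u) (x',u') < d1" "Y y y' < dy"
      using d2(2)[of "((x,u),y)" "((x',u'),y')"]
      by (auto simp: S_def C_def Y_def weighted_pair_seq_dist_nonneg weighted_seq_dist_nonneg)
    have b: "S x x' < dx" "C u u' < du"
      using d1(2)[of "(x,u)" "(x',u')"] a(1)
      by (auto simp: S_def C_def weighted_seq_dist_nonneg)
    show "\<forall>t\<in>state_times G. t \<le> n \<longrightarrow> dist (x t) (x' t) < e"
      using b(1) dx(2) unfolding S_def by blast
    show "\<forall>t\<in>ctrl_times G. t \<le> n \<longrightarrow> dist (u t) (u' t) < e \<and> dist (y t) (y' t) < e"
      using b(2) a(2) du(2) dy(2) unfolding C_def Y_def by blast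
  qed
qed

section \<open>Integrals against laws that are close in the Prokhorov distance\<close>

text \<open>A discrete layer-cake formula: the sum counts the levels e, 2e, ..., Ke strictly below
  v, so e times the count is v rounded down to a multiple of e.\<close>

lemma layer_sum_bounds:
  fixes v e :: real
  assumes "e > 0" "0 \<le> v" "v \<le> e * real K"
  shows "e * (\<Sum>k\<in>{1..K}. of_bool (v > e * real k)) \<le> v"
    and "v \<le> e + e * (\<Sum>k\<in>{1..K}. of_bool (v > e * real k))"
proof -
  \<comment> \<open>The premise v \<le> e * K is not inherited by smaller K; truncating v at e * K
    gives a claim that can be proved by induction on K.\<close>
  have "(e * (\<Sum>k\<in>{1..K}. of_bool (v > e * real k)) \<le> min v (e * real K)) \<and>
    min v (e * real K) \<le> e + e * (\<Sum>k\<in>{1..K}. of_bool (v > e * real k))"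
  proof (induction K)
    case 0
    then show ?case using assms by (auto simp: min_def)
  next
    case (Suc K)
    show ?case
    proof (cases "v > e * real (Suc K)")
      case True
      have "e * real K \<le> e * real (Suc K)" using assms(1) by (intro mult_left_mono) auto
      with True have "v > e * real K" by linarith
      with True Suc show ?thesis by (auto simp: min_def distrib_left algebra_simps)
    next
      case F: False
      show ?thesis
      proof (cases "v > e * real K")
        case True
        have "(\<Sum>k\<in>{1..K}. of_bool (v > e * real k)) = (\<Sum>k\<in>{1..K}. 1::real)"
        proof (rule sum.cong)
          fix k assume "k \<in> {1..K}"
          then have "e * real k \<le> e * real K" using assms(1) by simp
          with True show "of_bool (v > e * real k) = (1::real)" by simp
        qed simp
        then show ?thesis using F True by (auto simp: min_def algebra_simps)
      next
        case False
        then show ?thesis using F Suc assms by (auto simp: min_def algebra_simps)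
      qed
    qed
  qed
  with assms show "e * (\<Sum>k\<in>{1..K}. of_bool (v > e * real k)) \<le> v"
    "v \<le> e + e * (\<Sum>k\<in>{1..K}. of_bool (v > e * real k))" by (auto simp: min_def)
qed

lemma prokhorov_less_imp:
  assumes "prob_space \<mu>" "prokhorov m \<mu> \<nu> < d"
  obtains e where "0 < e" "e < d"
    "\<And>B. B \<in> sets \<mu> \<Longrightarrow> measure \<mu> B \<le> measure \<nu> {a \<in> space \<nu>. \<exists>b\<in>B. m b a < e} + e"
proof -
  let ?S = "{\<epsilon>. \<epsilon> > 0 \<and>
    (\<forall>B\<in>sets \<mu>. measure \<mu> B \<le> measure \<nu> {a \<in> space \<nu>. \<exists>b\<in>B. m b a < \<epsilon>} + \<epsilon>)}"
  \<comment> \<open>For probability measures the radius 1 always qualifies, so the infimum is taken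
    over a nonempty set and can be approached by its members.\<close>
  have "1 \<in> ?S" using prob_space.prob_le_1[OF assms(1)] by (auto intro!: add_increasing)
  then obtain e where "e \<in> ?S" "e < d"
    using cInf_lessD[of ?S d] assms(2) unfolding prokhorov_def by blast
  then show thesis using that by auto
qed

text \<open>A point within distance r < d of the level set F > e * k has F > e * (k - 1). So the
  defining inequality compares the k-th layer under \<open>\<mu>\<close> with the (k-1)-st under
  \<open>\<nu>\<close>. The error 3 * e is made of e for rounding to layers, e for the additive
  errors r of all K layers (K * r \<le> 1), and e for the shift of the index.\<close>

lemma prokhorov_integral_le:
  fixes F :: "'a \<Rightarrow> real"
  assumes \<mu>: "prob_space \<mu>" and \<nu>: "prob_space \<nu>"
    and F: "F \<in> borel_measurable \<mu>" "F \<in> borel_measurable \<nu>"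
    and bd: "\<And>a. a \<in> space \<mu> \<Longrightarrow> 0 \<le> F a \<and> F a \<le> e * real K" "\<And>a. a \<in> space \<nu> \<Longrightarrow> 0 \<le> F a \<and> F a \<le> e * real K"
    and e: "e > 0" and d: "d > 0"
    and uc: "\<And>a b. a \<in> space \<mu> \<Longrightarrow> b \<in> space \<nu> \<Longrightarrow> m a b < d \<Longrightarrow> \<bar>F a - F b\<bar> < e"
    and p: "prokhorov m \<mu> \<nu> < d" "real K * prokhorov m \<mu> \<nu> < 1"
  shows "(\<integral>a. F a \<partial>\<mu>) \<le> (\<integral>a. F a \<partial>\<nu>) + 3 * e"
proof (cases "K = 0")
  \<comment> \<open>Treated separately because the bound \<open>1 / real K\<close> on the radius
    below requires K to be positive.\<close>
  case True
  then have "F a = 0" if "a \<in> space \<mu> \<or> a \<in> space \<nu>" for a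
    using bd[of a] that by auto
  then have "(\<integral>a. F a \<partial>\<mu>) = (\<integral>a. 0 \<partial>\<mu>)" "(\<integral>a. F a \<partial>\<nu>) = (\<integral>a. 0 \<partial>\<nu>)"
    by - (rule Bochner_Integration.integral_cong; simp)+
  then show ?thesis using e by simp
next
  case False
  interpret M: prob_space \<mu> by fact
  interpret N: prob_space \<nu> by fact
  from p False have "prokhorov m \<mu> \<nu> < min d (1 / real K)" by (simp add: field_simps)
  from prokhorov_less_imp[OF \<mu> this] obtain r where r: "0 < r" "r < d" "r < 1 / real K"
    "\<And>B. B \<in> sets \<mu> \<Longrightarrow> measure \<mu> B \<le> measure \<nu> {a \<in> space \<nu>. \<exists>b\<in>B. m b a < r} + r"
    by (auto)
  have le: "measure \<mu> {a \<in> space \<mu>. F a > e * real k} \<le> measure \<nu> {a \<in> space \<nu>. F a > e * (real k - 1)} + r" for k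
  proof -
    have "measure \<mu> {a \<in> space \<mu>. F a > e * real k} \<le> measure \<nu> {a \<in> space \<nu>. \<exists>b\<in>{a \<in> space \<mu>. F a > e * real k}. m b a < r} + r"
      by (rule r(4)) (use F in measurable)
    also have "measure \<nu> {a \<in> space \<nu>. \<exists>b\<in>{a \<in> space \<mu>. F a > e * real k}. m b a < r}
      \<le> measure \<nu> {a \<in> space \<nu>. F a > e * (real k - 1)}"
    proof (rule N.finite_measure_mono)
      \<comment> \<open>Monotonicity asks for measurability of the larger set only; nothing is
        claimed about the neighbourhood itself.\<close>
      show "{a \<in> space \<nu>. F a > e * (real k - 1)} \<in> sets \<nu>" using F by measurable
      show "{a \<in> space \<nu>. \<exists>b\<in>{a \<in> space \<mu>. F a > e * real k}. m b a < r} \<subseteq> {a \<in> space \<nu>. F a > e * (real k - 1)}"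
      proof safe
        fix a b assume "a \<in> space \<nu>" "b \<in> space \<mu>" "m b a < r" "F b > e * real k"
        then have "\<bar>F b - F a\<bar> < e" using uc r by auto
        with \<open>F b > e * real k\<close> show "F a > e * (real k - 1)" by (simp add: algebra_simps)
      qed
    qed
    finally show ?thesis by simp
  qed
  have int: "integrable \<mu> F" "integrable \<nu> F"
    using F bd by (auto intro!: M.integrable_const_bound[where B="e * real K"] N.integrable_const_bound[where B="e * real K"])
  have intb [simp]: "integrable \<mu> (\<lambda>a. of_bool (F a > c) :: real)" "integrable \<nu> (\<lambda>a. of_bool (F a > c) :: real)" for c
    using F by (auto intro!: M.integrable_const_bound[where B=1] N.integrable_const_bound[where B=1])
  have eqm: "(\<integral>a. of_bool (F a > c) \<partial>\<mu>) = measure \<mu> {a \<in> space \<mu>. F a > c}" 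
    "(\<integral>a. of_bool (F a > c) \<partial>\<nu>) = measure \<nu> {a \<in> space \<nu>. F a > c}" for c
  proof -
    have "(\<integral>a. of_bool (F a > c) \<partial>\<mu>) = (\<integral>a. indicator {a \<in> space \<mu>. F a > c} a \<partial>\<mu>)"
      by (intro Bochner_Integration.integral_cong) (auto simp: indicator_def)
    also have "\<dots> = measure \<mu> ({a \<in> space \<mu>. F a > c} \<inter> space \<mu>)" by (rule Bochner_Integration.integral_indicator)
    also have "{a \<in> space \<mu>. F a > c} \<inter> space \<mu> = {a \<in> space \<mu>. F a > c}" by auto
    finally show "(\<integral>a. of_bool (F a > c) \<partial>\<mu>) = measure \<mu> {a \<in> space \<mu>. F a > c}" .
    have "(\<integral>a. of_bool (F a > c) \<partial>\<nu>) = (\<integral>a. indicator {a \<in> space \<nu>. F a > c} a \<partial>\<nu>)"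
      by (intro Bochner_Integration.integral_cong) (auto simp: indicator_def)
    also have "\<dots> = measure \<nu> ({a \<in> space \<nu>. F a > c} \<inter> space \<nu>)" by (rule Bochner_Integration.integral_indicator)
    also have "{a \<in> space \<nu>. F a > c} \<inter> space \<nu> = {a \<in> space \<nu>. F a > c}" by auto
    finally show "(\<integral>a. of_bool (F a > c) \<partial>\<nu>) = measure \<nu> {a \<in> space \<nu>. F a > c}" .
  qed
  have ints: "integrable \<mu> (\<lambda>a. \<Sum>k\<in>{1..K}. of_bool (F a > e * real k) :: real)"
    "integrable \<nu> (\<lambda>a. \<Sum>k\<in>{1..K}. of_bool (F a > e * real k) :: real)"
    by (intro Bochner_Integration.integrable_sum intb)+
  have ints_eq: "(\<integral>a. (\<Sum>k\<in>{1..K}. of_bool (F a > e * real k)) \<partial>\<mu>) = (\<Sum>k\<in>{1..K}. measure \<mu> {a \<in> space \<mu>. F a > e * real k})"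
    "(\<integral>a. (\<Sum>k\<in>{1..K}. of_bool (F a > e * real k)) \<partial>\<nu>) = (\<Sum>k\<in>{1..K}. measure \<nu> {a \<in> space \<nu>. F a > e * real k})"
    by (subst Bochner_Integration.integral_sum, rule intb, simp only: eqm)+
  have "(\<integral>a. F a \<partial>\<mu>) \<le> (\<integral>a. e + e * (\<Sum>k\<in>{1..K}. of_bool (F a > e * real k)) \<partial>\<mu>)"
    using bd(1) by (intro integral_mono int layer_sum_bounds(2) e Bochner_Integration.integrable_add
        integrable_mult_right ints) auto
  also have "\<dots> = e + e * (\<Sum>k\<in>{1..K}. measure \<mu> {a \<in> space \<mu>. F a > e * real k})"
    using ints by (simp add: M.prob_space ints_eq eqm del: sum_of_bool_eq)
  also have "\<dots> \<le> e + e * (\<Sum>k\<in>{1..K}. measure \<nu> {a \<in> space \<nu>. F a > e * (real k - 1)} + r)"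
    using le e by (intro add_left_mono mult_left_mono sum_mono) auto
  also have "\<dots> = e + e * (real K * r) + e * (\<Sum>k\<in>{1..K}. measure \<nu> {a \<in> space \<nu>. F a > e * (real k - 1)})"
    by (simp add: sum.distrib algebra_simps)
  \<comment> \<open>The shifted sum starts at level 0; this extra term is at most 1, and the top
    level K is added back for free.\<close>
  also have "(\<Sum>k\<in>{1..K}. measure \<nu> {a \<in> space \<nu>. F a > e * (real k - 1)})
     = (\<Sum>k\<in>{0..<K}. measure \<nu> {a \<in> space \<nu>. F a > e * real k})"
    by (rule sum.reindex_bij_witness[of _ Suc "\<lambda>k. k - 1"]) (auto simp: of_nat_diff)
  also have "\<dots> \<le> 1 + (\<Sum>k\<in>{1..K}. measure \<nu> {a \<in> space \<nu>. F a > e * real k})"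
  proof -
    have "(\<Sum>k\<in>{0..<K}. measure \<nu> {a \<in> space \<nu>. F a > e * real k}) \<le> (\<Sum>k\<in>insert 0 {1..K}. measure \<nu> {a \<in> space \<nu>. F a > e * real k})"
      by (intro sum_mono2) auto
    also have "\<dots> = measure \<nu> {a \<in> space \<nu>. F a > e * real 0} + (\<Sum>k\<in>{1..K}. measure \<nu> {a \<in> space \<nu>. F a > e * real k})"
      by (subst sum.insert) auto
    also have "measure \<nu> {a \<in> space \<nu>. F a > e * real 0} \<le> 1" by (rule N.prob_le_1)
    finally show ?thesis by simp
  qed
  also have "e * (real K * r) \<le> e * 1" using r False e by (intro mult_left_mono) (auto simp: field_simps)
  also have "e + e * 1 + e * (1 + (\<Sum>k\<in>{1..K}. measure \<nu> {a \<in> space \<nu>. F a > e * real k}))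
    = 3 * e + (\<integral>a. e * (\<Sum>k\<in>{1..K}. of_bool (F a > e * real k)) \<partial>\<nu>)"
    by (simp add: ints_eq eqm algebra_simps del: sum_of_bool_eq)
  also have "(\<integral>a. e * (\<Sum>k\<in>{1..K}. of_bool (F a > e * real k)) \<partial>\<nu>) \<le> (\<integral>a. F a \<partial>\<nu>)"
    using bd(2) by (intro integral_mono int layer_sum_bounds(1) e integrable_mult_right ints) auto
  finally show ?thesis using e by simp
qed

text \<open>The inequality in \<open>prokhorov\<close> is one-sided in the two measures, so the
  preceding lemma is applied to both C + F and C - F, shifted by the bound on F to become
  nonnegative. The index N0 is there because the laws of decision maker i make sense only in games
  that contain i.\<close>

lemma prokhorov_tendsto_imp_integral:
  fixes F :: "'a \<Rightarrow> real"
  assumes \<mu>: "\<And>N. N \<ge> N0 \<Longrightarrow> prob_space (\<mu> N) \<and> prob_space (\<nu> N) \<and> sets (\<mu> N) = sets M \<and> sets (\<nu> N) = sets M"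
    and F: "F \<in> borel_measurable M"
    and bd: "\<And>a. a \<in> space M \<Longrightarrow> \<bar>F a\<bar> \<le> C"
    and uc: "\<And>e. e > 0 \<Longrightarrow> \<exists>d>0. \<forall>a\<in>space M. \<forall>b\<in>space M. m a b < d \<longrightarrow> \<bar>F a - F b\<bar> < e"
    and p: "(\<lambda>N. prokhorov m (\<mu> N) (\<nu> N)) \<longlonglongrightarrow> 0"
  shows "(\<lambda>N. (\<integral>a. F a \<partial>\<mu> N) - (\<integral>a. F a \<partial>\<nu> N)) \<longlonglongrightarrow> 0"
proof (rule LIMSEQ_I)
  fix r :: real assume "r > 0"
  \<comment> \<open>The one-sided estimates have error 3 * e, which is then strictly below
    r.\<close>
  define e where "e = r / 4"
  have e: "e > 0" using \<open>r > 0\<close> by (simp add: e_def)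
  obtain d where d: "d > 0" "\<And>a b. a\<in>space M \<Longrightarrow> b\<in>space M \<Longrightarrow> m a b < d \<Longrightarrow> \<bar>F a - F b\<bar> < e"
    using uc[OF e] by blast
  \<comment> \<open>The K layers of height e have to cover the range of the shifted function, which
    has length at most 2 * \<bar>C\<bar>.\<close>
  obtain K where K: "2 * \<bar>C\<bar> / e \<le> real K" using real_arch_simple by blast
  then have K: "2 * \<bar>C\<bar> \<le> e * real K" using e by (simp add: field_simps)
  have "eventually (\<lambda>N. prokhorov m (\<mu> N) (\<nu> N) < d \<and> real K * prokhorov m (\<mu> N) (\<nu> N) < 1 \<and> N \<ge> N0) sequentially"
  proof (intro eventually_conj)
    show "eventually (\<lambda>N. prokhorov m (\<mu> N) (\<nu> N) < d) sequentially"
      using order_tendstoD(2)[OF p d(1)] .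
    have "(\<lambda>N. real K * prokhorov m (\<mu> N) (\<nu> N)) \<longlonglongrightarrow> real K * 0" by (intro tendsto_intros p)
    then show "eventually (\<lambda>N. real K * prokhorov m (\<mu> N) (\<nu> N) < 1) sequentially"
      using order_tendstoD(2)[of _ "real K * 0" sequentially 1] by simp
  qed (rule eventually_ge_at_top)
  then obtain N1 where N1: "\<And>N. N \<ge> N1 \<Longrightarrow> prokhorov m (\<mu> N) (\<nu> N) < d \<and> real K * prokhorov m (\<mu> N) (\<nu> N) < 1 \<and> N \<ge> N0"
    unfolding eventually_sequentially by blast
  show "\<exists>no. \<forall>n\<ge>no. norm ((\<integral>a. F a \<partial>\<mu> n) - (\<integral>a. F a \<partial>\<nu> n) - 0) < r"
  proof (intro exI[of _ N1] allI impI)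
    fix n assume "n \<ge> N1"
    note n = N1[OF this]
    interpret M: prob_space "\<mu> n" using n \<mu> by auto
    interpret N: prob_space "\<nu> n" using n \<mu> by auto
    have sp: "space (\<mu> n) = space M" "space (\<nu> n) = space M"
      using n \<mu> by (auto intro!: sets_eq_imp_space_eq)
    have F': "F \<in> borel_measurable (\<mu> n)" "F \<in> borel_measurable (\<nu> n)"
      using F n \<mu> by (auto cong: measurable_cong_sets)
    have int: "integrable (\<mu> n) F" "integrable (\<nu> n) F"
      using F' bd sp by (auto intro!: M.integrable_const_bound[where B=C] N.integrable_const_bound[where B=C])
    have 1: "(\<integral>a. \<bar>C\<bar> + F a \<partial>\<mu> n) \<le> (\<integral>a. \<bar>C\<bar> + F a \<partial>\<nu> n) + 3 * e"
    proof (rule prokhorov_integral_le[where K = K and d = d and m = m])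
      show "0 \<le> \<bar>C\<bar> + F a \<and> \<bar>C\<bar> + F a \<le> e * real K" if "a \<in> space (\<mu> n)" for a
        using bd[of a] K that sp by (auto simp: abs_le_iff)
      show "0 \<le> \<bar>C\<bar> + F a \<and> \<bar>C\<bar> + F a \<le> e * real K" if "a \<in> space (\<nu> n)" for a
        using bd[of a] K that sp by (auto simp: abs_le_iff)
    qed (use n F' e d sp M.prob_space_axioms N.prob_space_axioms in auto)
    have 2: "(\<integral>a. \<bar>C\<bar> - F a \<partial>\<mu> n) \<le> (\<integral>a. \<bar>C\<bar> - F a \<partial>\<nu> n) + 3 * e"
    proof (rule prokhorov_integral_le[where K = K and d = d and m = m])
      show "0 \<le> \<bar>C\<bar> - F a \<and> \<bar>C\<bar> - F a \<le> e * real K" if "a \<in> space (\<mu> n)" for a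
        using bd[of a] K that sp by (auto simp: abs_le_iff)
      show "0 \<le> \<bar>C\<bar> - F a \<and> \<bar>C\<bar> - F a \<le> e * real K" if "a \<in> space (\<nu> n)" for a
        using bd[of a] K that sp by (auto simp: abs_le_iff)
      show "\<bar>\<bar>C\<bar> - F a - (\<bar>C\<bar> - F b)\<bar> < e" if "a \<in> space (\<mu> n)" "b \<in> space (\<nu> n)" "m a b < d" for a b
        using d(2)[of a b] that sp by auto
    qed (use n F' e d sp M.prob_space_axioms N.prob_space_axioms in auto)
    from 1 2 int show "norm ((\<integral>a. F a \<partial>\<mu> n) - (\<integral>a. F a \<partial>\<nu> n) - 0) < r"
      using e by (simp add: M.prob_space N.prob_space e_def abs_less_iff)
  qed
qed

section \<open>Closeness, compactness and evaluation in function spaces\<close>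

text \<open>The class metric on functions over \<open>nat\<close>, with respect to which strategies
  are uniformly continuous, is not \<open>weighted_seq_dist\<close>; it is reached through uniform
  closeness of all coordinates.\<close>

lemma dist_fun_small:
  fixes e :: real
  assumes "e > 0"
  shows "\<exists>d>0. \<forall>x y :: nat \<Rightarrow> 'a::metric_space. (\<forall>k. dist (x k) (y k) < d) \<longrightarrow> dist x y < e"
proof -
  obtain N where N: "(1/2::real) ^ N < e / 2" using real_arch_pow_inv[of "e/2" "1/2"] assms by auto
  \<comment> \<open>The first terms enter the bound \<open>dist_fun_le_dist_first_terms\<close> with
    factor 2; the choice e/4 leaves e/2 for the tail (1/2)^N.\<close>
  show ?thesis
  proof (intro exI[of _ "e/4"] conjI allI impI)
    fix x y :: "nat \<Rightarrow> 'a" assume h: "\<forall>k. dist (x k) (y k) < e / 4"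
    have "Max {dist (x (from_nat n)) (y (from_nat n)) |n. n \<le> N} < e / 4"
      using h by (subst Max_less_iff) auto
    then show "dist x y < e" using dist_fun_le_dist_first_terms[of x y N] N by linarith
  qed (use assms in auto)
qed

text \<open>Tychonoff's theorem, transferred from the product topology to the class topology on
  functions.\<close>

lemma compact_UNIV_fun:
  assumes "compact (UNIV :: 'a::topological_space set)"
  shows "compact (UNIV :: ('i \<Rightarrow> 'a) set)"
proof -
  have "compact_space (euclidean :: 'a topology)"
    using assms by (simp add: compact_space_def)
  then have "compact_space (product_topology (\<lambda>i::'i. (euclidean :: 'a topology)) UNIV)"
    by (simp add: compact_space_product_topology)
  then show ?thesis by (simp add: compact_space_def euclidean_product_topology)
qed

text \<open>Evaluation is continuous, but the space of bounded continuous functions need not be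
  second countable, so the pair of \<open>\<phi>\<close> and \<open>h\<close> is not known to be
  Borel measurable. Approximating \<open>h\<close> by simple functions reduces the claim to
  evaluation at countably many fixed points, which is continuous in the supremum metric.\<close>

lemma borel_measurable_apply_bcontfun:
  fixes \<phi> :: "'l \<Rightarrow> ('h::{metric_space, second_countable_topology} \<Rightarrow>\<^sub>C 'u::metric_space)"
  assumes \<phi>: "\<phi> \<in> borel_measurable L" and h: "h \<in> borel_measurable L"
  shows "(\<lambda>l. apply_bcontfun (\<phi> l) (h l)) \<in> borel_measurable L"
proof -
  obtain F where F: "\<And>i. simple_function L (F i)" "\<And>l. l \<in> space L \<Longrightarrow> (\<lambda>i. F i l) \<longlonglongrightarrow> h l"
    using borel_measurable_implies_sequence_metric[OF h] by blast
  show ?thesis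
  proof (rule borel_measurable_LIMSEQ_metric)
    fix i
    show "(\<lambda>l. apply_bcontfun (\<phi> l) (F i l)) \<in> borel_measurable L"
    proof (rule measurable_compose_countable'[where I = "F i ` space L"])
      show "F i \<in> measurable L (count_space (F i ` space L))"
        using F(1)[of i] by (simp add: simple_functionD(1) measurable_simple_function
            simple_function_def measurable_count_space_eq2)
      show "countable (F i ` space L)" using F(1)[of i] simple_functionD(1) countable_finite by blast
      fix c
      have "continuous_on UNIV (\<lambda>f :: 'h \<Rightarrow>\<^sub>C 'u. apply_bcontfun f c)"
      proof (clarsimp simp: continuous_on_iff)
        fix f :: "'h \<Rightarrow>\<^sub>C 'u" and e :: real assume "0 < e"
        then show "\<exists>d>0. \<forall>f'. dist f' f < d \<longrightarrow> dist (apply_bcontfun f' c) (apply_bcontfun f c) < e"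
          by (meson dist_bounded le_less_trans)
      qed
      then show "(\<lambda>l. apply_bcontfun (\<phi> l) c) \<in> borel_measurable L"
        using \<phi> by (intro measurable_compose[OF \<phi>] borel_measurable_continuous_onI)
    qed
  next
    fix l assume "l \<in> space L"
    then have "(\<lambda>i. F i l) \<longlonglongrightarrow> h l" by (rule F)
    moreover have "isCont (apply_bcontfun (\<phi> l)) (h l)"
      using continuous_on_eq_continuous_at[of UNIV] continuous_on_apply_bcontfun by blast
    ultimately show "(\<lambda>i. apply_bcontfun (\<phi> l) (F i l)) \<longlonglongrightarrow> apply_bcontfun (\<phi> l) (h l)"
      by (rule isCont_tendsto_compose[rotated])
  qed
qed

subsection \<open>Uniform continuity of the primitives\<close>

lemma finite_uniform_delta:
  fixes P :: "'a \<Rightarrow> real \<Rightarrow> bool"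
  assumes "finite F" "\<And>f. f \<in> F \<Longrightarrow> \<exists>d>0. P f d"
    and mono: "\<And>f d d'. P f d \<Longrightarrow> 0 < d' \<Longrightarrow> d' \<le> d \<Longrightarrow> P f d'"
  shows "\<exists>d>0. \<forall>f\<in>F. P f d"
  using assms(1,2)
proof (induction F)
  case (insert f F)
  then obtain d1 d2 where "d1 > 0" "d2 > 0" "P f d1" "\<forall>f\<in>F. P f d2" by (metis insertCI)
  then show ?case using mono by (intro exI[of _ "min d1 d2"]) (auto intro: mono[of _ d1] mono[of _ d2])
qed (auto intro: exI[of _ 1])

lemma dist_triple_le:
  "dist ((x, u), y) ((x', u'), y') \<le> dist x x' + dist u u' + dist y y'"
proof -
  have "dist ((x, u), y) ((x', u'), y') \<le> dist (x, u) (x', u') + dist y y'"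
    unfolding dist_Pair_Pair[of "(x,u)"] by (rule sqrt_sum_squares_le_sum) auto
  also have "dist (x, u) (x', u') \<le> dist x x' + dist u u'"
    unfolding dist_Pair_Pair by (rule sqrt_sum_squares_le_sum) auto
  finally show ?thesis by simp
qed

lemma dist_prod_le:
  "dist (a, b) (a', b') \<le> dist a a' + dist b b'"
  unfolding dist_Pair_Pair by (rule sqrt_sum_squares_le_sum) auto

text \<open>Extending the costs by zero beyond the control times gives an ordinary series, for
  finite and infinite horizons alike; measurability and the splitting of tails are then
  available.\<close>

lemma infsum_eq_suminf_geometric:
  fixes f :: "nat \<Rightarrow> real"
  assumes "\<And>n. n \<in> A \<Longrightarrow> \<bar>f n\<bar> \<le> C * b ^ n" "0 \<le> b" "b < 1" "0 \<le> C"
  shows "summable (\<lambda>n. \<bar>if n \<in> A then f n else 0\<bar>)"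
    and "infsum f A = (\<Sum>n. if n \<in> A then f n else 0)"
    and "\<bar>infsum f A\<bar> \<le> C / (1 - b)"
proof -
  let ?g = "\<lambda>n. if n \<in> A then f n else 0"
  have g: "summable (\<lambda>n. C * b ^ n)" using assms by (intro summable_mult summable_geometric) auto
  show s: "summable (\<lambda>n. \<bar>?g n\<bar>)"
    by (rule summable_comparison_test'[OF g, of 0]) (use assms in auto)
  have "infsum f A = infsum ?g UNIV" by (rule infsum_cong_neutral) auto
  moreover have "(?g has_sum suminf ?g) UNIV"
    by (rule norm_summable_imp_has_sum) (use s summable_rabs_cancel[OF s] in auto)
  ultimately show e: "infsum f A = suminf ?g" by (simp add: infsumI)
  have "\<bar>suminf ?g\<bar> \<le> (\<Sum>n. \<bar>?g n\<bar>)" by (rule summable_rabs[OF s])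
  also have "\<dots> \<le> (\<Sum>n. C * b ^ n)" by (rule suminf_le[OF _ s g]) (use assms in auto)
  also have "\<dots> = C / (1 - b)" using assms by (simp add: suminf_mult suminf_geometric summable_geometric)
  finally show "\<bar>infsum f A\<bar> \<le> C / (1 - b)" using e by simp
qed

text \<open>Condition (A3) enters as an explicit premise where independence is used; what is
  developed in the locale before that is pointwise in the sample point or concerns measurability and
  product measures.\<close>

locale game_sequence =
  fixes G :: "('x::{metric_space, second_countable_topology}, 'u::{metric_space, second_countable_topology},
      'w::{metric_space, second_countable_topology}, 'x0::{metric_space, second_countable_topology},
      'w0::{metric_space, second_countable_topology}, 'y::{metric_space, second_countable_topology},
      'k::{metric_space, second_countable_topology}, 'd::{metric_space, second_countable_topology},
      'z) game_seq"
  assumes valid: "valid_games G" and A1: "A1 G" and A2: "A2 G"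
begin

section \<open>Consequences of the standing assumptions\<close>

lemma compact_spaces:
  "compact (UNIV :: 'x set)" "compact (UNIV :: 'u set)" "compact (UNIV :: 'w set)"
  "compact (UNIV :: 'x0 set)" "compact (UNIV :: 'w0 set)" "compact (UNIV :: 'y set)"
  "compact (UNIV :: 'k set)" "compact (UNIV :: 'd set)"
  using A1 valid unfolding A1_def valid_games_def by - (elim conjE, assumption)+

lemma discount_bounds:
  assumes "i \<ge> 1"
  shows "0 < discount G i" "discount G i < 1"
proof -
  have "\<forall>i\<ge>1. 0 < discount G i \<and> discount G i \<le> 1"
    using valid unfolding valid_games_def by (elim conjE)
  moreover have "\<exists>b<1. \<forall>i\<ge>1. discount G i < b"
    using A1 unfolding A1_def by (elim conjE)
  ultimately show "0 < discount G i" "discount G i < 1" using assms less_trans by blast+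
qed

definition cost_bound :: real where
  "cost_bound = (SOME C. 0 < C \<and> (\<forall>i\<ge>1. \<forall>t\<in>ctrl_times G. \<forall>p. \<bar>cost G i t p\<bar> < C) \<and> (\<forall>i\<ge>1. \<forall>x. \<bar>tcost G i x\<bar> < C))"

lemma cost_bound: "0 < cost_bound"
  "i \<ge> 1 \<Longrightarrow> t \<in> ctrl_times G \<Longrightarrow> \<bar>cost G i t p\<bar> < cost_bound"
  "i \<ge> 1 \<Longrightarrow> \<bar>tcost G i x\<bar> < cost_bound"
proof -
  obtain C where C: "\<forall>i\<ge>1. \<forall>t\<in>ctrl_times G. \<forall>p. \<bar>cost G i t p\<bar> < C" "\<forall>i\<ge>1. \<forall>x. \<bar>tcost G i x\<bar> < C"
    using A1 unfolding A1_def by (elim conjE exE) blast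
  have "0 < C" using C(2) by (meson abs_ge_zero le_less_trans order_refl)
  with C have "\<exists>C. 0 < C \<and> (\<forall>i\<ge>1. \<forall>t\<in>ctrl_times G. \<forall>p. \<bar>cost G i t p\<bar> < C) \<and> (\<forall>i\<ge>1. \<forall>x. \<bar>tcost G i x\<bar> < C)"
    by blast
  from someI_ex[OF this, folded cost_bound_def]
  have *: "0 < cost_bound \<and> (\<forall>i\<ge>1. \<forall>t\<in>ctrl_times G. \<forall>p. \<bar>cost G i t p\<bar> < cost_bound)
    \<and> (\<forall>i\<ge>1. \<forall>x. \<bar>tcost G i x\<bar> < cost_bound)" .
  from * show "0 < cost_bound" by (elim conjE)
  from * show "i \<ge> 1 \<Longrightarrow> t \<in> ctrl_times G \<Longrightarrow> \<bar>cost G i t p\<bar> < cost_bound" by (elim conjE) blast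
  from * show "i \<ge> 1 \<Longrightarrow> \<bar>tcost G i x\<bar> < cost_bound" by (elim conjE) blast
qed

lemma strats:
  assumes "i \<ge> 1" "t \<in> ctrl_times G"
  shows "compact (strats G i t)" "strats G i t \<subseteq> strategy_maps t"
proof -
  have "\<forall>i\<ge>1. \<forall>t\<in>ctrl_times G. strats G i t \<noteq> {} \<and> compact (strats G i t)"
    using A1 unfolding A1_def by (elim conjE)
  moreover have "\<forall>i\<ge>1. \<forall>t\<in>ctrl_times G. strats G i t \<subseteq> strategy_maps t"
    using valid unfolding valid_games_def by (elim conjE)
  ultimately show "compact (strats G i t)" "strats G i t \<subseteq> strategy_maps t"
    using assms by blast+
qed

lemma pures_eq:
  assumes "i \<ge> 1"
  shows "pures G i = pures G 1"
proof -
  have "\<forall>i\<ge>1. pures G i = pures G 1" using A1 unfolding A1_def by (elim conjE)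
  with assms show ?thesis by blast
qed

lemma pures_D: "s \<in> pures G 1 \<Longrightarrow> t \<in> ctrl_times G \<Longrightarrow> s t \<in> strats G 1 t"
  unfolding pures_def by auto

lemma ctrl_times_le: "t \<in> ctrl_times G \<Longrightarrow> k \<le> t \<Longrightarrow> k \<in> ctrl_times G"
  unfolding ctrl_times_def by (auto intro: le_less_trans[of "enat k" "enat t"])

lemma state_times_lt: "t \<in> state_times G \<Longrightarrow> k < t \<Longrightarrow> k \<in> ctrl_times G"
  unfolding ctrl_times_def state_times_def by (auto intro: less_le_trans[of "enat k" "enat t"])

lemma ctrl_state_times: "t \<in> ctrl_times G \<Longrightarrow> t \<in> state_times G"
  unfolding ctrl_times_def state_times_def by auto

lemma strategy_local:
  assumes "t \<in> ctrl_times G" "\<phi> \<in> strats G 1 t"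
    and "\<And>k. k \<le> t \<Longrightarrow> x k = x' k" "\<And>k. k < t \<Longrightarrow> u k = u' k" "\<And>k. k < t \<Longrightarrow> y k = y' k"
  shows "apply_bcontfun \<phi> ((x, u), y) = apply_bcontfun \<phi> ((x', u'), y')"
proof -
  have "\<phi> \<in> strategy_maps t" using strats(2)[of 1 t] assms(1,2) by auto
  then show ?thesis using assms(3-5) unfolding strategy_maps_def by blast
qed

text \<open>A compact set of strategies has a finite e/3-net. Each member of the net is uniformly
  continuous on the compact space of histories, a common modulus serves the finite net, and the
  supremum metric carries it over to all strategies.\<close>

lemma strategies_equicontinuous:
  assumes t: "t \<in> ctrl_times G" and e: "e > 0"
  shows "\<exists>d>0. \<forall>\<phi>\<in>strats G 1 t. \<forall>x x' u u' y y'. (\<forall>k\<le>t. dist (x k) (x' k) < d) \<and>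
    (\<forall>k<t. dist (u k) (u' k) < d \<and> dist (y k) (y' k) < d)
    \<longrightarrow> dist (apply_bcontfun \<phi> ((x, u), y)) (apply_bcontfun \<phi> ((x', u'), y')) < e"
proof -
  have "seq_compact (strats G 1 t)"
    using strats(1)[OF _ t, of 1] by (simp add: compact_imp_seq_compact)
  from seq_compact_imp_totally_bounded[OF this] e obtain F where
    F: "finite F" "F \<subseteq> strats G 1 t" "strats G 1 t \<subseteq> (\<Union>\<phi>\<in>F. ball \<phi> (e/3))"
    by (meson divide_pos_pos zero_less_numeral)
  have cpt: "compact (UNIV :: ('x, 'u, 'y) hist set)"
    unfolding UNIV_Times_UNIV[symmetric]
    by (intro compact_Times compact_UNIV_fun compact_spaces)
  have "\<exists>d>0. \<forall>f\<in>F. \<forall>x x' u u' y y'. (\<forall>k. dist (x k) (x' k) < d \<and> dist (u k) (u' k) < d \<and> dist (y k) (y' k) < d)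
     \<longrightarrow> dist (apply_bcontfun f ((x, u), y)) (apply_bcontfun f ((x', u'), y')) < e/3"
  proof (rule finite_uniform_delta[OF F(1)])
    fix f assume "f \<in> F"
    have "uniformly_continuous_on UNIV (apply_bcontfun f)"
      using compact_uniformly_continuous[OF _ cpt] continuous_on_apply_bcontfun by blast
    then obtain \<eta> where \<eta>: "\<eta> > 0" "\<And>h h'. dist h h' < \<eta> \<Longrightarrow> dist (apply_bcontfun f h) (apply_bcontfun f h') < e/3"
      using e unfolding uniformly_continuous_on_def
      by (metis UNIV_I divide_pos_pos zero_less_numeral)
    have "\<eta>/3 > 0" using \<eta> by simp
    note * = dist_fun_small[OF this]
    obtain dx where dx: "dx > 0" "\<And>x y :: nat \<Rightarrow> 'x. (\<forall>k. dist (x k) (y k) < dx) \<Longrightarrow> dist x y < \<eta>/3"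
      using * by blast
    obtain du where du: "du > 0" "\<And>x y :: nat \<Rightarrow> 'u. (\<forall>k. dist (x k) (y k) < du) \<Longrightarrow> dist x y < \<eta>/3"
      using * by blast
    obtain dy where dy: "dy > 0" "\<And>x y :: nat \<Rightarrow> 'y. (\<forall>k. dist (x k) (y k) < dy) \<Longrightarrow> dist x y < \<eta>/3"
      using * by blast
    show "\<exists>d>0. \<forall>x x' u u' y y'. (\<forall>k. dist (x k) (x' k) < d \<and> dist (u k) (u' k) < d \<and> dist (y k) (y' k) < d)
     \<longrightarrow> dist (apply_bcontfun f ((x, u), y)) (apply_bcontfun f ((x', u'), y')) < e/3"
    proof (intro exI[of _ "min dx (min du dy)"] conjI allI impI)
      fix x x' :: "nat \<Rightarrow> 'x" and u u' :: "nat \<Rightarrow> 'u" and y y' :: "nat \<Rightarrow> 'y"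
      assume "\<forall>k. dist (x k) (x' k) < min dx (min du dy) \<and> dist (u k) (u' k) < min dx (min du dy)
        \<and> dist (y k) (y' k) < min dx (min du dy)"
      then have "dist x x' < \<eta>/3" "dist u u' < \<eta>/3" "dist y y' < \<eta>/3"
        using dx(2)[of x x'] du(2)[of u u'] dy(2)[of y y'] by auto
      then have "dist ((x, u), y) ((x', u'), y') < \<eta>"
        using dist_triple_le[of x u y x' u' y'] by simp
      then show "dist (apply_bcontfun f ((x, u), y)) (apply_bcontfun f ((x', u'), y')) < e/3" by (rule \<eta>)
    qed (use dx du dy in auto)
  next
    fix f d d' assume "\<forall>x x' u u' y y'. (\<forall>k. dist (x k) (x' k) < d \<and> dist (u k) (u' k) < d \<and> dist (y k) (y' k) < d)
     \<longrightarrow> dist (apply_bcontfun f ((x, u), y)) (apply_bcontfun f ((x', u'), y')) < e/3" "0 < (d'::real)" "d' \<le> d"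
    then show "\<forall>x x' u u' y y'. (\<forall>k. dist (x k) (x' k) < d' \<and> dist (u k) (u' k) < d' \<and> dist (y k) (y' k) < d')
     \<longrightarrow> dist (apply_bcontfun f ((x, u), y)) (apply_bcontfun f ((x', u'), y')) < e/3"
      by (meson order_less_le_trans)
  qed
  then obtain d where d: "d > 0" "\<And>f x x' u u' y y'. f \<in> F \<Longrightarrow>
     (\<And>k. dist (x k) (x' k) < d \<and> dist (u k) (u' k) < d \<and> dist (y k) (y' k) < d)
     \<Longrightarrow> dist (apply_bcontfun f ((x, u), y)) (apply_bcontfun f ((x', u'), y')) < e/3" by metis
  show ?thesis
  proof (intro exI[of _ d] conjI ballI allI impI)
    fix \<phi> :: "('x, 'u, 'y) hist \<Rightarrow>\<^sub>C 'u"
      and x x' :: "nat \<Rightarrow> 'x" and u u' :: "nat \<Rightarrow> 'u" and y y' :: "nat \<Rightarrow> 'y"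
    assume \<phi>: "\<phi> \<in> strats G 1 t" and h: "(\<forall>k\<le>t. dist (x k) (x' k) < d) \<and>
      (\<forall>k<t. dist (u k) (u' k) < d \<and> dist (y k) (y' k) < d)"
    obtain f where f: "f \<in> F" "dist f \<phi> < e/3" using F \<phi> by auto
    \<comment> \<open>Closeness is given only at the observed coordinates, while the modulus asks
      for it at all. Overwriting the unobserved coordinates of the second history by those of the
      first leaves the value of the strategy unchanged and makes all coordinates close.\<close>
    define x'' where "x'' = (\<lambda>k. if k \<le> t then x' k else x k)"
    define u'' where "u'' = (\<lambda>k. if k < t then u' k else u k)"
    define y'' where "y'' = (\<lambda>k. if k < t then y' k else y k)"
    have eq: "apply_bcontfun \<phi> ((x', u'), y') = apply_bcontfun \<phi> ((x'', u''), y'')"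
      by (rule strategy_local[OF t \<phi>]) (auto simp: x''_def u''_def y''_def)
    have "dist (apply_bcontfun f ((x, u), y)) (apply_bcontfun f ((x'', u''), y'')) < e/3"
      by (rule d(2)[OF f(1)]) (use h d(1) in \<open>auto simp: x''_def u''_def y''_def\<close>)
    moreover have *: "dist (apply_bcontfun f h) (apply_bcontfun \<phi> h) < e/3" for h
      using dist_bounded[of f h \<phi>] f(2) by simp
    ultimately show "dist (apply_bcontfun \<phi> ((x, u), y)) (apply_bcontfun \<phi> ((x', u'), y')) < e"
      unfolding eq using *[of "((x'', u''), y'')"] *[of "((x, u), y)"]
        dist_triangle3[of "apply_bcontfun \<phi> ((x, u), y)" "apply_bcontfun \<phi> ((x'', u''), y'')" "apply_bcontfun f ((x, u), y)"]
        dist_triangle[of "apply_bcontfun f ((x, u), y)" "apply_bcontfun \<phi> ((x'', u''), y'')" "apply_bcontfun f ((x'', u''), y'')"]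
      by linarith
  qed (use d in auto)
qed

lemma dyn_equicontinuous:
  assumes "t \<in> ctrl_times G" "e > 0"
  shows "\<exists>d>0. \<forall>i\<ge>1. \<forall>x x' u u' y y' w. dist x x' < d \<and> dist u u' < d \<and> dist y y' < d
    \<longrightarrow> dist (dyn G i t (x, u, y, w)) (dyn G i t (x', u', y', w)) < e"
proof -
  have "unif_equicont {1..} (\<lambda>i. dyn G i t)"
    using A1 assms(1) unfolding A1_def by (elim conjE) blast
  then obtain d where d: "d > 0" "\<And>i p q. i \<ge> 1 \<Longrightarrow> dist p q < d \<Longrightarrow> dist (dyn G i t p) (dyn G i t q) < e"
    using assms(2) unfolding unif_equicont_def by (metis atLeast_iff)
  show ?thesis
  proof (intro exI[of _ "d/3"] conjI allI impI)
    fix i :: nat and x x' :: 'x and u u' :: 'u and y y' :: 'y and w :: 'w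
    assume "i \<ge> 1" "dist x x' < d/3 \<and> dist u u' < d/3 \<and> dist y y' < d/3"
    then show "dist (dyn G i t (x, u, y, w)) (dyn G i t (x', u', y', w)) < e"
      using dist_prod_le[of x "(u,y,w)" x' "(u',y',w)"] dist_prod_le[of u "(y,w)" u' "(y',w)"]
        dist_prod_le[of y w y' w] by (intro d) auto
  qed (use d in auto)
qed

lemma cost_equicontinuous:
  assumes "t \<in> ctrl_times G" "e > 0"
  shows "\<exists>d>0. \<forall>i\<ge>1. \<forall>x x' u u' y y'. dist x x' < d \<and> dist u u' < d \<and> dist y y' < d
    \<longrightarrow> \<bar>cost G i t (x, u, y) - cost G i t (x', u', y')\<bar> < e"
proof -
  have "unif_equicont {1..} (\<lambda>i. cost G i t)"
    using A1 assms(1) unfolding A1_def by (elim conjE) blast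
  then obtain d where d: "d > 0" "\<And>i p q. i \<ge> 1 \<Longrightarrow> dist p q < d \<Longrightarrow> dist (cost G i t p) (cost G i t q) < e"
    using assms(2) unfolding unif_equicont_def by (metis atLeast_iff)
  show ?thesis
  proof (intro exI[of _ "d/3"] conjI allI impI)
    fix i :: nat and x x' :: 'x and u u' :: 'u and y y' :: 'y
    assume "i \<ge> 1" "dist x x' < d/3 \<and> dist u u' < d/3 \<and> dist y y' < d/3"
    then have "dist (cost G i t (x, u, y)) (cost G i t (x', u', y')) < e"
      using dist_prod_le[of x "(u,y)" x' "(u',y')"] dist_prod_le[of u y u' y'] by (intro d) auto
    then show "\<bar>cost G i t (x, u, y) - cost G i t (x', u', y')\<bar> < e" by (simp add: dist_real_def)
  qed (use d in auto)
qed

lemma env_equicontinuous: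
  assumes "t \<in> ctrl_times G" "e > 0"
  shows "\<exists>d>0. \<forall>x x' a a' w. dist x x' < d \<and> dist a a' < d
    \<longrightarrow> dist (env_dyn G t (x, a, w)) (env_dyn G t (x', a', w)) < e" (is ?thesis1)
    and "\<exists>d>0. \<forall>x x' a a' w. dist x x' < d \<and> dist a a' < d
    \<longrightarrow> dist (env_out G t (x, a, w)) (env_out G t (x', a', w)) < e" (is ?thesis2)
proof -
  have c: "continuous_on UNIV (env_dyn G t)" "continuous_on UNIV (env_out G t)"
    using A1 assms(1) unfolding A1_def by - (elim conjE, blast)+
  have cpt: "compact (UNIV :: ('x0 \<times> 'd \<times> 'w0) set)" "compact (UNIV :: ('x0 \<times> 'd \<times> 'k) set)"
    unfolding UNIV_Times_UNIV[symmetric] by (intro compact_Times compact_spaces)+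
  have u: "uniformly_continuous_on UNIV (env_dyn G t)" "uniformly_continuous_on UNIV (env_out G t)"
    using c cpt by (auto intro: compact_uniformly_continuous)
  obtain d where d: "d > 0" "\<And>p q. dist p q < d \<Longrightarrow> dist (env_dyn G t p) (env_dyn G t q) < e"
    using u(1) assms(2) unfolding uniformly_continuous_on_def by (metis UNIV_I)
  obtain d' where d': "d' > 0" "\<And>p q. dist p q < d' \<Longrightarrow> dist (env_out G t p) (env_out G t q) < e"
    using u(2) assms(2) unfolding uniformly_continuous_on_def by (metis UNIV_I)
  show ?thesis1
  proof (intro exI[of _ "d/2"] conjI allI impI)
    fix x x' :: 'x0 and a a' :: 'd and w :: 'w0
    assume "dist x x' < d/2 \<and> dist a a' < d/2"
    then show "dist (env_dyn G t (x, a, w)) (env_dyn G t (x', a', w)) < e"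
      using dist_prod_le[of x "(a,w)" x' "(a',w)"] dist_prod_le[of a w a' w] by (intro d) auto
  qed (use d in auto)
  show ?thesis2
  proof (intro exI[of _ "d'/2"] conjI allI impI)
    fix x x' :: 'x0 and a a' :: 'd and w :: 'k
    assume "dist x x' < d'/2 \<and> dist a a' < d'/2"
    then show "dist (env_out G t (x, a, w)) (env_out G t (x', a', w)) < e"
      using dist_prod_le[of x "(a,w)" x' "(a',w)"] dist_prod_le[of a w a' w] by (intro d') auto
  qed (use d' in auto)
qed

lemma aggr_equicontinuous:
  assumes "t \<in> ctrl_times G" "e > 0"
  shows "\<exists>d>0. \<forall>N\<ge>1. \<forall>x u x' u'. (x, u) \<in> joint_acts N \<and> (x', u') \<in> joint_acts N \<and>
    (\<forall>j\<in>{1..N}. dist (x j) (x' j) < d \<and> dist (u j) (u' j) < d)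
    \<longrightarrow> dist (aggr G N t (x, u)) (aggr G N t (x', u')) < e"
proof -
  obtain d where d: "d > 0" "\<forall>N\<ge>1. \<forall>(x, u)\<in>joint_acts N. \<forall>(x', u')\<in>joint_acts N.
       (SUP i\<in>{1..N}. weighted_pair_dist dist dist (x i, u i) (x' i, u' i)) < d
         \<longrightarrow> dist (aggr G N t (x, u)) (aggr G N t (x', u')) < e"
    using A2 assms unfolding A2_def by meson
  \<comment> \<open>Since r / (1 + r) \<le> r and the weights are 1 and 1/2, coordinates closer than
    d/2 give a weighted distance below 3/4 * d.\<close>
  show ?thesis
  proof (intro exI[of _ "d/2"] conjI allI impI)
    fix N :: nat and x x' :: "nat \<Rightarrow> 'x" and u u' :: "nat \<Rightarrow> 'u"
    assume N: "N \<ge> 1" and h: "(x, u) \<in> joint_acts N \<and> (x', u') \<in> joint_acts N \<and>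
      (\<forall>j\<in>{1..N}. dist (x j) (x' j) < d/2 \<and> dist (u j) (u' j) < d/2)"
    have le: "r / (1 + r) \<le> r" if "r \<ge> 0" for r :: real
      using that by (simp add: divide_le_eq distrib_left)
    have w: "weighted_pair_dist dist dist (x j, u j) (x' j, u' j) < d" if "j \<in> {1..N}" for j
    proof -
      have "dist (x j) (x' j) < d/2" "dist (u j) (u' j) < d/2" using h that by auto
      then show ?thesis using le[OF zero_le_dist, of "x j" "x' j"] le[OF zero_le_dist, of "u j" "u' j"]
          zero_le_dist[of "x j" "x' j"] zero_le_dist[of "u j" "u' j"]
        unfolding weighted_pair_dist_def fst_conv snd_conv by linarith
    qed
    let ?A = "(\<lambda>i. weighted_pair_dist dist dist (x i, u i) (x' i, u' i)) ` {1..N}"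
    \<comment> \<open>The supremum over a nonempty finite set is attained, so the strict bound
      survives.\<close>
    have "Sup ?A \<in> ?A" using N by (subst cSup_eq_Max) (auto intro!: Max_in)
    then have "Sup ?A < d" using w by auto
    then show "dist (aggr G N t (x, u)) (aggr G N t (x', u')) < e" using d(2) N h by fastforce
  qed (use d in auto)
qed

lemma aggr_insensitive:
  assumes "t \<in> ctrl_times G" "e > 0"
  shows "\<forall>\<^sub>F N in sequentially. \<forall>i\<in>{1..N}. \<forall>x u x' u'. (x, u) \<in> joint_acts N \<and> (x', u') \<in> joint_acts N \<and>
    (\<forall>j\<in>{1..N}-{i}. x j = x' j \<and> u j = u' j)
    \<longrightarrow> dist (aggr G N t (x, u)) (aggr G N t (x', u')) < e"
proof -
  define S where "S N i = (SUP (p, q) \<in> {((x, u), (x', u')). (x, u) \<in> joint_acts N \<and> (x', u') \<in> joint_acts N \<and>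
                        (\<forall>j\<in>{1..N} - {i}. x j = x' j \<and> u j = u' j)}.
         dist (aggr G N t p) (aggr G N t q))" for N i
  have "(\<lambda>N. SUP i\<in>{1..N}. S N i) \<longlonglongrightarrow> 0"
    using A2 assms(1) unfolding A2_def S_def by blast
  from order_tendstoD(2)[OF this assms(2)] show ?thesis
  proof (rule eventually_mono, intro ballI allI impI)
    fix N i :: nat and x x' :: "nat \<Rightarrow> 'x" and u u' :: "nat \<Rightarrow> 'u"
    assume N: "(SUP i\<in>{1..N}. S N i) < e" and i: "i \<in> {1..N}"
      and h: "(x, u) \<in> joint_acts N \<and> (x', u') \<in> joint_acts N \<and> (\<forall>j\<in>{1..N}-{i}. x j = x' j \<and> u j = u' j)"
    \<comment> \<open>A real \<open>SUP\<close> dominates its members only for sets bounded above;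
      compactness of the space of aggregate statistics supplies the bound.\<close>
    obtain B where B: "\<And>p q :: 'd. dist p q \<le> B"
      using compact_imp_bounded[OF compact_spaces(8)] unfolding bounded_two_points by auto
    have "(\<lambda>(p, q). dist (aggr G N t p) (aggr G N t q)) ((x, u), (x', u')) \<le> S N i"
      unfolding S_def by (rule cSUP_upper) (use h B in \<open>auto intro!: bdd_aboveI[of _ B]\<close>)
    also have "S N i \<le> (SUP i\<in>{1..N}. S N i)" by (rule cSUP_upper) (use i in auto)
    finally show "dist (aggr G N t (x, u)) (aggr G N t (x', u')) < e" using N by simp
  qed
qed

section \<open>Discounted costs along a path\<close>

lemma path_cost_eq:
  assumes "i \<ge> 1"
  shows "path_cost G i x u y = (\<Sum>t. if t \<in> ctrl_times G then discount G i ^ t * cost G i t (x t, u t, y t) else 0)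
    + terminal_cost G i x"
    and "summable (\<lambda>t. \<bar>if t \<in> ctrl_times G then discount G i ^ t * cost G i t (x t, u t, y t) else 0\<bar>)"
    and "\<bar>path_cost G i x u y\<bar> \<le> cost_bound / (1 - discount G i) + cost_bound"
proof -
  have *: "\<bar>discount G i ^ t * cost G i t (x t, u t, y t)\<bar> \<le> cost_bound * discount G i ^ t" if "t \<in> ctrl_times G" for t
    using cost_bound(2)[OF assms that, of "(x t, u t, y t)"] discount_bounds[OF assms]
    by (simp add: abs_mult mult.commute mult_left_mono)
  note ** = infsum_eq_suminf_geometric[OF *, of "ctrl_times G"]
  show "path_cost G i x u y = (\<Sum>t. if t \<in> ctrl_times G then discount G i ^ t * cost G i t (x t, u t, y t) else 0)
    + terminal_cost G i x"
    "summable (\<lambda>t. \<bar>if t \<in> ctrl_times G then discount G i ^ t * cost G i t (x t, u t, y t) else 0\<bar>)"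
    using ** discount_bounds[OF assms] cost_bound(1) unfolding path_cost_def by auto
  have "\<bar>terminal_cost G i x\<bar> \<le> cost_bound"
  proof (cases "horizon G")
    case (enat n)
    have "\<bar>discount G i ^ n * tcost G i (x n)\<bar> \<le> 1 * cost_bound"
      using cost_bound(3)[OF assms, of "x n"] discount_bounds[OF assms]
      by (simp only: abs_mult, intro mult_mono) (auto intro: power_le_one)
    then show ?thesis by (simp add: enat terminal_cost_def)
  qed (use cost_bound(1) in \<open>auto simp: terminal_cost_def\<close>)
  then show "\<bar>path_cost G i x u y\<bar> \<le> cost_bound / (1 - discount G i) + cost_bound"
    using **(3) discount_bounds[OF assms] cost_bound(1) unfolding path_cost_def
    by (auto intro!: order_trans[OF abs_triangle_ineq] add_mono)
qed

text \<open>One third of e each goes to the discounted tail from time n on, to the first n stage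
  costs and to the terminal cost. This is the continuity of the cost in the product topology,
  uniform over all paths.\<close>

lemma path_cost_close:
  assumes i: "i \<ge> 1" and e: "e > 0"
  shows "\<exists>n. \<exists>d>0. \<forall>x u y x' u' y'. (\<forall>t\<in>state_times G. t \<le> n \<longrightarrow> dist (x t) (x' t) < d) \<and>
    (\<forall>t\<in>ctrl_times G. t \<le> n \<longrightarrow> dist (u t) (u' t) < d \<and> dist (y t) (y' t) < d)
    \<longrightarrow> \<bar>path_cost G i x u y - path_cost G i x' u' y'\<bar> < e"
proof -
  let ?b = "discount G i"
  note b = discount_bounds[OF i]
  \<comment> \<open>The tails of two cost series from time n on differ by at most 2 * cost_bound /
    (1 - b) * b^n with b the discount factor; this is the bound that makes it smaller than
    e/3.\<close>
  have "e / (3 * (2 * cost_bound / (1 - ?b))) > 0" using e cost_bound(1) b by simp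
  from real_arch_pow_inv[OF this b(2)]
  obtain n where n: "?b ^ n < e / (3 * (2 * cost_bound / (1 - ?b)))" by blast
  \<comment> \<open>The summand 1 avoids division by zero and keeps n * \<eta> strictly below
    e/3.\<close>
  define \<eta> where "\<eta> = e / (3 * (real n + 1))"
  have \<eta>: "\<eta> > 0" using e by (simp add: \<eta>_def)
  have "\<exists>d>0. \<forall>t\<in>{t\<in>ctrl_times G. t < n}. \<forall>x x' u u' y y'. dist x x' < d \<and> dist u u' < d \<and> dist y y' < d
    \<longrightarrow> \<bar>cost G i t (x, u, y) - cost G i t (x', u', y')\<bar> < \<eta>"
  proof (rule finite_uniform_delta)
    fix t assume "t \<in> {t\<in>ctrl_times G. t < n}"
    then show "\<exists>d>0. \<forall>x x' u u' y y'. dist x x' < d \<and> dist u u' < d \<and> dist y y' < d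
      \<longrightarrow> \<bar>cost G i t (x, u, y) - cost G i t (x', u', y')\<bar> < \<eta>"
      using cost_equicontinuous[OF _ \<eta>, of t] i by auto
  qed (auto)
  then obtain d1 where d1: "d1 > 0" "\<And>t x x' u u' y y'. t \<in> ctrl_times G \<Longrightarrow> t < n \<Longrightarrow>
    dist x x' < d1 \<Longrightarrow> dist u u' < d1 \<Longrightarrow> dist y y' < d1
    \<Longrightarrow> \<bar>cost G i t (x, u, y) - cost G i t (x', u', y')\<bar> < \<eta>" by auto
  have "unif_equicont {1..} (tcost G)" using A1 unfolding A1_def by (elim conjE)
  then obtain d2 where d2: "d2 > 0" "\<And>x x'. dist x x' < d2 \<Longrightarrow> dist (tcost G i x) (tcost G i x') < e / 3"
    using e i unfolding unif_equicont_def by (metis atLeast_iff divide_pos_pos zero_less_numeral)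
  \<comment> \<open>The time at which the terminal cost is read must be among the controlled ones;
    for an infinite horizon there is no terminal cost and 0 is a dummy.\<close>
  define m where "m = (case horizon G of enat m \<Rightarrow> m | \<infinity> \<Rightarrow> 0)"
  show ?thesis
  proof (intro exI[of _ "max n m"] exI[of _ "min d1 d2"] conjI allI impI)
    show "min d1 d2 > 0" using d1 d2 by simp
    fix x x' :: "nat \<Rightarrow> 'x" and u u' :: "nat \<Rightarrow> 'u" and y y' :: "nat \<Rightarrow> 'y"
    assume h: "(\<forall>t\<in>state_times G. t \<le> max n m \<longrightarrow> dist (x t) (x' t) < min d1 d2) \<and>
      (\<forall>t\<in>ctrl_times G. t \<le> max n m \<longrightarrow> dist (u t) (u' t) < min d1 d2 \<and> dist (y t) (y' t) < min d1 d2)"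
    have tc: "\<bar>terminal_cost G i x - terminal_cost G i x'\<bar> < e / 3"
    proof (cases "horizon G")
      case (enat k)
      then have "m \<in> state_times G" "k = m" by (auto simp: m_def state_times_def)
      then have "dist (x m) (x' m) < d2" using h by auto
      then have "\<bar>tcost G i (x m) - tcost G i (x' m)\<bar> < e / 3" using d2(2) by (simp add: dist_real_def)
      moreover have "\<bar>?b ^ m * (tcost G i (x m) - tcost G i (x' m))\<bar> \<le> 1 * \<bar>tcost G i (x m) - tcost G i (x' m)\<bar>"
        unfolding abs_mult using b by (intro mult_right_mono) (auto intro: power_le_one)
      ultimately show ?thesis using enat \<open>k = m\<close> by (simp add: terminal_cost_def right_diff_distrib)
    qed (use e in \<open>simp add: terminal_cost_def\<close>)
    define a where "a t = (if t \<in> ctrl_times G then ?b ^ t * cost G i t (x t, u t, y t) else 0)" for t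
    define a' where "a' t = (if t \<in> ctrl_times G then ?b ^ t * cost G i t (x' t, u' t, y' t) else 0)" for t
    have sa: "summable a" "summable a'"
      using path_cost_eq(2)[OF i, of x u y] path_cost_eq(2)[OF i, of x' u' y']
      unfolding a_def[symmetric] a'_def[symmetric] by (auto intro: summable_rabs_cancel)
    have bd: "\<bar>a t - a' t\<bar> \<le> 2 * cost_bound * ?b ^ t" for t
    proof (cases "t \<in> ctrl_times G")
      case True
      then have "\<bar>cost G i t (x t, u t, y t) - cost G i t (x' t, u' t, y' t)\<bar> \<le> 2 * cost_bound"
        using cost_bound(2)[OF i True, of "(x t, u t, y t)"] cost_bound(2)[OF i True, of "(x' t, u' t, y' t)"] by linarith
      then have "?b ^ t * \<bar>cost G i t (x t, u t, y t) - cost G i t (x' t, u' t, y' t)\<bar> \<le> ?b ^ t * (2 * cost_bound)"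
        using b by (intro mult_left_mono) auto
      then show ?thesis using True b by (simp add: a_def a'_def right_diff_distrib[symmetric] abs_mult mult_ac)
    next
      case False then show ?thesis using b cost_bound(1) by (simp add: a_def a'_def)
    qed
    have geo: "summable (\<lambda>t. 2 * cost_bound * ?b ^ n * ?b ^ t)"
      using b by (intro summable_mult summable_geometric) auto
    have sabs: "summable (\<lambda>t. \<bar>a t - a' t\<bar>)"
    proof (rule summable_comparison_test'[of "\<lambda>t. 2 * cost_bound * ?b ^ t" 0])
      show "summable (\<lambda>t. 2 * cost_bound * ?b ^ t)" using b by (intro summable_mult summable_geometric) auto
    qed (use bd in auto)
    have fin: "(\<Sum>t<n. \<bar>a t - a' t\<bar>) \<le> (\<Sum>t<n. \<eta>)"
    proof (rule sum_mono)
      fix t assume "t \<in> {..<n}"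
      show "\<bar>a t - a' t\<bar> \<le> \<eta>"
      proof (cases "t \<in> ctrl_times G")
        case True
        then have "\<bar>cost G i t (x t, u t, y t) - cost G i t (x' t, u' t, y' t)\<bar> < \<eta>"
          using h \<open>t \<in> {..<n}\<close> ctrl_state_times[OF True] by (intro d1) auto
        then have "?b ^ t * \<bar>cost G i t (x t, u t, y t) - cost G i t (x' t, u' t, y' t)\<bar> \<le> 1 * \<eta>"
          using b by (intro mult_mono) (auto intro: power_le_one)
        then show ?thesis using True b by (simp add: a_def a'_def right_diff_distrib[symmetric] abs_mult)
      qed (use \<eta> in \<open>simp add: a_def a'_def\<close>)
    qed
    have "\<bar>suminf a - suminf a'\<bar> = \<bar>\<Sum>t. a t - a' t\<bar>" using sa by (simp add: suminf_diff)
    also have "\<dots> \<le> (\<Sum>t. \<bar>a t - a' t\<bar>)" by (rule summable_rabs[OF sabs])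
    also have "\<dots> = (\<Sum>t. \<bar>a (t + n) - a' (t + n)\<bar>) + (\<Sum>t<n. \<bar>a t - a' t\<bar>)"
      by (rule suminf_split_initial_segment[OF sabs])
    also have "(\<Sum>t. \<bar>a (t + n) - a' (t + n)\<bar>) \<le> (\<Sum>t. 2 * cost_bound * ?b ^ n * ?b ^ t)"
    proof (rule suminf_le[OF _ _ geo])
      show "\<bar>a (t + n) - a' (t + n)\<bar> \<le> 2 * cost_bound * ?b ^ n * ?b ^ t" for t
        using bd[of "t + n"] by (simp add: power_add mult_ac)
      show "summable (\<lambda>t. \<bar>a (t + n) - a' (t + n)\<bar>)" using sabs summable_iff_shift[of "\<lambda>t. \<bar>a t - a' t\<bar>" n] by simp
    qed
    also have "\<dots> = 2 * cost_bound / (1 - ?b) * ?b ^ n"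
      using b by (subst suminf_mult) (auto simp: suminf_geometric summable_geometric)
    also have "\<dots> < e / 3" using n cost_bound(1) b by (simp add: field_simps)
    also note fin
    also have "(\<Sum>t<n. \<eta>) < e / 3" using e by (simp add: \<eta>_def field_simps)
    finally have "\<bar>suminf a - suminf a'\<bar> < e / 3 + e / 3" by simp
    moreover have "path_cost G i x u y = suminf a + terminal_cost G i x"
      "path_cost G i x' u' y' = suminf a' + terminal_cost G i x'"
      using path_cost_eq(1)[OF i] unfolding a_def a'_def by auto
    ultimately show "\<bar>path_cost G i x u y - path_cost G i x' u' y'\<bar> < e" using tc by linarith
  qed
qed

end

subsection \<open>Trajectories and the insensitivity to a single decision maker\<close>

text \<open>The tuple produced by \<open>play\<close> is split into components so that each obeys
  its own one-step equation, collected in \<open>play_Suc\<close>.\<close>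

definition play_env where "play_env G N s z t = fst (play G N s z t)"
definition play_states where "play_states G N s z t = fst (snd (play G N s z t))"
definition play_controls where "play_controls G N s z t = fst (snd (snd (play G N s z t)))"
definition play_outs where "play_outs G N s z t = snd (snd (snd (play G N s z t)))"

definition play_act where
  "play_act G N s z t j =
     apply_bcontfun (s j t) ((play_states G N s z t j, play_controls G N s z t j), play_outs G N s z t)"

definition play_aggr where
  "play_aggr G N s z t =
     aggr G N t (\<lambda>j\<in>{1..N}. play_states G N s z t j t, \<lambda>j\<in>{1..N}. play_act G N s z t j)"

definition play_out where
  "play_out G N s z t = env_out G t (play_env G N s z t, play_aggr G N s z t, out_noise G t z)"

lemma play_0:
  "play_env G N s z 0 = env_init G z"
  "play_states G N s z 0 j = (\<lambda>_. undefined)(0 := init G j z)"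
  "play_controls G N s z 0 j = (\<lambda>_. undefined)"
  "play_outs G N s z 0 = (\<lambda>_. undefined)"
  by (simp_all add: play_env_def play_states_def play_controls_def play_outs_def)

lemma play_Suc:
  "play_env G N s z (Suc t) = env_dyn G t (play_env G N s z t, play_aggr G N s z t, env_noise G t z)"
  "play_states G N s z (Suc t) j = (play_states G N s z t j)(Suc t := dyn G j t
     (play_states G N s z t j t, play_act G N s z t j, play_out G N s z t, noise G j t z))"
  "play_controls G N s z (Suc t) j = (play_controls G N s z t j)(t := play_act G N s z t j)"
  "play_outs G N s z (Suc t) = (play_outs G N s z t)(t := play_out G N s z t)"
  by (simp_all add: play_env_def play_states_def play_controls_def play_outs_def play_act_def
      play_aggr_def play_out_def Let_def split: prod.split)

text \<open>Step t writes only the states at time Suc t and the controls and environment variables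
  at time t, so an entry once written stays.\<close>

lemma play_stable:
  "k \<le> t \<Longrightarrow> play_states G N s z t j k = play_states G N s z k j k"
  "k < t \<Longrightarrow> play_controls G N s z t j k = play_act G N s z k j"
  "k < t \<Longrightarrow> play_outs G N s z t k = play_out G N s z k"
  by (induction t) (auto simp: play_Suc le_Suc_eq less_Suc_eq)

lemma state_eq: "state G N s z j t = play_states G N s z t j t"
  unfolding state_def play_states_def by (simp split: prod.split)

lemma control_eq: "control G N s z j t = play_act G N s z t j"
proof -
  have "control G N s z j t = play_controls G N s z (Suc t) j t"
    unfolding control_def play_controls_def by (simp split: prod.split del: play.simps)
  then show ?thesis by (simp add: play_Suc)
qed

lemma env_var_eq: "env_var G N s z t = play_out G N s z t"
proof -
  have "env_var G N s z t = play_outs G N s z (Suc t) t"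
    unfolding env_var_def play_outs_def by (simp split: prod.split del: play.simps)
  then show ?thesis by (simp add: play_Suc)
qed

definition solo_act where
  "solo_act G i si zs z t = apply_bcontfun (si t) (solo G i si zs z t, \<lambda>k\<in>{..<t}. zs k)"

lemma solo_Suc:
  "fst (solo G i si zs z (Suc t)) = (fst (solo G i si zs z t))(Suc t := dyn G i t
     (fst (solo G i si zs z t) t, solo_act G i si zs z t, zs t, noise G i t z))"
  "snd (solo G i si zs z (Suc t)) = (snd (solo G i si zs z t))(t := solo_act G i si zs z t)"
  by (simp_all add: solo_act_def Let_def split: prod.split)

declare solo.simps(2) [simp del]

lemma solo_stable:
  "k \<le> t \<Longrightarrow> fst (solo G i si zs z t) k = fst (solo G i si zs z k) k"
  "k < t \<Longrightarrow> snd (solo G i si zs z t) k = solo_act G i si zs z k"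
  by (induction t) (auto simp: solo_Suc le_Suc_eq less_Suc_eq)

text \<open>The integrand of \<open>solo_cost\<close>, named because environments are exchanged
  pointwise in the sample point, before integration.\<close>

definition solo_path_cost where
  "solo_path_cost G i si zs z =
     path_cost G i (\<lambda>t. fst (solo G i si zs z t) t) (\<lambda>t. snd (solo G i si zs z (Suc t)) t) zs"

section \<open>Continuity of a single decision maker in the environment sequence\<close>

text \<open>The entourage filter of the product uniformity on the coordinates in I: its base
  prescribes closeness at finitely many times. Statements about sufficiently close sequences can
  then be combined as \<open>eventually\<close> statements.\<close>

definition seq_uniformity :: "nat set \<Rightarrow> ((nat \<Rightarrow> 'a::metric_space) \<times> (nat \<Rightarrow> 'a)) filter"
  where "seq_uniformity I = (INF (n, d)\<in>UNIV \<times> {0<..}.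
    principal {(a, b). \<forall>k\<in>I. k \<le> (n::nat) \<longrightarrow> dist (a k) (b k) < d})"

lemma eventually_seq_uniformity:
  "eventually P (seq_uniformity I) \<longleftrightarrow>
    (\<exists>n. \<exists>d>0. \<forall>a b. (\<forall>k\<in>I. k \<le> n \<longrightarrow> dist (a k) (b k) < d) \<longrightarrow> P (a, b))"
proof -
  have "eventually P (seq_uniformity I) \<longleftrightarrow> (\<exists>nd\<in>UNIV \<times> {0<..}. eventually P
     ((\<lambda>(n, d). principal {(a, b). \<forall>k\<in>I. k \<le> (n::nat) \<longrightarrow> dist (a k) (b k) < d}) nd))"
    unfolding seq_uniformity_def
  proof (rule eventually_INF_base)
    fix p q :: "nat \<times> real" assume "p \<in> UNIV \<times> {0<..}" "q \<in> UNIV \<times> {0<..}"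
    then show "\<exists>x\<in>UNIV \<times> {0<..}. (case x of (n, d) \<Rightarrow> principal {(a, b). \<forall>k\<in>I. k \<le> n \<longrightarrow> dist (a k) (b k) < d})
      \<le> inf (case p of (n, d) \<Rightarrow> principal {(a, b). \<forall>k\<in>I. k \<le> n \<longrightarrow> dist (a k) (b k) < d})
            (case q of (n, d) \<Rightarrow> principal {(a, b). \<forall>k\<in>I. k \<le> n \<longrightarrow> dist (a k) (b k) < d})"
      by (intro bexI[of _ "(max (fst p) (fst q), min (snd p) (snd q))"]) (auto split: prod.split)
  qed (auto intro: exI[of _ 1])
  also have "\<dots> \<longleftrightarrow> (\<exists>n. \<exists>d>0. eventually P (principal {(a, b). \<forall>k\<in>I. k \<le> n \<longrightarrow> dist (a k) (b k) < d}))"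
    by (simp only: Bex_def split_paired_Ex mem_Times_iff fst_conv snd_conv prod.case UNIV_I greaterThan_iff simp_thms)
  finally show ?thesis by (simp only: eventually_principal split_paired_Ball_Sigma Ball_def split_paired_All mem_Collect_eq prod.case)
qed

lemma eventually_seq_uniformity_at:
  "k \<in> I \<Longrightarrow> e > 0 \<Longrightarrow> \<forall>\<^sub>F (a, b) in seq_uniformity I. dist (a k) (b k) < e"
  unfolding eventually_seq_uniformity by auto

context game_sequence
begin

text \<open>Facing the sequence that the game itself has produced, a single decision maker sees the
  same observations at every time and hence repeats its moves in the game;
  \<open>strategy_local\<close> allows the unobserved coordinates to be ignored.\<close>

lemma solo_play:
  assumes s: "s i \<in> pures G 1" and t: "t \<in> state_times G"
    and zs: "\<And>k. k \<in> ctrl_times G \<Longrightarrow> zs k = play_out G N s z k"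
  shows "solo G i (s i) zs z t = (play_states G N s z t i, play_controls G N s z t i)"
    and "t \<in> ctrl_times G \<Longrightarrow> solo_act G i (s i) zs z t = play_act G N s z t i"
proof -
  have *: "solo_act G i (s i) zs z t = play_act G N s z t i"
    if "t \<in> ctrl_times G" "solo G i (s i) zs z t = (play_states G N s z t i, play_controls G N s z t i)" for t
    unfolding solo_act_def play_act_def that(2)
    by (rule strategy_local[OF that(1) pures_D[OF s that(1)]])
      (use ctrl_times_le[OF that(1)] in \<open>auto simp: play_stable(2,3) zs\<close>)
  have "t \<in> state_times G \<longrightarrow> solo G i (s i) zs z t = (play_states G N s z t i, play_controls G N s z t i)"
  proof (induction t)
    case (Suc t)
    show ?case
    proof
      assume "Suc t \<in> state_times G"
      then have t: "t \<in> ctrl_times G" by (rule state_times_lt) simp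
      then have "solo G i (s i) zs z t = (play_states G N s z t i, play_controls G N s z t i)"
        using Suc ctrl_state_times by blast
      with *[OF t this] zs[OF t] show "solo G i (s i) zs z (Suc t) = (play_states G N s z (Suc t) i, play_controls G N s z (Suc t) i)"
        by (intro prod_eqI) (simp_all add: solo_Suc play_Suc)
    qed
  qed (simp add: play_0 fun_upd_def)
  with t * show "solo G i (s i) zs z t = (play_states G N s z t i, play_controls G N s z t i)"
    "t \<in> ctrl_times G \<Longrightarrow> solo_act G i (s i) zs z t = play_act G N s z t i" by auto
qed

text \<open>With this identity the true cost and the subjective cost have the same integrand. They
  differ only in that the true environment path is correlated with the strategy and noise of
  i.\<close>

lemma solo_path_cost_play:
  assumes "s i \<in> pures G 1" "i \<ge> 1"
  shows "path_cost G i (state G N s z i) (control G N s z i) (env_var G N s z)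
    = solo_path_cost G i (s i) (env_path G N s z) z"
proof -
  have zs: "env_path G N s z k = play_out G N s z k" if "k \<in> ctrl_times G" for k
    using that by (simp add: env_path_def env_var_eq)
  have x: "fst (solo G i (s i) (env_path G N s z) z t) t = state G N s z i t" if "t \<in> state_times G" for t
    using solo_play(1)[where s=s and i=i, OF assms(1) that zs] by (simp add: state_eq)
  have u: "snd (solo G i (s i) (env_path G N s z) z (Suc t)) t = control G N s z i t" if "t \<in> ctrl_times G" for t
    using solo_play(2)[where s=s and i=i, OF assms(1) ctrl_state_times[OF that] zs that] by (simp add: control_eq solo_Suc)
  have "terminal_cost G i (state G N s z i) = terminal_cost G i (\<lambda>t. fst (solo G i (s i) (env_path G N s z) z t) t)"
    unfolding terminal_cost_def by (auto split: enat.split simp: x state_times_def)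
  moreover have "(\<Sum>\<^sub>\<infinity>t\<in>ctrl_times G. discount G i ^ t * cost G i t (state G N s z i t, control G N s z i t, env_var G N s z t))
    = (\<Sum>\<^sub>\<infinity>t\<in>ctrl_times G. discount G i ^ t * cost G i t (fst (solo G i (s i) (env_path G N s z) z t) t,
        snd (solo G i (s i) (env_path G N s z) z (Suc t)) t, env_path G N s z t))"
    by (rule infsum_cong) (simp add: x u zs ctrl_state_times env_var_eq)
  ultimately show ?thesis unfolding solo_path_cost_def path_cost_def by simp
qed

text \<open>An action depends on all earlier states and actions, so both claims are proved in one
  strong induction. Equicontinuity at each step keeps the bounds uniform in the strategy and the
  sample point.\<close>

lemma solo_close:
  assumes i: "i \<ge> 1"
  shows "t \<in> state_times G \<Longrightarrow> e > 0 \<Longrightarrow> \<forall>\<^sub>F (a, b) in seq_uniformity (ctrl_times G).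
      \<forall>si\<in>pures G 1. \<forall>z. dist (fst (solo G i si a z t) t) (fst (solo G i si b z t) t) < e"
    and "t \<in> ctrl_times G \<Longrightarrow> e > 0 \<Longrightarrow> \<forall>\<^sub>F (a, b) in seq_uniformity (ctrl_times G).
      \<forall>si\<in>pures G 1. \<forall>z. dist (solo_act G i si a z t) (solo_act G i si b z t) < e"
proof -
  let ?U = "seq_uniformity (ctrl_times G)"
  have "(t \<in> state_times G \<longrightarrow> (\<forall>e>0. \<forall>\<^sub>F ab in ?U.
      \<forall>si\<in>pures G 1. \<forall>z. dist (fst (solo G i si (fst ab) z t) t) (fst (solo G i si (snd ab) z t) t) < e)) \<and>
    (t \<in> ctrl_times G \<longrightarrow> (\<forall>e>0. \<forall>\<^sub>F ab in ?U.
      \<forall>si\<in>pures G 1. \<forall>z. dist (solo_act G i si (fst ab) z t) (solo_act G i si (snd ab) z t) < e))" for t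
  proof (induction t rule: less_induct)
    case (less t)
    \<comment> \<open>Within one time the state comes first, because the action at that time
      observes it.\<close>
    have X: "\<forall>\<^sub>F ab in ?U. \<forall>si\<in>pures G 1. \<forall>z. dist (fst (solo G i si (fst ab) z t) t) (fst (solo G i si (snd ab) z t) t) < e"
      if t: "t \<in> state_times G" and e: "e > 0" for e
    proof (cases t)
      case 0 then show ?thesis using e by simp
    next
      case (Suc k)
      with t have k: "k \<in> ctrl_times G" "k < t" by (auto intro: state_times_lt)
      obtain d where d: "d > 0" "\<And>x x' u u' y y' w. dist x x' < d \<Longrightarrow> dist u u' < d \<Longrightarrow> dist y y' < d
        \<Longrightarrow> dist (dyn G i k (x, u, y, w)) (dyn G i k (x', u', y', w)) < e"
        using dyn_equicontinuous[OF k(1) e] i by blast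
      from less[OF k(2)] k(1) ctrl_state_times[OF k(1)] d(1)
      have "\<forall>\<^sub>F ab in ?U. \<forall>si\<in>pures G 1. \<forall>z. dist (fst (solo G i si (fst ab) z k) k) (fst (solo G i si (snd ab) z k) k) < d"
        "\<forall>\<^sub>F ab in ?U. \<forall>si\<in>pures G 1. \<forall>z. dist (solo_act G i si (fst ab) z k) (solo_act G i si (snd ab) z k) < d"
        by auto
      moreover have "\<forall>\<^sub>F ab in ?U. dist (fst ab k) (snd ab k) < d"
        using eventually_seq_uniformity_at[OF k(1) d(1)] by (simp add: case_prod_beta')
      ultimately show ?thesis by eventually_elim (auto simp: Suc solo_Suc intro!: d(2))
    qed
    have "\<forall>\<^sub>F ab in ?U. \<forall>si\<in>pures G 1. \<forall>z. dist (solo_act G i si (fst ab) z t) (solo_act G i si (snd ab) z t) < e"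
      if t: "t \<in> ctrl_times G" and e: "e > 0" for e
    proof -
      obtain d where d: "d > 0" "\<And>\<phi> x x' u u' y y'. \<phi> \<in> strats G 1 t \<Longrightarrow> (\<And>k. k \<le> t \<Longrightarrow> dist (x k) (x' k) < d) \<Longrightarrow>
        (\<And>k. k < t \<Longrightarrow> dist (u k) (u' k) < d) \<Longrightarrow> (\<And>k. k < t \<Longrightarrow> dist (y k) (y' k) < d)
        \<Longrightarrow> dist (apply_bcontfun \<phi> ((x, u), y)) (apply_bcontfun \<phi> ((x', u'), y')) < e"
        using strategies_equicontinuous[OF t e] by metis
      have "\<forall>\<^sub>F ab in ?U. \<forall>k\<in>{..t}. \<forall>si\<in>pures G 1. \<forall>z. dist (fst (solo G i si (fst ab) z k) k) (fst (solo G i si (snd ab) z k) k) < d"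
      proof (rule eventually_ball_finite[OF finite_atMost], rule ballI)
        fix k assume "k \<in> {..t}"
        then show "\<forall>\<^sub>F ab in ?U. \<forall>si\<in>pures G 1. \<forall>z. dist (fst (solo G i si (fst ab) z k) k) (fst (solo G i si (snd ab) z k) k) < d"
          using X[OF ctrl_state_times[OF t] d(1)] less[of k] ctrl_state_times[OF ctrl_times_le[OF t, of k]] d(1)
          by (cases "k = t") auto
      qed
      moreover have "\<forall>\<^sub>F ab in ?U. \<forall>k\<in>{..<t}. \<forall>si\<in>pures G 1. \<forall>z. dist (solo_act G i si (fst ab) z k) (solo_act G i si (snd ab) z k) < d"
        using less ctrl_times_le[OF t] d(1) by (intro eventually_ball_finite[OF finite_lessThan]) auto
      moreover have "\<forall>\<^sub>F ab in ?U. \<forall>k\<in>{..<t}. dist (fst ab k) (snd ab k) < d"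
      proof (rule eventually_ball_finite[OF finite_lessThan], rule ballI)
        fix k assume "k \<in> {..<t}"
        then have "k \<in> ctrl_times G" using ctrl_times_le[OF t, of k] by simp
        from eventually_seq_uniformity_at[OF this d(1)]
        show "\<forall>\<^sub>F ab in ?U. dist (fst ab k) (snd ab k) < d" by (simp add: case_prod_beta')
      qed
      ultimately show ?thesis
      proof eventually_elim
        case (elim ab)
        show ?case
        proof (intro ballI allI)
          fix si z assume si: "si \<in> pures G 1"
          have "dist (apply_bcontfun (si t) ((fst (solo G i si (fst ab) z t), snd (solo G i si (fst ab) z t)), \<lambda>k\<in>{..<t}. fst ab k))
            (apply_bcontfun (si t) ((fst (solo G i si (snd ab) z t), snd (solo G i si (snd ab) z t)), \<lambda>k\<in>{..<t}. snd ab k)) < e"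
          proof (rule d(2)[OF pures_D[OF si t]])
            fix k assume "k \<le> t"
            then show "dist (fst (solo G i si (fst ab) z t) k) (fst (solo G i si (snd ab) z t) k) < d"
              unfolding solo_stable(1)[OF \<open>k \<le> t\<close>] using elim(1) si by blast
          qed (use elim(2,3) si in \<open>auto simp: solo_stable(2)\<close>)
          then show "dist (solo_act G i si (fst ab) z t) (solo_act G i si (snd ab) z t) < e"
            by (simp add: solo_act_def)
        qed
      qed
    qed
    with X show ?case by blast
  qed
  then show "t \<in> state_times G \<Longrightarrow> e > 0 \<Longrightarrow> \<forall>\<^sub>F (a, b) in seq_uniformity (ctrl_times G).
      \<forall>si\<in>pures G 1. \<forall>z. dist (fst (solo G i si a z t) t) (fst (solo G i si b z t) t) < e"
    and "t \<in> ctrl_times G \<Longrightarrow> e > 0 \<Longrightarrow> \<forall>\<^sub>F (a, b) in seq_uniformity (ctrl_times G).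
      \<forall>si\<in>pures G 1. \<forall>z. dist (solo_act G i si a z t) (solo_act G i si b z t) < e"
    by (auto simp: case_prod_beta')
qed

lemma solo_path_cost_close:
  assumes i: "i \<ge> 1" and e: "e > 0"
  shows "\<forall>\<^sub>F (a, b) in seq_uniformity (ctrl_times G).
      \<forall>si\<in>pures G 1. \<forall>z. \<bar>solo_path_cost G i si a z - solo_path_cost G i si b z\<bar> < e"
proof -
  let ?U = "seq_uniformity (ctrl_times G) :: ((nat \<Rightarrow> 'y) \<times> (nat \<Rightarrow> 'y)) filter"
  obtain n d where d: "d > 0" "\<And>x u y x' u' y'. (\<And>t. t\<in>state_times G \<Longrightarrow> t \<le> n \<Longrightarrow> dist (x t) (x' t) < d) \<Longrightarrow>
    (\<And>t. t\<in>ctrl_times G \<Longrightarrow> t \<le> n \<Longrightarrow> dist (u t) (u' t) < d) \<Longrightarrow>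
    (\<And>t. t\<in>ctrl_times G \<Longrightarrow> t \<le> n \<Longrightarrow> dist (y t) (y' t) < d)
    \<Longrightarrow> \<bar>path_cost G i x u y - path_cost G i x' u' y'\<bar> < e"
    using path_cost_close[OF i e] by metis
  have "\<forall>\<^sub>F ab in ?U. \<forall>t\<in>{t\<in>state_times G. t \<le> n}. \<forall>si\<in>pures G 1. \<forall>z. dist (fst (solo G i si (fst ab) z t) t) (fst (solo G i si (snd ab) z t) t) < d"
    using solo_close(1)[OF i _ d(1)] by (intro eventually_ball_finite) (auto simp: case_prod_beta')
  moreover have "\<forall>\<^sub>F ab in ?U. \<forall>t\<in>{t\<in>ctrl_times G. t \<le> n}. \<forall>si\<in>pures G 1. \<forall>z. dist (solo_act G i si (fst ab) z t) (solo_act G i si (snd ab) z t) < d"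
    using solo_close(2)[OF i _ d(1)] by (intro eventually_ball_finite) (auto simp: case_prod_beta')
  moreover have "\<forall>\<^sub>F ab in ?U. \<forall>t\<in>{t\<in>ctrl_times G. t \<le> n}. dist (fst ab t) (snd ab t) < d"
    using eventually_seq_uniformity_at[OF _ d(1)] by (intro eventually_ball_finite) (auto simp: case_prod_beta')
  ultimately have "\<forall>\<^sub>F ab in ?U. \<forall>si\<in>pures G 1. \<forall>z. \<bar>solo_path_cost G i si (fst ab) z - solo_path_cost G i si (snd ab) z\<bar> < e"
    by eventually_elim (auto simp: solo_path_cost_def solo_Suc intro!: d(2))
  then show ?thesis by (simp add: case_prod_beta')
qed

section \<open>Replacing the data of one decision maker\<close>

definition differ_only_at :: "nat \<Rightarrow> nat \<Rightarrow> (nat \<Rightarrow> ('x, 'u, 'y) pure) \<Rightarrow> (nat \<Rightarrow> ('x, 'u, 'y) pure)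
    \<Rightarrow> (nat \<Rightarrow> 'z \<Rightarrow> 'x) \<Rightarrow> (nat \<Rightarrow> nat \<Rightarrow> 'z \<Rightarrow> 'w) \<Rightarrow> bool"
  where "differ_only_at N i s s' a b \<longleftrightarrow> i \<in> {1..N} \<and> (\<forall>j\<in>{1..N}. s j \<in> pures G 1) \<and>
    (\<forall>j\<in>{1..N}-{i}. s' j = s j \<and> a j = init G j \<and> b j = noise G j)"

text \<open>The game is an argument of \<open>f\<close>, so that \<open>f\<close> can be evaluated
  in \<open>G\<close> and in the game with replaced data. The threshold on N comes before all
  quantifiers over decision makers, strategies and sample points.\<close>

definition insensitive where
  "insensitive f \<longleftrightarrow> (\<forall>e>0. \<forall>\<^sub>F N in sequentially. \<forall>i s s' a b z. differ_only_at N i s s' a b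
     \<longrightarrow> dist (f G N s z) (f (G\<lparr>init := a, noise := b\<rparr>) N s' z) < e)"

text \<open>Decision maker i is excluded since its own states and actions may change
  arbitrarily.\<close>

definition insensitive_others where
  "insensitive_others f \<longleftrightarrow> (\<forall>e>0. \<forall>\<^sub>F N in sequentially. \<forall>i s s' a b z. differ_only_at N i s s' a b
     \<longrightarrow> (\<forall>j\<in>{1..N}-{i}. dist (f G N s z j) (f (G\<lparr>init := a, noise := b\<rparr>) N s' z j) < e))"

lemma insensitive_act:
  assumes t: "t \<in> ctrl_times G"
    and X: "\<And>k. k \<le> t \<Longrightarrow> insensitive_others (\<lambda>G N s z j. play_states G N s z k j k)"
    and A: "\<And>k. k < t \<Longrightarrow> insensitive_others (\<lambda>G N s z j. play_act G N s z k j)"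
    and Y: "\<And>k. k < t \<Longrightarrow> insensitive (\<lambda>G N s z. play_out G N s z k)"
  shows "insensitive_others (\<lambda>G N s z j. play_act G N s z t j)"
  unfolding insensitive_others_def
proof (intro allI impI)
  fix e :: real assume e: "e > 0"
  obtain d where d: "d > 0" "\<And>\<phi> x x' u u' y y'. \<phi> \<in> strats G 1 t \<Longrightarrow> (\<And>k. k \<le> t \<Longrightarrow> dist (x k) (x' k) < d) \<Longrightarrow>
    (\<And>k. k < t \<Longrightarrow> dist (u k) (u' k) < d) \<Longrightarrow> (\<And>k. k < t \<Longrightarrow> dist (y k) (y' k) < d)
    \<Longrightarrow> dist (apply_bcontfun \<phi> ((x, u), y)) (apply_bcontfun \<phi> ((x', u'), y')) < e"
    using strategies_equicontinuous[OF t e] by metis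
  have "\<forall>\<^sub>F N in sequentially. \<forall>k\<in>{..t}. \<forall>i s s' a b z. differ_only_at N i s s' a b
     \<longrightarrow> (\<forall>j\<in>{1..N}-{i}. dist (play_states G N s z k j k) (play_states (G\<lparr>init := a, noise := b\<rparr>) N s' z k j k) < d)"
    using X d(1) unfolding insensitive_others_def by (intro eventually_ball_finite) auto
  moreover have "\<forall>\<^sub>F N in sequentially. \<forall>k\<in>{..<t}. \<forall>i s s' a b z. differ_only_at N i s s' a b
     \<longrightarrow> (\<forall>j\<in>{1..N}-{i}. dist (play_act G N s z k j) (play_act (G\<lparr>init := a, noise := b\<rparr>) N s' z k j) < d)"
    using A d(1) unfolding insensitive_others_def by (intro eventually_ball_finite) auto
  moreover have "\<forall>\<^sub>F N in sequentially. \<forall>k\<in>{..<t}. \<forall>i s s' a b z. differ_only_at N i s s' a b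
     \<longrightarrow> dist (play_out G N s z k) (play_out (G\<lparr>init := a, noise := b\<rparr>) N s' z k) < d"
    using Y d(1) unfolding insensitive_def by (intro eventually_ball_finite) auto
  ultimately show "\<forall>\<^sub>F N in sequentially. \<forall>i s s' a b z. differ_only_at N i s s' a b
     \<longrightarrow> (\<forall>j\<in>{1..N}-{i}. dist (play_act G N s z t j) (play_act (G\<lparr>init := a, noise := b\<rparr>) N s' z t j) < e)"
  proof eventually_elim
    case (elim N)
    show ?case
    proof (intro allI impI ballI)
      fix i s s' a b z j
      assume adm: "differ_only_at N i s s' a b" and j: "j \<in> {1..N}-{i}"
      then have s': "s' j = s j" and s: "s j \<in> pures G 1" unfolding differ_only_at_def by auto
      show "dist (play_act G N s z t j) (play_act (G\<lparr>init := a, noise := b\<rparr>) N s' z t j) < e"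
        unfolding play_act_def s'
      proof (rule d(2)[OF pures_D[OF s t]])
        fix k assume k: "k \<le> t"
        then show "dist (play_states G N s z t j k) (play_states (G\<lparr>init := a, noise := b\<rparr>) N s' z t j k) < d"
          unfolding play_stable(1)[OF k] using elim(1) adm j by blast
      next
        fix k assume k: "k < t"
        then show "dist (play_controls G N s z t j k) (play_controls (G\<lparr>init := a, noise := b\<rparr>) N s' z t j k) < d"
          unfolding play_stable(2)[OF k] using elim(2) adm j by blast
        show "dist (play_outs G N s z t k) (play_outs (G\<lparr>init := a, noise := b\<rparr>) N s' z t k) < d"
          unfolding play_stable(3)[OF k] using elim(3) adm k by blast
      qed
    qed
  qed
qed

text \<open>Both halves of (A2) are combined: exchanging the coordinate of i alone has vanishing
  effect as N grows, and moving all other coordinates slightly has a small effect uniformly in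
  N.\<close>

lemma insensitive_aggr:
  assumes t: "t \<in> ctrl_times G"
    and X: "insensitive_others (\<lambda>G N s z j. play_states G N s z t j t)"
    and A: "insensitive_others (\<lambda>G N s z j. play_act G N s z t j)"
  shows "insensitive (\<lambda>G N s z. play_aggr G N s z t)"
  unfolding insensitive_def
proof (intro allI impI)
  fix e :: real assume e: "e > 0"
  then have e2: "e / 2 > 0" by simp
  obtain d where d: "d > 0" "\<And>N x u x' u'. N \<ge> 1 \<Longrightarrow> (x, u) \<in> joint_acts N \<Longrightarrow> (x', u') \<in> joint_acts N \<Longrightarrow>
    (\<And>j. j\<in>{1..N} \<Longrightarrow> dist (x j) (x' j) < d \<and> dist (u j) (u' j) < d)
    \<Longrightarrow> dist (aggr G N t (x, u)) (aggr G N t (x', u')) < e / 2"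
    using aggr_equicontinuous[OF t e2] by metis
  have "\<forall>\<^sub>F N in sequentially. \<forall>i s s' a b z. differ_only_at N i s s' a b
     \<longrightarrow> (\<forall>j\<in>{1..N}-{i}. dist (play_states G N s z t j t) (play_states (G\<lparr>init := a, noise := b\<rparr>) N s' z t j t) < d)"
    using X d(1) unfolding insensitive_others_def by auto
  moreover have "\<forall>\<^sub>F N in sequentially. \<forall>i s s' a b z. differ_only_at N i s s' a b
     \<longrightarrow> (\<forall>j\<in>{1..N}-{i}. dist (play_act G N s z t j) (play_act (G\<lparr>init := a, noise := b\<rparr>) N s' z t j) < d)"
    using A d(1) unfolding insensitive_others_def by auto
  moreover note aggr_insensitive[OF t e2]
  ultimately show "\<forall>\<^sub>F N in sequentially. \<forall>i s s' a b z. differ_only_at N i s s' a b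
     \<longrightarrow> dist (play_aggr G N s z t) (play_aggr (G\<lparr>init := a, noise := b\<rparr>) N s' z t) < e"
  proof eventually_elim
    case (elim N)
    show ?case
    proof (intro allI impI)
      fix i s s' a b z
      assume adm: "differ_only_at N i s s' a b"
      then have i: "i \<in> {1..N}" unfolding differ_only_at_def by auto
      define x where "x = (\<lambda>j\<in>{1..N}. play_states G N s z t j t)"
      define u where "u = (\<lambda>j\<in>{1..N}. play_act G N s z t j)"
      define x' where "x' = (\<lambda>j\<in>{1..N}. play_states (G\<lparr>init := a, noise := b\<rparr>) N s' z t j t)"
      define u' where "u' = (\<lambda>j\<in>{1..N}. play_act (G\<lparr>init := a, noise := b\<rparr>) N s' z t j)"
      have J: "(x, u) \<in> joint_acts N" "(x', u') \<in> joint_acts N" "(x(i := x' i), u(i := u' i)) \<in> joint_acts N"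
        using i unfolding joint_acts_def x_def u_def x'_def u'_def by (auto simp: PiE_def extensional_def)
      \<comment> \<open>The intermediate point takes coordinate i from the replaced game and all
        others from the original one, so the two halves of (A2) apply one after the other.\<close>
      have "dist (aggr G N t (x, u)) (aggr G N t (x(i := x' i), u(i := u' i))) < e / 2"
        using elim(3) i J by auto
      moreover have "dist (aggr G N t (x(i := x' i), u(i := u' i))) (aggr G N t (x', u')) < e / 2"
      proof (rule d(2)[OF _ J(3,2)])
        fix j assume j: "j \<in> {1..N}"
        show "dist ((x(i := x' i)) j) (x' j) < d \<and> dist ((u(i := u' i)) j) (u' j) < d"
        proof (cases "j = i")
          case False
          then have "j \<in> {1..N} - {i}" using j by auto
          then have "dist (x j) (x' j) < d" "dist (u j) (u' j) < d"
            using elim(1,2) adm j unfolding x_def u_def x'_def u'_def by auto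
          with False show ?thesis by simp
        qed (use d in auto)
      qed (use i in auto)
      ultimately have "dist (aggr G N t (x, u)) (aggr G N t (x', u')) < e"
        using dist_triangle_half_l dist_commute
          dist_triangle[of "aggr G N t (x, u)" "aggr G N t (x', u')" "aggr G N t (x(i := x' i), u(i := u' i))"] by linarith
      then show "dist (play_aggr G N s z t) (play_aggr (G\<lparr>init := a, noise := b\<rparr>) N s' z t) < e"
        unfolding play_aggr_def x_def u_def x'_def u'_def by simp
    qed
  qed
qed

lemma insensitive_out:
  assumes t: "t \<in> ctrl_times G"
    and E: "insensitive (\<lambda>G N s z. play_env G N s z t)"
    and D: "insensitive (\<lambda>G N s z. play_aggr G N s z t)"
  shows "insensitive (\<lambda>G N s z. play_out G N s z t)"
    and "insensitive (\<lambda>G N s z. play_env G N s z (Suc t))"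
proof -
  have *: "\<forall>\<^sub>F N in sequentially. \<forall>i s s' a b z. differ_only_at N i s s' a b
     \<longrightarrow> dist (play_env G N s z t) (play_env (G\<lparr>init := a, noise := b\<rparr>) N s' z t) < d
       \<and> dist (play_aggr G N s z t) (play_aggr (G\<lparr>init := a, noise := b\<rparr>) N s' z t) < d" if "d > 0" for d
  proof -
    have "\<forall>\<^sub>F N in sequentially. \<forall>i s s' a b z. differ_only_at N i s s' a b
     \<longrightarrow> dist (play_env G N s z t) (play_env (G\<lparr>init := a, noise := b\<rparr>) N s' z t) < d"
      "\<forall>\<^sub>F N in sequentially. \<forall>i s s' a b z. differ_only_at N i s s' a b
     \<longrightarrow> dist (play_aggr G N s z t) (play_aggr (G\<lparr>init := a, noise := b\<rparr>) N s' z t) < d"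
      using E D that unfolding insensitive_def by auto
    then show ?thesis by eventually_elim blast
  qed
  show "insensitive (\<lambda>G N s z. play_out G N s z t)"
    unfolding insensitive_def
  proof (intro allI impI)
    fix e :: real assume e: "e > 0"
    obtain d where d: "d > 0" "\<And>x x' a a' w. dist x x' < d \<Longrightarrow> dist a a' < d
      \<Longrightarrow> dist (env_out G t (x, a, w)) (env_out G t (x', a', w)) < e"
      using env_equicontinuous(2)[OF t e] by blast
    from *[OF d(1)] show "\<forall>\<^sub>F N in sequentially. \<forall>i s s' a b z. differ_only_at N i s s' a b
     \<longrightarrow> dist (play_out G N s z t) (play_out (G\<lparr>init := a, noise := b\<rparr>) N s' z t) < e"
      by eventually_elim (auto simp: play_out_def intro!: d(2))
  qed
  show "insensitive (\<lambda>G N s z. play_env G N s z (Suc t))"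
    unfolding insensitive_def
  proof (intro allI impI)
    fix e :: real assume e: "e > 0"
    obtain d where d: "d > 0" "\<And>x x' a a' w. dist x x' < d \<Longrightarrow> dist a a' < d
      \<Longrightarrow> dist (env_dyn G t (x, a, w)) (env_dyn G t (x', a', w)) < e"
      using env_equicontinuous(1)[OF t e] by blast
    from *[OF d(1)] show "\<forall>\<^sub>F N in sequentially. \<forall>i s s' a b z. differ_only_at N i s s' a b
     \<longrightarrow> dist (play_env G N s z (Suc t)) (play_env (G\<lparr>init := a, noise := b\<rparr>) N s' z (Suc t)) < e"
      by eventually_elim (auto simp: play_Suc intro!: d(2))
  qed
qed

lemma insensitive_states:
  assumes t: "t \<in> ctrl_times G"
    and X: "insensitive_others (\<lambda>G N s z j. play_states G N s z t j t)"
    and A: "insensitive_others (\<lambda>G N s z j. play_act G N s z t j)"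
    and Y: "insensitive (\<lambda>G N s z. play_out G N s z t)"
  shows "insensitive_others (\<lambda>G N s z j. play_states G N s z (Suc t) j (Suc t))"
  unfolding insensitive_others_def
proof (intro allI impI)
  fix e :: real assume e: "e > 0"
  obtain d where d: "d > 0" "\<And>j x x' u u' y y' w. j \<ge> 1 \<Longrightarrow> dist x x' < d \<Longrightarrow> dist u u' < d \<Longrightarrow> dist y y' < d
    \<Longrightarrow> dist (dyn G j t (x, u, y, w)) (dyn G j t (x', u', y', w)) < e"
    using dyn_equicontinuous[OF t e] by blast
  have "\<forall>\<^sub>F N in sequentially. \<forall>i s s' a b z. differ_only_at N i s s' a b
     \<longrightarrow> (\<forall>j\<in>{1..N}-{i}. dist (play_states G N s z t j t) (play_states (G\<lparr>init := a, noise := b\<rparr>) N s' z t j t) < d)"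
    using X d(1) unfolding insensitive_others_def by auto
  moreover have "\<forall>\<^sub>F N in sequentially. \<forall>i s s' a b z. differ_only_at N i s s' a b
     \<longrightarrow> (\<forall>j\<in>{1..N}-{i}. dist (play_act G N s z t j) (play_act (G\<lparr>init := a, noise := b\<rparr>) N s' z t j) < d)"
    using A d(1) unfolding insensitive_others_def by auto
  moreover have "\<forall>\<^sub>F N in sequentially. \<forall>i s s' a b z. differ_only_at N i s s' a b
     \<longrightarrow> dist (play_out G N s z t) (play_out (G\<lparr>init := a, noise := b\<rparr>) N s' z t) < d"
    using Y d(1) unfolding insensitive_def by auto
  ultimately show "\<forall>\<^sub>F N in sequentially. \<forall>i s s' a b z. differ_only_at N i s s' a b
     \<longrightarrow> (\<forall>j\<in>{1..N}-{i}. dist (play_states G N s z (Suc t) j (Suc t))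
       (play_states (G\<lparr>init := a, noise := b\<rparr>) N s' z (Suc t) j (Suc t)) < e)"
  proof eventually_elim
    case (elim N)
    show ?case
    proof (intro allI impI ballI)
      fix i s s' a b z j
      assume adm: "differ_only_at N i s s' a b" and j: "j \<in> {1..N}-{i}"
      then have b: "b j = noise G j" unfolding differ_only_at_def by auto
      show "dist (play_states G N s z (Suc t) j (Suc t))
        (play_states (G\<lparr>init := a, noise := b\<rparr>) N s' z (Suc t) j (Suc t)) < e"
        using elim adm j by (auto simp: play_Suc b intro!: d(2))
    qed
  qed
qed

text \<open>At time 0 the environment state and the other initial states are not affected at all.
  Afterwards a perturbation passes from states to actions, from there to the aggregate, and from the
  aggregate to the environment variable and the next states.\<close>

lemma play_insensitive:
  "(t \<in> state_times G \<longrightarrow> insensitive (\<lambda>G N s z. play_env G N s z t) \<and>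
     insensitive_others (\<lambda>G N s z j. play_states G N s z t j t)) \<and>
   (t \<in> ctrl_times G \<longrightarrow> insensitive_others (\<lambda>G N s z j. play_act G N s z t j) \<and>
     insensitive (\<lambda>G N s z. play_out G N s z t))"
proof (induction t rule: less_induct)
  case (less t)
  have EX: "insensitive (\<lambda>G N s z. play_env G N s z t) \<and> insensitive_others (\<lambda>G N s z j. play_states G N s z t j t)"
    if "t \<in> state_times G"
  proof (cases t)
    case 0
    then show ?thesis
      by (auto simp: insensitive_def insensitive_others_def play_0 differ_only_at_def)
  next
    case (Suc k)
    then have k: "k \<in> ctrl_times G" "k < t" using that by (auto intro: state_times_lt)
    have IH: "insensitive (\<lambda>G N s z. play_env G N s z k)" "insensitive_others (\<lambda>G N s z j. play_states G N s z k j k)"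
      "insensitive_others (\<lambda>G N s z j. play_act G N s z k j)" "insensitive (\<lambda>G N s z. play_out G N s z k)"
      using less[OF k(2)] k(1) ctrl_state_times[OF k(1)] by blast+
    have "insensitive (\<lambda>G N s z. play_aggr G N s z k)" by (rule insensitive_aggr[OF k(1) IH(2,3)])
    from insensitive_out(2)[OF k(1) IH(1) this] insensitive_states[OF k(1) IH(2-4)]
    show ?thesis unfolding Suc by blast
  qed
  moreover have "insensitive_others (\<lambda>G N s z j. play_act G N s z t j) \<and> insensitive (\<lambda>G N s z. play_out G N s z t)"
    if t: "t \<in> ctrl_times G"
  proof -
    have A: "insensitive_others (\<lambda>G N s z j. play_act G N s z t j)"
    proof (rule insensitive_act[OF t])
      fix k assume "k \<le> t"
      then show "insensitive_others (\<lambda>G N s z j. play_states G N s z k j k)"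
        using EX less[of k] ctrl_state_times[OF ctrl_times_le[OF t, of k]] by (cases "k = t") auto
    qed (use less ctrl_times_le[OF t] in auto)
    moreover have "insensitive (\<lambda>G N s z. play_aggr G N s z t)"
      using EX[OF ctrl_state_times[OF t]] A by (intro insensitive_aggr[OF t]) auto
    ultimately show ?thesis using insensitive_out(1)[OF t] EX[OF ctrl_state_times[OF t]] by blast
  qed
  ultimately show ?case by blast
qed

text \<open>The threshold on N in \<open>play_insensitive\<close> may grow with the time. Membership
  in an entourage involves finitely many times only, so a common threshold exists.\<close>

lemma env_path_insensitive:
  assumes "eventually P (seq_uniformity (ctrl_times G))"
  shows "\<forall>\<^sub>F N in sequentially. \<forall>i s s' a b z. differ_only_at N i s s' a b
    \<longrightarrow> P (env_path G N s z, env_path (G\<lparr>init := a, noise := b\<rparr>) N s' z)"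
proof -
  obtain n d where d: "d > 0" "\<And>a b. (\<And>k. k\<in>ctrl_times G \<Longrightarrow> k \<le> n \<Longrightarrow> dist (a k) (b k) < d) \<Longrightarrow> P (a, b)"
    using assms unfolding eventually_seq_uniformity by metis
  have "\<forall>\<^sub>F N in sequentially. \<forall>k\<in>{k\<in>ctrl_times G. k \<le> n}. \<forall>i s s' a b z. differ_only_at N i s s' a b
     \<longrightarrow> dist (play_out G N s z k) (play_out (G\<lparr>init := a, noise := b\<rparr>) N s' z k) < d"
    using play_insensitive d(1) unfolding insensitive_def by (intro eventually_ball_finite) auto
  then show ?thesis
    by eventually_elim (auto simp: env_path_def env_var_eq ctrl_times_def intro!: d(2))
qed

end

subsection \<open>Measurability\<close>

lemma borel_measurable_fun_upd:
  fixes f :: "'l \<Rightarrow> nat \<Rightarrow> 'c::second_countable_topology"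
  assumes "f \<in> borel_measurable L" "v \<in> borel_measurable L"
  shows "(\<lambda>l. (f l)(k := v l)) \<in> borel_measurable L"
proof (rule measurable_coordinatewise_then_product)
  fix n
  show "(\<lambda>l. ((f l)(k := v l)) n) \<in> borel_measurable L"
    using assms measurable_product_then_coordinatewise[OF assms(1)] by (cases "n = k") auto
qed

lemma borel_measurable_restrict:
  fixes f :: "'l \<Rightarrow> nat \<Rightarrow> 'c::second_countable_topology"
  assumes "\<And>n. n \<in> I \<Longrightarrow> (\<lambda>l. f l n) \<in> borel_measurable L"
  shows "(\<lambda>l. \<lambda>n\<in>I. f l n) \<in> borel_measurable L"
proof (rule measurable_coordinatewise_then_product)
  fix n show "(\<lambda>l. (\<lambda>n\<in>I. f l n) n) \<in> borel_measurable L"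
    using assms by (cases "n \<in> I") auto
qed

lemma borel_measurable_continuous_compose:
  assumes "continuous_on UNIV f" "g \<in> borel_measurable L"
  shows "(\<lambda>l. f (g l)) \<in> borel_measurable L"
  by (rule measurable_compose[OF assms(2) borel_measurable_continuous_onI[OF assms(1)]])

context game_sequence
begin

lemma continuous_data:
  assumes "t \<in> ctrl_times G"
  shows "i \<ge> 1 \<Longrightarrow> continuous_on UNIV (dyn G i t)" "i \<ge> 1 \<Longrightarrow> continuous_on UNIV (cost G i t)"
    "continuous_on UNIV (env_dyn G t)" "continuous_on UNIV (env_out G t)"
proof -
  have "\<forall>i\<ge>1. \<forall>t\<in>ctrl_times G. continuous_on UNIV (cost G i t) \<and> continuous_on UNIV (dyn G i t)"
    "\<forall>t\<in>ctrl_times G. continuous_on UNIV (env_dyn G t) \<and> continuous_on UNIV (env_out G t)"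
    using A1 unfolding A1_def by - (elim conjE, assumption)+
  with assms show "i \<ge> 1 \<Longrightarrow> continuous_on UNIV (dyn G i t)" "i \<ge> 1 \<Longrightarrow> continuous_on UNIV (cost G i t)"
    "continuous_on UNIV (env_dyn G t)" "continuous_on UNIV (env_out G t)" by blast+
qed

lemma continuous_tcost: "i \<ge> 1 \<Longrightarrow> continuous_on UNIV (tcost G i)"
proof -
  have "\<forall>i\<ge>1. continuous_on UNIV (tcost G i)"
    using A1 unfolding A1_def by (elim conjE)
  then show "i \<ge> 1 \<Longrightarrow> continuous_on UNIV (tcost G i)" by blast
qed

text \<open>Measurability of the aggregate statistics is not postulated; it is obtained from this
  continuity, a consequence of the first half of (A2) for fixed N.\<close>

lemma continuous_on_aggr:
  assumes t: "t \<in> ctrl_times G" and N: "N \<ge> 1"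
  shows "continuous_on (joint_acts N) (aggr G N t)"
  unfolding continuous_on_def
proof (intro ballI tendstoI)
  fix p :: "(nat \<Rightarrow> 'x) \<times> (nat \<Rightarrow> 'u)" and e :: real assume p: "p \<in> joint_acts N" and e: "e > 0"
  obtain d where d: "d > 0" "\<And>x u x' u'. (x, u) \<in> joint_acts N \<Longrightarrow> (x', u') \<in> joint_acts N \<Longrightarrow>
    (\<And>j. j\<in>{1..N} \<Longrightarrow> dist (x j) (x' j) < d \<and> dist (u j) (u' j) < d)
    \<Longrightarrow> dist (aggr G N t (x, u)) (aggr G N t (x', u')) < e"
    using aggr_equicontinuous[OF t e] N by metis
  have c: "((\<lambda>q. fst q j) \<longlongrightarrow> fst p j) (at p within joint_acts N)"
      "((\<lambda>q. snd q j) \<longlongrightarrow> snd p j) (at p within joint_acts N)" for j :: nat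
  proof -
    have "continuous_on UNIV (\<lambda>q::(nat \<Rightarrow> 'x) \<times> (nat \<Rightarrow> 'u). fst q j)"
      by (rule continuous_on_compose2[OF continuous_on_product_coordinates[of j] continuous_on_fst]) (auto intro: continuous_intros)
    moreover have "continuous_on UNIV (\<lambda>q::(nat \<Rightarrow> 'x) \<times> (nat \<Rightarrow> 'u). snd q j)"
      by (rule continuous_on_compose2[OF continuous_on_product_coordinates[of j] continuous_on_snd]) (auto intro: continuous_intros)
    ultimately have "continuous_on (joint_acts N) (\<lambda>q::(nat \<Rightarrow> 'x) \<times> (nat \<Rightarrow> 'u). fst q j)"
      "continuous_on (joint_acts N) (\<lambda>q::(nat \<Rightarrow> 'x) \<times> (nat \<Rightarrow> 'u). snd q j)"
      using continuous_on_subset by blast+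
    then show "((\<lambda>q. fst q j) \<longlongrightarrow> fst p j) (at p within joint_acts N)"
      "((\<lambda>q. snd q j) \<longlongrightarrow> snd p j) (at p within joint_acts N)"
      using p unfolding continuous_on_def by blast+
  qed
  have "\<forall>\<^sub>F q in at p within joint_acts N. \<forall>j\<in>{1..N}. dist (fst q j) (fst p j) < d \<and> dist (snd q j) (snd p j) < d"
    using tendstoD[OF c(1) d(1)] tendstoD[OF c(2) d(1)]
    by (intro eventually_ball_finite) (auto intro: eventually_conj)
  moreover have "\<forall>\<^sub>F q in at p within joint_acts N. q \<in> joint_acts N"
    by (simp add: eventually_at_filter)
  ultimately show "\<forall>\<^sub>F q in at p within joint_acts N. dist (aggr G N t q) (aggr G N t p) < e"
  proof eventually_elim
    case (elim q)
    then show ?case using d(2)[of "fst q" "snd q" "fst p" "snd p"] p by auto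
  qed
qed

text \<open>
  The sample point ranges over an arbitrary measurable space L, so that the lemmas also apply to
  joint laws with the mixed strategies and to the sub-sigma-algebras in the independence argument.
\<close>

definition measurable_data where
  "measurable_data L N S Z a b \<longleftrightarrow>
    (\<forall>j\<in>{1..N}. \<forall>t\<in>ctrl_times G. (\<lambda>l. S l j t) \<in> borel_measurable L) \<and>
    (\<forall>j\<in>{1..N}. (\<lambda>l. a j (Z l)) \<in> borel_measurable L) \<and>
    (\<forall>j\<in>{1..N}. \<forall>t\<in>ctrl_times G. (\<lambda>l. b j t (Z l)) \<in> borel_measurable L) \<and>
    (\<lambda>l. env_init G (Z l)) \<in> borel_measurable L \<and>
    (\<forall>t\<in>ctrl_times G. (\<lambda>l. env_noise G t (Z l)) \<in> borel_measurable L \<and> (\<lambda>l. out_noise G t (Z l)) \<in> borel_measurable L)"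

lemma measurable_play_step:
  fixes S :: "'l \<Rightarrow> nat \<Rightarrow> ('x, 'u, 'y) pure" and Z :: "'l \<Rightarrow> 'z"
  assumes m: "measurable_data L N S Z a b" and N: "N \<ge> 1" and t: "t \<in> ctrl_times G"
    and E: "(\<lambda>l. play_env (G\<lparr>init := a, noise := b\<rparr>) N (S l) (Z l) t) \<in> borel_measurable L"
    and X: "\<forall>j\<in>{1..N}. (\<lambda>l. play_states (G\<lparr>init := a, noise := b\<rparr>) N (S l) (Z l) t j) \<in> borel_measurable L"
    and U: "\<forall>j\<in>{1..N}. (\<lambda>l. play_controls (G\<lparr>init := a, noise := b\<rparr>) N (S l) (Z l) t j) \<in> borel_measurable L"
    and Y: "(\<lambda>l. play_outs (G\<lparr>init := a, noise := b\<rparr>) N (S l) (Z l) t) \<in> borel_measurable L"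
  shows "j \<in> {1..N} \<Longrightarrow> (\<lambda>l. play_act (G\<lparr>init := a, noise := b\<rparr>) N (S l) (Z l) t j) \<in> borel_measurable L"
    and "(\<lambda>l. play_aggr (G\<lparr>init := a, noise := b\<rparr>) N (S l) (Z l) t) \<in> borel_measurable L"
    and "(\<lambda>l. play_out (G\<lparr>init := a, noise := b\<rparr>) N (S l) (Z l) t) \<in> borel_measurable L"
proof -
  have X': "(\<lambda>l. play_states (G\<lparr>init := a, noise := b\<rparr>) N (S l) (Z l) t j k) \<in> borel_measurable L" if "j \<in> {1..N}" for j k
    using measurable_product_then_coordinatewise[OF bspec[OF X that]] .
  show act: "(\<lambda>l. play_act (G\<lparr>init := a, noise := b\<rparr>) N (S l) (Z l) t j) \<in> borel_measurable L" if "j \<in> {1..N}" for j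
    unfolding play_act_def
    using m t that bspec[OF X that] bspec[OF U that] Y unfolding measurable_data_def
    by (intro borel_measurable_apply_bcontfun borel_measurable_Pair) auto
  \<comment> \<open>Continuity of \<open>aggr\<close> is known on \<open>joint_acts N\<close> only,
    hence the target is the restricted Borel space.\<close>
  have "(\<lambda>l. (\<lambda>j\<in>{1..N}. play_states (G\<lparr>init := a, noise := b\<rparr>) N (S l) (Z l) t j t,
      \<lambda>j\<in>{1..N}. play_act (G\<lparr>init := a, noise := b\<rparr>) N (S l) (Z l) t j))
      \<in> measurable L (restrict_space borel (joint_acts N))"
    using X' act by (intro measurable_restrict_space2 borel_measurable_Pair borel_measurable_restrict)
      (auto simp: joint_acts_def)
  from measurable_compose[OF this borel_measurable_continuous_on_restrict[OF continuous_on_aggr[OF t N]]]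
  show aggr: "(\<lambda>l. play_aggr (G\<lparr>init := a, noise := b\<rparr>) N (S l) (Z l) t) \<in> borel_measurable L"
    unfolding play_aggr_def by simp
  have "(\<lambda>l. out_noise G t (Z l)) \<in> borel_measurable L" using m t unfolding measurable_data_def by auto
  with E aggr have "(\<lambda>l. env_out G t (play_env (G\<lparr>init := a, noise := b\<rparr>) N (S l) (Z l) t,
    play_aggr (G\<lparr>init := a, noise := b\<rparr>) N (S l) (Z l) t, out_noise G t (Z l))) \<in> borel_measurable L"
    by (intro borel_measurable_continuous_compose[OF continuous_data(4)[OF t]] borel_measurable_Pair)
  then show "(\<lambda>l. play_out (G\<lparr>init := a, noise := b\<rparr>) N (S l) (Z l) t) \<in> borel_measurable L"
    by (simp add: play_out_def)
qed

lemma measurable_play: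
  fixes S :: "'l \<Rightarrow> nat \<Rightarrow> ('x, 'u, 'y) pure" and Z :: "'l \<Rightarrow> 'z"
  assumes m: "measurable_data L N S Z a b" and N: "N \<ge> 1"
  shows "t \<in> state_times G \<longrightarrow>
    (\<lambda>l. play_env (G\<lparr>init := a, noise := b\<rparr>) N (S l) (Z l) t) \<in> borel_measurable L \<and>
    (\<forall>j\<in>{1..N}. (\<lambda>l. play_states (G\<lparr>init := a, noise := b\<rparr>) N (S l) (Z l) t j) \<in> borel_measurable L \<and>
      (\<lambda>l. play_controls (G\<lparr>init := a, noise := b\<rparr>) N (S l) (Z l) t j) \<in> borel_measurable L) \<and>
    (\<lambda>l. play_outs (G\<lparr>init := a, noise := b\<rparr>) N (S l) (Z l) t) \<in> borel_measurable L"
proof (induction t)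
  case 0
  have "(\<lambda>l. (\<lambda>_::nat. undefined :: 'x)(0 := a j (Z l))) \<in> borel_measurable L" if "j \<in> {1..N}" for j
    using m that unfolding measurable_data_def by (intro borel_measurable_fun_upd) auto
  moreover have "(\<lambda>l. env_init G (Z l)) \<in> borel_measurable L" using m unfolding measurable_data_def by auto
  ultimately show ?case by (auto simp: play_0 fun_upd_def)
next
  case (Suc t)
  show ?case
  proof
    assume "Suc t \<in> state_times G"
    then have t: "t \<in> ctrl_times G" by (rule state_times_lt) simp
    let ?G = "G\<lparr>init := a, noise := b\<rparr>"
    have E: "(\<lambda>l. play_env ?G N (S l) (Z l) t) \<in> borel_measurable L"
      and X: "\<forall>j\<in>{1..N}. (\<lambda>l. play_states ?G N (S l) (Z l) t j) \<in> borel_measurable L"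
      and U: "\<forall>j\<in>{1..N}. (\<lambda>l. play_controls ?G N (S l) (Z l) t j) \<in> borel_measurable L"
      and Y: "(\<lambda>l. play_outs ?G N (S l) (Z l) t) \<in> borel_measurable L"
      using Suc ctrl_state_times[OF t] by auto
    note st = measurable_play_step[OF m N t E X U Y]
    have nz: "(\<lambda>l. env_noise G t (Z l)) \<in> borel_measurable L" "\<And>j. j \<in> {1..N} \<Longrightarrow> (\<lambda>l. b j t (Z l)) \<in> borel_measurable L"
      using m t unfolding measurable_data_def by auto
    have "(\<lambda>l. env_dyn G t (play_env ?G N (S l) (Z l) t, play_aggr ?G N (S l) (Z l) t, env_noise G t (Z l))) \<in> borel_measurable L"
      using E st(2) nz(1) by (intro borel_measurable_continuous_compose[OF continuous_data(3)[OF t]] borel_measurable_Pair)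
    moreover have "(\<lambda>l. (play_states ?G N (S l) (Z l) t j)(Suc t := dyn G j t
     (play_states ?G N (S l) (Z l) t j t, play_act ?G N (S l) (Z l) t j, play_out ?G N (S l) (Z l) t, b j t (Z l)))) \<in> borel_measurable L"
      if j: "j \<in> {1..N}" for j
    proof -
      have "j \<ge> 1" using j by simp
      then show ?thesis
        using bspec[OF X j] st(1)[OF j] st(3) nz(2)[OF j] measurable_product_then_coordinatewise[OF bspec[OF X j]]
        by (intro borel_measurable_fun_upd borel_measurable_continuous_compose[OF continuous_data(1)[OF t]] borel_measurable_Pair)
    qed
    moreover have "(\<lambda>l. (play_controls ?G N (S l) (Z l) t j)(t := play_act ?G N (S l) (Z l) t j)) \<in> borel_measurable L"
      if j: "j \<in> {1..N}" for j
      using bspec[OF U j] st(1)[OF j] by (rule borel_measurable_fun_upd)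
    moreover have "(\<lambda>l. (play_outs ?G N (S l) (Z l) t)(t := play_out ?G N (S l) (Z l) t)) \<in> borel_measurable L"
      using Y st(3) by (rule borel_measurable_fun_upd)
    ultimately show "(\<lambda>l. play_env ?G N (S l) (Z l) (Suc t)) \<in> borel_measurable L \<and>
      (\<forall>j\<in>{1..N}. (\<lambda>l. play_states ?G N (S l) (Z l) (Suc t) j) \<in> borel_measurable L \<and>
        (\<lambda>l. play_controls ?G N (S l) (Z l) (Suc t) j) \<in> borel_measurable L) \<and>
      (\<lambda>l. play_outs ?G N (S l) (Z l) (Suc t)) \<in> borel_measurable L"
      by (simp add: play_Suc)
  qed
qed

lemma measurable_trajectory:
  fixes S :: "'l \<Rightarrow> nat \<Rightarrow> ('x, 'u, 'y) pure" and Z :: "'l \<Rightarrow> 'z"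
  assumes m: "measurable_data L N S Z a b" and N: "N \<ge> 1"
  shows "t \<in> state_times G \<Longrightarrow> j \<in> {1..N} \<Longrightarrow> (\<lambda>l. state (G\<lparr>init := a, noise := b\<rparr>) N (S l) (Z l) j t) \<in> borel_measurable L"
    and "t \<in> ctrl_times G \<Longrightarrow> j \<in> {1..N} \<Longrightarrow> (\<lambda>l. control (G\<lparr>init := a, noise := b\<rparr>) N (S l) (Z l) j t) \<in> borel_measurable L"
    and "t \<in> ctrl_times G \<Longrightarrow> (\<lambda>l. env_var (G\<lparr>init := a, noise := b\<rparr>) N (S l) (Z l) t) \<in> borel_measurable L"
proof -
  let ?G = "G\<lparr>init := a, noise := b\<rparr>"
  have p: "(\<lambda>l. play_env ?G N (S l) (Z l) t) \<in> borel_measurable L"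
    "\<forall>j\<in>{1..N}. (\<lambda>l. play_states ?G N (S l) (Z l) t j) \<in> borel_measurable L"
    "\<forall>j\<in>{1..N}. (\<lambda>l. play_controls ?G N (S l) (Z l) t j) \<in> borel_measurable L"
    "(\<lambda>l. play_outs ?G N (S l) (Z l) t) \<in> borel_measurable L"
    if "t \<in> state_times G"
    using measurable_play[OF m N, THEN mp, OF that, unfolded ball_conj_distrib] by - (elim conjE, assumption)+
  show "(\<lambda>l. state ?G N (S l) (Z l) j t) \<in> borel_measurable L"
    if "t \<in> state_times G" "j \<in> {1..N}"
    unfolding state_eq by (rule measurable_product_then_coordinatewise[OF bspec[OF p(2)[OF that(1)] that(2)]])
  note st = measurable_play_step[OF m N _ p, OF _ ctrl_state_times ctrl_state_times ctrl_state_times ctrl_state_times]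
  show "(\<lambda>l. control ?G N (S l) (Z l) j t) \<in> borel_measurable L"
    if "t \<in> ctrl_times G" "j \<in> {1..N}"
    unfolding control_eq using that by (intro st(1)) assumption+
  show "(\<lambda>l. env_var ?G N (S l) (Z l) t) \<in> borel_measurable L"
    if "t \<in> ctrl_times G"
    unfolding env_var_eq using that by (intro st(3)) assumption+
qed

lemma times_update [simp]:
  "ctrl_times (G\<lparr>init := a, noise := b\<rparr>) = ctrl_times G"
  "state_times (G\<lparr>init := a, noise := b\<rparr>) = state_times G"
  by (simp_all add: ctrl_times_def state_times_def)

lemma measurable_env_path:
  fixes S :: "'l \<Rightarrow> nat \<Rightarrow> ('x, 'u, 'y) pure" and Z :: "'l \<Rightarrow> 'z"
  assumes m: "measurable_data L N S Z a b" and N: "N \<ge> 1"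
  shows "(\<lambda>l. env_path (G\<lparr>init := a, noise := b\<rparr>) N (S l) (Z l)) \<in> measurable L (restrict_space borel (env_seqs G))"
proof (rule measurable_restrict_space2)
  show "(\<lambda>l. env_path (G\<lparr>init := a, noise := b\<rparr>) N (S l) (Z l)) \<in> space L \<rightarrow> env_seqs G"
    by (auto simp: env_path_def env_seqs_def)
  show "(\<lambda>l. env_path (G\<lparr>init := a, noise := b\<rparr>) N (S l) (Z l)) \<in> borel_measurable L"
    unfolding env_path_def times_update
    by (intro borel_measurable_restrict measurable_trajectory[OF m N])
qed

lemma measurable_hist_path:
  fixes S :: "'l \<Rightarrow> nat \<Rightarrow> ('x, 'u, 'y) pure" and Z :: "'l \<Rightarrow> 'z"
  assumes m: "measurable_data L N S Z (init G) (noise G)" and i: "i \<in> {1..N}"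
  shows "(\<lambda>l. hist_path G N (S l) (Z l) i) \<in> measurable L (restrict_space borel (histories G))"
proof (rule measurable_restrict_space2)
  have N: "N \<ge> 1" using i by simp
  show "(\<lambda>l. hist_path G N (S l) (Z l) i) \<in> space L \<rightarrow> histories G"
    by (auto simp: hist_path_def histories_def env_path_def env_seqs_def)
  note tr = measurable_trajectory[OF m N, simplified]
  show "(\<lambda>l. hist_path G N (S l) (Z l) i) \<in> borel_measurable L"
    unfolding hist_path_def env_path_def
    by (intro borel_measurable_Pair borel_measurable_restrict tr) (use i in auto)
qed

lemma measurable_path_cost:
  fixes x :: "'l \<Rightarrow> nat \<Rightarrow> 'x" and u :: "'l \<Rightarrow> nat \<Rightarrow> 'u" and y :: "'l \<Rightarrow> nat \<Rightarrow> 'y"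
  assumes i: "i \<ge> 1"
    and x: "\<And>t. t \<in> state_times G \<Longrightarrow> (\<lambda>l. x l t) \<in> borel_measurable L"
    and u: "\<And>t. t \<in> ctrl_times G \<Longrightarrow> (\<lambda>l. u l t) \<in> borel_measurable L"
    and y: "\<And>t. t \<in> ctrl_times G \<Longrightarrow> (\<lambda>l. y l t) \<in> borel_measurable L"
  shows "(\<lambda>l. path_cost G i (x l) (u l) (y l)) \<in> borel_measurable L"
  unfolding path_cost_eq(1)[OF i]
proof (rule borel_measurable_add)
  show "(\<lambda>l. \<Sum>t. if t \<in> ctrl_times G then discount G i ^ t * cost G i t (x l t, u l t, y l t) else 0) \<in> borel_measurable L"
  proof (rule borel_measurable_suminf)
    fix t
    show "(\<lambda>l. if t \<in> ctrl_times G then discount G i ^ t * cost G i t (x l t, u l t, y l t) else 0) \<in> borel_measurable L"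
    proof (cases "t \<in> ctrl_times G")
      case True
      then have "(\<lambda>l. cost G i t (x l t, u l t, y l t)) \<in> borel_measurable L"
        using x[OF ctrl_state_times[OF True]] u[OF True] y[OF True]
        by (intro borel_measurable_continuous_compose[OF continuous_data(2)[OF True i]] borel_measurable_Pair)
      with True show ?thesis by simp
    qed simp
  qed
  show "(\<lambda>l. terminal_cost G i (x l)) \<in> borel_measurable L"
  proof (cases "horizon G")
    case (enat n)
    then have "n \<in> state_times G" by (simp add: state_times_def)
    then have "(\<lambda>l. tcost G i (x l n)) \<in> borel_measurable L"
      by (intro borel_measurable_continuous_compose[OF continuous_tcost[OF i]] x)
    with enat show ?thesis by (simp add: terminal_cost_def)
  qed (simp add: terminal_cost_def)
qed

lemma measurable_solo_path_cost:
  fixes si :: "'l \<Rightarrow> ('x, 'u, 'y) pure" and Z :: "'l \<Rightarrow> 'z" and zs :: "'l \<Rightarrow> nat \<Rightarrow> 'y"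
  assumes i: "i \<ge> 1"
    and si: "\<And>t. t \<in> ctrl_times G \<Longrightarrow> (\<lambda>l. si l t) \<in> borel_measurable L"
    and zs: "\<And>t. t \<in> ctrl_times G \<Longrightarrow> (\<lambda>l. zs l t) \<in> borel_measurable L"
    and init: "(\<lambda>l. init G i (Z l)) \<in> borel_measurable L"
    and noise: "\<And>t. t \<in> ctrl_times G \<Longrightarrow> (\<lambda>l. noise G i t (Z l)) \<in> borel_measurable L"
  shows "(\<lambda>l. solo_path_cost G i (si l) (zs l) (Z l)) \<in> borel_measurable L"
proof -
  have act: "(\<lambda>l. solo_act G i (si l) (zs l) (Z l) t) \<in> borel_measurable L"
    if t: "t \<in> ctrl_times G" and s: "(\<lambda>l. solo G i (si l) (zs l) (Z l) t) \<in> borel_measurable L" for t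
    unfolding solo_act_def
    by (intro borel_measurable_apply_bcontfun borel_measurable_Pair si t s borel_measurable_restrict zs)
      (use ctrl_times_le[OF t] in auto)
  have solo: "t \<in> state_times G \<longrightarrow> (\<lambda>l. solo G i (si l) (zs l) (Z l) t) \<in> borel_measurable L" for t
  proof (induction t)
    case 0
    show ?case using init by (auto intro!: borel_measurable_Pair borel_measurable_fun_upd)
  next
    case (Suc t)
    show ?case
    proof
      assume "Suc t \<in> state_times G"
      then have t: "t \<in> ctrl_times G" by (rule state_times_lt) simp
      then have s: "(\<lambda>l. solo G i (si l) (zs l) (Z l) t) \<in> borel_measurable L"
        using Suc ctrl_state_times by blast
      then have f: "(\<lambda>l. fst (solo G i (si l) (zs l) (Z l) t)) \<in> borel_measurable L"
        "(\<lambda>l. snd (solo G i (si l) (zs l) (Z l) t)) \<in> borel_measurable L"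
        by - (rule borel_measurable_continuous_compose[OF _ s], rule continuous_on_fst continuous_on_snd, rule continuous_on_id)+
      have "(\<lambda>l. (fst (solo G i (si l) (zs l) (Z l) (Suc t)), snd (solo G i (si l) (zs l) (Z l) (Suc t)))) \<in> borel_measurable L"
        unfolding solo_Suc
        by (intro borel_measurable_Pair borel_measurable_fun_upd f act[OF t s]
            borel_measurable_continuous_compose[OF continuous_data(1)[OF t i]]
            measurable_product_then_coordinatewise[OF f(1)] zs[OF t] noise[OF t])
      then show "(\<lambda>l. solo G i (si l) (zs l) (Z l) (Suc t)) \<in> borel_measurable L" by simp
    qed
  qed
  show ?thesis
    unfolding solo_path_cost_def
  proof (rule measurable_path_cost[OF i])
    fix t assume "t \<in> state_times G"
    then have s: "(\<lambda>l. solo G i (si l) (zs l) (Z l) t) \<in> borel_measurable L" using solo by blast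
    have "(\<lambda>l. fst (solo G i (si l) (zs l) (Z l) t)) \<in> borel_measurable L"
      by (rule borel_measurable_continuous_compose[OF continuous_on_fst[OF continuous_on_id] s])
    then show "(\<lambda>l. fst (solo G i (si l) (zs l) (Z l) t) t) \<in> borel_measurable L"
      by (rule measurable_product_then_coordinatewise)
  next
    fix t assume t: "t \<in> ctrl_times G"
    then show "(\<lambda>l. snd (solo G i (si l) (zs l) (Z l) (Suc t)) t) \<in> borel_measurable L"
      unfolding solo_Suc using act[OF t] solo ctrl_state_times[OF t] by auto
  qed (rule zs)
qed

lemma solo_path_cost_bound:
  "i \<ge> 1 \<Longrightarrow> \<bar>solo_path_cost G i si zs z\<bar> \<le> cost_bound / (1 - discount G i) + cost_bound"
  unfolding solo_path_cost_def by (rule path_cost_eq(3))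

end

subsection \<open>Laws and expected costs\<close>

lemma (in prob_space) integral_close:
  fixes f g :: "'a \<Rightarrow> real"
  assumes f: "f \<in> borel_measurable M" "\<And>x. x \<in> space M \<Longrightarrow> \<bar>f x\<bar> \<le> B"
    and g: "g \<in> borel_measurable M" "\<And>x. x \<in> space M \<Longrightarrow> \<bar>g x\<bar> \<le> B"
    and fg: "\<And>x. x \<in> space M \<Longrightarrow> \<bar>f x - g x\<bar> \<le> e"
  shows "\<bar>(\<integral>x. f x \<partial>M) - (\<integral>x. g x \<partial>M)\<bar> \<le> e"
proof -
  have int: "integrable M f" "integrable M g"
    using assms by (auto intro!: integrable_const_bound[where B=B])
  have "(\<integral>x. f x \<partial>M) - (\<integral>x. g x \<partial>M) = (\<integral>x. f x - g x \<partial>M)" using int by simp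
  also have "\<dots> \<le> (\<integral>x. e \<partial>M)" using int fg by (intro integral_mono) (auto simp: abs_le_iff)
  finally have 1: "(\<integral>x. f x \<partial>M) - (\<integral>x. g x \<partial>M) \<le> e" by (simp add: prob_space)
  have "(\<integral>x. g x \<partial>M) - (\<integral>x. f x \<partial>M) = (\<integral>x. g x - f x \<partial>M)" using int by simp
  also have "\<dots> \<le> (\<integral>x. e \<partial>M)" using int fg by (intro integral_mono) (force simp: abs_le_iff)+
  finally show ?thesis using 1 by (simp add: prob_space abs_le_iff)
qed

lemma (in prob_space) integral_bounded:
  fixes f :: "'a \<Rightarrow> real"
  assumes "f \<in> borel_measurable M" "\<And>x. x \<in> space M \<Longrightarrow> \<bar>f x\<bar> \<le> B"
  shows "integrable M f" "\<bar>\<integral>x. f x \<partial>M\<bar> \<le> B"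
proof -
  show "integrable M f" using assms by (auto intro!: integrable_const_bound[where B=B])
  obtain x where "x \<in> space M" using not_empty by blast
  with assms(2) have "0 \<le> B" by fastforce
  then show "\<bar>\<integral>x. f x \<partial>M\<bar> \<le> B"
    using integral_close[OF assms, of "\<lambda>_. 0" B] assms(2) by simp
qed

lemma measurable_generated:
  "generated M X \<subseteq> sets N \<Longrightarrow> space N = space M \<Longrightarrow> X \<in> borel_measurable N"
  unfolding generated_def by (intro measurableI) auto

text \<open>Stability under intersections lets independence pass to the sigma-algebras generated
  jointly by groups of these families.\<close>

lemma Int_stable_generated: "Int_stable (generated M X)"
proof (rule Int_stableI)
  fix a b assume "a \<in> generated M X" "b \<in> generated M X"
  then obtain A B where "A \<in> sets borel" "B \<in> sets borel" "a = X -` A \<inter> space M" "b = X -` B \<inter> space M"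
    unfolding generated_def by auto
  then show "a \<inter> b \<in> generated M X"
    unfolding generated_def by (intro CollectI exI[of _ "A \<inter> B"]) auto
qed

lemma borel_measurable_fst: 
  fixes f :: "'l \<Rightarrow> 'a::topological_space \<times> 'b::topological_space"
  assumes "f \<in> borel_measurable L" 
  shows "(\<lambda>l. fst (f l)) \<in> borel_measurable L"
  by (rule borel_measurable_continuous_compose[OF continuous_on_fst[OF continuous_on_id] assms])

lemma borel_measurable_snd: 
  fixes f :: "'l \<Rightarrow> 'a::topological_space \<times> 'b::topological_space"
  assumes "f \<in> borel_measurable L" 
  shows "(\<lambda>l. snd (f l)) \<in> borel_measurable L"
  by (rule borel_measurable_continuous_compose[OF continuous_on_snd[OF continuous_on_id] assms])

context game_sequence
begin

abbreviation "cost_limit i \<equiv> cost_bound / (1 - discount G i) + cost_bound"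

lemma prob_sp: "prob_space (prob_sp G)"
  using valid unfolding valid_games_def by (elim conjE)

lemma random_data:
  "env_init G \<in> borel_measurable (prob_sp G)"
  "t \<in> ctrl_times G \<Longrightarrow> env_noise G t \<in> borel_measurable (prob_sp G)"
  "t \<in> ctrl_times G \<Longrightarrow> out_noise G t \<in> borel_measurable (prob_sp G)"
  "i \<ge> 1 \<Longrightarrow> init G i \<in> borel_measurable (prob_sp G)"
  "i \<ge> 1 \<Longrightarrow> t \<in> ctrl_times G \<Longrightarrow> noise G i t \<in> borel_measurable (prob_sp G)"
proof -
  show "env_init G \<in> borel_measurable (prob_sp G)"
    using valid unfolding valid_games_def by (elim conjE)
  have "\<forall>t\<in>ctrl_times G. env_noise G t \<in> borel_measurable (prob_sp G) \<and> out_noise G t \<in> borel_measurable (prob_sp G)"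
    "\<forall>i\<ge>1. init G i \<in> borel_measurable (prob_sp G)"
    "\<forall>i\<ge>1. \<forall>t\<in>ctrl_times G. noise G i t \<in> borel_measurable (prob_sp G)"
    using valid unfolding valid_games_def by - (elim conjE, assumption)+
  then show "t \<in> ctrl_times G \<Longrightarrow> env_noise G t \<in> borel_measurable (prob_sp G)"
    "t \<in> ctrl_times G \<Longrightarrow> out_noise G t \<in> borel_measurable (prob_sp G)"
    "i \<ge> 1 \<Longrightarrow> init G i \<in> borel_measurable (prob_sp G)"
    "i \<ge> 1 \<Longrightarrow> t \<in> ctrl_times G \<Longrightarrow> noise G i t \<in> borel_measurable (prob_sp G)"
    by simp_all
qed

lemma mixed_eq: "i \<ge> 1 \<Longrightarrow> mixed G i = mixed G 1"
  unfolding mixed_def by (simp only: pures_eq[of i])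

lemma mixed_D:
  assumes "\<gamma> \<in> mixed G 1"
  shows "prob_space \<gamma>" "space \<gamma> = pures G 1" "(\<lambda>s. s) \<in> measurable \<gamma> borel"
    "(\<lambda>s. s t) \<in> borel_measurable \<gamma>"
proof -
  have s: "sets \<gamma> = sets (restrict_space borel (pures G 1))" and p: "prob_space \<gamma>"
    using assms unfolding mixed_def by auto
  show "prob_space \<gamma>" by fact
  show "space \<gamma> = pures G 1" using sets_eq_imp_space_eq[OF s] by (simp add: space_restrict_space)
  have "(\<lambda>s. s) \<in> measurable (restrict_space borel (pures G 1)) borel"
    by (rule measurable_restrict_space1) simp
  then show m: "(\<lambda>s. s) \<in> measurable \<gamma> borel" by (simp cong: measurable_cong_sets add: s)
  show "(\<lambda>s. s t) \<in> borel_measurable \<gamma>"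
    by (rule measurable_product_then_coordinatewise[OF m])
qed

text \<open>
  The environment variables when the data and the strategy of decision maker i are replaced by
  constants: they do not depend on anything random that concerns decision maker i.
\<close>

definition frozen :: "nat \<Rightarrow> nat \<Rightarrow> (nat \<Rightarrow> ('x, 'u, 'y) pure) \<Rightarrow> 'z \<Rightarrow> nat \<Rightarrow> 'y" where
  "frozen i N s z = env_path (G\<lparr>init := (init G)(i := \<lambda>_. undefined), noise := (noise G)(i := \<lambda>_ _. undefined)\<rparr>) N
     (s(i := undefined)) z"

text \<open>These are the ingredients of \<open>frozen\<close>. Leaving out i makes the predicate
  hold also for the sigma-algebra generated by the environment and the other decision
  makers.\<close>

definition rest_data where
  "rest_data L i N S Z \<longleftrightarrow>
    (\<forall>j\<in>{1..N}-{i}. \<forall>t\<in>ctrl_times G. (\<lambda>l. S l j t) \<in> borel_measurable L) \<and>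
    (\<forall>j\<in>{1..N}-{i}. (\<lambda>l. init G j (Z l)) \<in> borel_measurable L) \<and>
    (\<forall>j\<in>{1..N}-{i}. \<forall>t\<in>ctrl_times G. (\<lambda>l. noise G j t (Z l)) \<in> borel_measurable L) \<and>
    (\<lambda>l. env_init G (Z l)) \<in> borel_measurable L \<and>
    (\<forall>t\<in>ctrl_times G. (\<lambda>l. env_noise G t (Z l)) \<in> borel_measurable L \<and> (\<lambda>l. out_noise G t (Z l)) \<in> borel_measurable L)"

lemma measurable_frozen:
  fixes S :: "'l \<Rightarrow> nat \<Rightarrow> ('x, 'u, 'y) pure" and Z :: "'l \<Rightarrow> 'z"
  assumes "rest_data L i N S Z" "N \<ge> 1"
  shows "(\<lambda>l. frozen i N (S l) (Z l)) \<in> measurable L (restrict_space borel (env_seqs G))"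
proof -
  have "(\<lambda>l. ((S l)(i := undefined)) j t) \<in> borel_measurable L"
    if "j \<in> {1..N}" "t \<in> ctrl_times G" for j t
    using assms(1) that unfolding rest_data_def by (cases "j = i") auto
  then have "measurable_data L N (\<lambda>l. (S l)(i := undefined)) Z
     ((init G)(i := \<lambda>_. undefined)) ((noise G)(i := \<lambda>_ _. undefined))"
    using assms(1) unfolding measurable_data_def rest_data_def by auto
  from measurable_env_path[OF this assms(2)] show ?thesis unfolding frozen_def .
qed

lemma measurable_frozen_const:
  assumes "N \<ge> 1"
  shows "frozen i N s \<in> measurable (prob_sp G) (restrict_space borel (env_seqs G))"
proof (rule measurable_frozen[OF _ assms])
  show "rest_data (prob_sp G) i N (\<lambda>_. s) (\<lambda>z. z)" unfolding rest_data_def using random_data by auto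
qed

lemma measurable_env_seqs_coordinate:
  assumes "f \<in> measurable L (restrict_space borel (env_seqs G))"
  shows "(\<lambda>l. f l t) \<in> borel_measurable L"
proof -
  have "f \<in> borel_measurable L" using assms by (simp add: measurable_restrict_space2_iff)
  then show ?thesis by (rule measurable_product_then_coordinatewise)
qed

lemma frozen_upd [simp]: "frozen i N (s(i := x)) z = frozen i N s z"
  unfolding frozen_def by simp

lemma frozen_close:
  assumes "eventually P (seq_uniformity (ctrl_times G))"
  shows "\<forall>\<^sub>F N in sequentially. \<forall>i\<in>{1..N}. \<forall>s z. (\<forall>j\<in>{1..N}. s j \<in> pures G 1)
    \<longrightarrow> P (env_path G N s z, frozen i N s z)"
  using env_path_insensitive[OF assms]
proof eventually_elim
  case (elim N)
  show ?case unfolding frozen_def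
    by (intro ballI allI impI elim[rule_format]) (auto simp: differ_only_at_def)
qed

lemma solo_cost_eq: "solo_cost G i si zs = (\<integral>z. solo_path_cost G i si zs z \<partial>prob_sp G)"
  unfolding solo_cost_def solo_path_cost_def ..

definition mean_cost where "mean_cost i \<gamma> zs = (\<integral>si. solo_cost G i si zs \<partial>\<gamma>)"

lemma measurable_solo_cost:
  fixes si :: "'l \<Rightarrow> ('x, 'u, 'y) pure" and zs :: "'l \<Rightarrow> nat \<Rightarrow> 'y"
  assumes i: "i \<ge> 1"
    and si: "\<And>t. t \<in> ctrl_times G \<Longrightarrow> (\<lambda>l. si l t) \<in> borel_measurable L"
    and zs: "\<And>t. t \<in> ctrl_times G \<Longrightarrow> (\<lambda>l. zs l t) \<in> borel_measurable L"
  shows "(\<lambda>l. solo_cost G i (si l) (zs l)) \<in> borel_measurable L"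
  unfolding solo_cost_eq
proof -
  interpret prob_space "prob_sp G" by (rule prob_sp)
  have "(\<lambda>p. solo_path_cost G i (si (fst p)) (zs (fst p)) (snd p)) \<in> borel_measurable (L \<Otimes>\<^sub>M prob_sp G)"
    using i by (intro measurable_solo_path_cost measurable_compose[OF measurable_fst si] measurable_compose[OF measurable_fst zs]
        measurable_compose[OF measurable_snd random_data(4)] measurable_compose[OF measurable_snd random_data(5)])
  then show "(\<lambda>l. \<integral>z. solo_path_cost G i (si l) (zs l) z \<partial>prob_sp G) \<in> borel_measurable L"
    by (intro borel_measurable_lebesgue_integral) (simp add: case_prod_beta')
qed

lemma measurable_solo_path_cost_const:
  "i \<ge> 1 \<Longrightarrow> solo_path_cost G i si zs \<in> borel_measurable (prob_sp G)"
  by (intro measurable_solo_path_cost random_data) auto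

lemma solo_cost_bound: "i \<ge> 1 \<Longrightarrow> \<bar>solo_cost G i si zs\<bar> \<le> cost_limit i"
  unfolding solo_cost_eq
  by (intro prob_space.integral_bounded(2)[OF prob_sp] measurable_solo_path_cost_const solo_path_cost_bound)

lemma measurable_mean_cost:
  assumes i: "i \<ge> 1" and \<gamma>: "\<gamma> \<in> mixed G 1" and zs: "zs \<in> measurable L (restrict_space borel (env_seqs G))"
  shows "(\<lambda>l. mean_cost i \<gamma> (zs l)) \<in> borel_measurable L"
  unfolding mean_cost_def
proof -
  interpret prob_space \<gamma> using mixed_D[OF \<gamma>] by blast
  have "(\<lambda>p. solo_cost G i (snd p) (zs (fst p))) \<in> borel_measurable (L \<Otimes>\<^sub>M \<gamma>)"
    using measurable_env_seqs_coordinate[OF zs] mixed_D[OF \<gamma>]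
    by (intro measurable_solo_cost i measurable_compose[OF measurable_snd mixed_D(4)[OF \<gamma>]]
        measurable_compose[OF measurable_fst measurable_env_seqs_coordinate[OF zs]])
  then show "(\<lambda>l. \<integral>si. solo_cost G i si (zs l) \<partial>\<gamma>) \<in> borel_measurable L"
    by (intro borel_measurable_lebesgue_integral) (simp add: case_prod_beta')
qed

lemma measurable_solo_cost_const:
  "i \<ge> 1 \<Longrightarrow> \<gamma> \<in> mixed G 1 \<Longrightarrow> (\<lambda>si. solo_cost G i si zs) \<in> borel_measurable \<gamma>"
  by (intro measurable_solo_cost mixed_D) auto

lemma mean_cost_bound: "i \<ge> 1 \<Longrightarrow> \<gamma> \<in> mixed G 1 \<Longrightarrow> \<bar>mean_cost i \<gamma> zs\<bar> \<le> cost_limit i"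
  unfolding mean_cost_def
  by (intro prob_space.integral_bounded(2)[OF mixed_D(1)] measurable_solo_cost_const solo_cost_bound)

text \<open>The modulus comes from single pure strategies, so it is common to all mixed ones; this
  matters because the equilibrium strategies vary with N. Integration turns the strict bound into a
  weak one.\<close>

lemma mean_cost_close:
  assumes i: "i \<ge> 1" and e: "e > 0"
  shows "\<forall>\<^sub>F ab in seq_uniformity (ctrl_times G).
      \<forall>\<gamma>\<in>mixed G 1. \<bar>mean_cost i \<gamma> (fst ab) - mean_cost i \<gamma> (snd ab)\<bar> \<le> e"
  using solo_path_cost_close[OF i e]
proof (rule eventually_mono, intro ballI)
  fix ab \<gamma> assume ab: "case ab of (a, b) \<Rightarrow> \<forall>si\<in>pures G 1. \<forall>z. \<bar>solo_path_cost G i si a z - solo_path_cost G i si b z\<bar> < e"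
    and \<gamma>: "\<gamma> \<in> mixed G 1"
  have *: "\<bar>solo_path_cost G i si (fst ab) z - solo_path_cost G i si (snd ab) z\<bar> \<le> e" if "si \<in> pures G 1" for si z
    using ab that by (auto simp: case_prod_beta' intro: less_imp_le)
  have "\<bar>solo_cost G i si (fst ab) - solo_cost G i si (snd ab)\<bar> \<le> e" if "si \<in> pures G 1" for si
    unfolding solo_cost_eq
    by (rule prob_space.integral_close[OF prob_sp measurable_solo_path_cost_const[OF i] solo_path_cost_bound[OF i]
        measurable_solo_path_cost_const[OF i] solo_path_cost_bound[OF i] *[OF that]])
  then show "\<bar>mean_cost i \<gamma> (fst ab) - mean_cost i \<gamma> (snd ab)\<bar> \<le> e"
    unfolding mean_cost_def
    by (intro prob_space.integral_close[OF mixed_D(1)[OF \<gamma>] measurable_solo_cost_const[OF i \<gamma>] solo_cost_bound[OF i]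
        measurable_solo_cost_const[OF i \<gamma>] solo_cost_bound[OF i]]) (simp add: mixed_D(2)[OF \<gamma>])
qed

section \<open>Joint laws under mixed profiles\<close>

text \<open>Membership is required at every index, also at 0 and beyond N, so that the product of
  probability spaces is defined over any index set.\<close>

definition profile :: "(nat \<Rightarrow> ('x, 'u, 'y) pure measure) \<Rightarrow> bool" where "profile \<gamma> \<longleftrightarrow> (\<forall>j. \<gamma> j \<in> mixed G 1)"

lemma joint_prob_spaces:
  assumes "profile \<gamma>"
  shows "prob_space (Pi\<^sub>M I \<gamma>)" "prob_space (Pi\<^sub>M I \<gamma> \<Otimes>\<^sub>M prob_sp G)"
    "s \<in> space (Pi\<^sub>M I \<gamma>) \<Longrightarrow> j \<in> I \<Longrightarrow> s j \<in> pures G 1"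
    "j \<in> I \<Longrightarrow> (\<lambda>s. s j t) \<in> borel_measurable (Pi\<^sub>M I \<gamma>)"
proof -
  have \<gamma>: "prob_space (\<gamma> j)" "space (\<gamma> j) = pures G 1" for j using assms mixed_D unfolding profile_def by blast+
  interpret P: product_prob_space \<gamma> I
    by (intro product_prob_spaceI \<gamma>)
  show 1: "prob_space (Pi\<^sub>M I \<gamma>)" by unfold_locales
  show "prob_space (Pi\<^sub>M I \<gamma> \<Otimes>\<^sub>M prob_sp G)"
  proof -
    interpret A: prob_space "Pi\<^sub>M I \<gamma>" by fact
    interpret B: prob_space "prob_sp G" by (rule prob_sp)
    interpret pair_prob_space "Pi\<^sub>M I \<gamma>" "prob_sp G" by unfold_locales
    show ?thesis by unfold_locales
  qed
  show "s \<in> space (Pi\<^sub>M I \<gamma>) \<Longrightarrow> j \<in> I \<Longrightarrow> s j \<in> pures G 1" by (auto simp: space_PiM \<gamma>)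
  show "(\<lambda>s. s j t) \<in> borel_measurable (Pi\<^sub>M I \<gamma>)" if "j \<in> I"
    using assms unfolding profile_def
    by (intro measurable_compose[OF measurable_component_singleton[OF that] mixed_D(4)]) auto
qed

lemma measurable_data_joint:
  assumes "profile \<gamma>"
  shows "measurable_data (Pi\<^sub>M {1..N} \<gamma> \<Otimes>\<^sub>M prob_sp G) N fst snd (init G) (noise G)"
  unfolding measurable_data_def
  by (intro conjI ballI measurable_compose[OF measurable_fst joint_prob_spaces(4)[OF assms]]
      measurable_compose[OF measurable_snd random_data(1)] measurable_compose[OF measurable_snd random_data(2)]
      measurable_compose[OF measurable_snd random_data(3)] measurable_compose[OF measurable_snd random_data(4)]
      measurable_compose[OF measurable_snd random_data(5)]) auto

lemma rest_data_joint:
  assumes "profile \<gamma>" "{1..N} - {i} \<subseteq> I"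
  shows "rest_data (Pi\<^sub>M I \<gamma> \<Otimes>\<^sub>M prob_sp G) i N fst snd"
  unfolding rest_data_def
  by (intro conjI ballI measurable_compose[OF measurable_fst joint_prob_spaces(4)[OF assms(1)]]
      measurable_compose[OF measurable_snd random_data(1)] measurable_compose[OF measurable_snd random_data(2)]
      measurable_compose[OF measurable_snd random_data(3)] measurable_compose[OF measurable_snd random_data(4)]
      measurable_compose[OF measurable_snd random_data(5)]) (use assms(2) in auto)

lemma measurable_joint_paths:
  assumes "profile \<gamma>" "i \<in> {1..N}"
  shows "(\<lambda>p. env_path G N (fst p) (snd p)) \<in> measurable (Pi\<^sub>M {1..N} \<gamma> \<Otimes>\<^sub>M prob_sp G) (restrict_space borel (env_seqs G))"
    and "(\<lambda>p. hist_path G N (fst p) (snd p) i) \<in> measurable (Pi\<^sub>M {1..N} \<gamma> \<Otimes>\<^sub>M prob_sp G) (restrict_space borel (histories G))"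
  using measurable_env_path[OF measurable_data_joint[OF assms(1)]] measurable_hist_path[OF measurable_data_joint[OF assms(1)]] assms(2)
  by auto

lemma joint_integral:
  assumes "profile \<gamma>" "f \<in> borel_measurable (Pi\<^sub>M I \<gamma> \<Otimes>\<^sub>M prob_sp G)" "\<And>p. p \<in> space (Pi\<^sub>M I \<gamma> \<Otimes>\<^sub>M prob_sp G) \<Longrightarrow> \<bar>f p\<bar> \<le> (B::real)"
  shows "(\<integral>s. \<integral>z. f (s, z) \<partial>prob_sp G \<partial>Pi\<^sub>M I \<gamma>) = integral\<^sup>L (Pi\<^sub>M I \<gamma> \<Otimes>\<^sub>M prob_sp G) f"
proof -
  interpret A: prob_space "Pi\<^sub>M I \<gamma>" by (rule joint_prob_spaces[OF assms(1)])
  interpret B: prob_space "prob_sp G" by (rule prob_sp)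
  interpret pair_prob_space "Pi\<^sub>M I \<gamma>" "prob_sp G" by unfold_locales
  show ?thesis using prob_space.integral_bounded(1)[OF joint_prob_spaces(2)[OF assms(1)] assms(2,3)] by (rule integral_fst')
qed

lemma measurable_snd_hist:
  "snd \<in> measurable (restrict_space borel (histories G)) (restrict_space borel (env_seqs G))"
  by (intro measurable_restrict_space2 measurable_restrict_space1 borel_measurable_snd)
    (auto simp: histories_def space_restrict_space)

lemma mixed_solo_cost_eq:
  assumes "profile \<gamma>" "i \<in> {1..N}" "\<gamma>' \<in> mixed G 1"
  shows "mixed_solo_cost G i \<gamma>' (env_law G N \<gamma>) = (\<integral>p. mean_cost i \<gamma>' (env_path G N (fst p) (snd p)) \<partial>(Pi\<^sub>M {1..N} \<gamma> \<Otimes>\<^sub>M prob_sp G))"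
    and "mixed_solo_cost G i \<gamma>' (env_law G N \<gamma>) = (\<integral>h. mean_cost i \<gamma>' (snd h) \<partial>hist_law G N \<gamma> i)"
proof -
  have 1: "mean_cost i \<gamma>' \<in> borel_measurable (restrict_space borel (env_seqs G))"
    by (rule measurable_mean_cost) (use assms in auto)
  show a: "mixed_solo_cost G i \<gamma>' (env_law G N \<gamma>) = (\<integral>p. mean_cost i \<gamma>' (env_path G N (fst p) (snd p)) \<partial>(Pi\<^sub>M {1..N} \<gamma> \<Otimes>\<^sub>M prob_sp G))"
    unfolding mixed_solo_cost_def env_law_def joint_space_def case_prod_beta' mean_cost_def[symmetric]
    by (rule integral_distr[OF measurable_joint_paths(1)[OF assms(1,2)] 1])
  show "mixed_solo_cost G i \<gamma>' (env_law G N \<gamma>) = (\<integral>h. mean_cost i \<gamma>' (snd h) \<partial>hist_law G N \<gamma> i)"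
    unfolding a hist_law_def joint_space_def case_prod_beta'
    by (subst integral_distr[OF measurable_joint_paths(2)[OF assms(1,2)] measurable_compose[OF measurable_snd_hist 1]])
      (simp add: hist_path_def)
qed

lemma measurable_path_cost_hist:
  assumes i: "i \<ge> 1"
  shows "(\<lambda>h. path_cost G i (fst (fst h)) (snd (fst h)) (snd h)) \<in> borel_measurable (restrict_space borel (histories G))"
proof -
  have id: "(\<lambda>h. h) \<in> borel_measurable (restrict_space borel (histories G))"
    by (rule measurable_restrict_space1) simp
  note m = borel_measurable_fst[OF borel_measurable_fst[OF id]] borel_measurable_snd[OF borel_measurable_fst[OF id]]
    borel_measurable_snd[OF id]
  show ?thesis
    by (rule measurable_path_cost[OF i measurable_product_then_coordinatewise[OF m(1)]
          measurable_product_then_coordinatewise[OF m(2)] measurable_product_then_coordinatewise[OF m(3)]])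
qed

lemma mixed_game_cost_eq:
  assumes "profile \<gamma>" "i \<in> {1..N}"
  shows "mixed_game_cost G N i \<gamma> = (\<integral>s. \<integral>z. solo_path_cost G i (s i) (env_path G N s z) z \<partial>prob_sp G \<partial>Pi\<^sub>M {1..N} \<gamma>)"
    and "mixed_game_cost G N i \<gamma> = (\<integral>h. path_cost G i (fst (fst h)) (snd (fst h)) (snd h) \<partial>hist_law G N \<gamma> i)"
proof -
  have i: "i \<ge> 1" using assms(2) by simp
  show 1: "mixed_game_cost G N i \<gamma> = (\<integral>s. \<integral>z. solo_path_cost G i (s i) (env_path G N s z) z \<partial>prob_sp G \<partial>Pi\<^sub>M {1..N} \<gamma>)"
    unfolding mixed_game_cost_def game_cost_def
    by (intro Bochner_Integration.integral_cong refl solo_path_cost_play joint_prob_spaces(3)[OF assms(1)] i)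
      (use assms(2) in auto)
  note hm = measurable_path_cost_hist[OF i]
  \<comment> \<open>The history is restricted to the valid times, and \<open>path_cost\<close> reads
    no other times.\<close>
  have pc: "path_cost G i (state G N s z i) (control G N s z i) (env_var G N s z)
    = path_cost G i (fst (fst (hist_path G N s z i))) (snd (fst (hist_path G N s z i))) (snd (hist_path G N s z i))" for s z
  proof -
    have "terminal_cost G i (state G N s z i) = terminal_cost G i (fst (fst (hist_path G N s z i)))"
      unfolding terminal_cost_def by (auto split: enat.split simp: hist_path_def state_times_def)
    moreover have "(\<Sum>\<^sub>\<infinity>t\<in>ctrl_times G. discount G i ^ t * cost G i t (state G N s z i t, control G N s z i t, env_var G N s z t))
      = (\<Sum>\<^sub>\<infinity>t\<in>ctrl_times G. discount G i ^ t * cost G i t (fst (fst (hist_path G N s z i)) t,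
          snd (fst (hist_path G N s z i)) t, snd (hist_path G N s z i) t))"
      by (rule infsum_cong) (simp add: hist_path_def env_path_def ctrl_state_times)
    ultimately show ?thesis unfolding path_cost_def by simp
  qed
  have "mixed_game_cost G N i \<gamma> = (\<integral>p. path_cost G i (fst (fst (hist_path G N (fst p) (snd p) i)))
    (snd (fst (hist_path G N (fst p) (snd p) i))) (snd (hist_path G N (fst p) (snd p) i)) \<partial>(Pi\<^sub>M {1..N} \<gamma> \<Otimes>\<^sub>M prob_sp G))"
    unfolding mixed_game_cost_def game_cost_def pc
    by (subst joint_integral[OF assms(1) measurable_compose[OF measurable_joint_paths(2)[OF assms] hm] path_cost_eq(3)[OF i], symmetric]) simp
  also have "\<dots> = (\<integral>h. path_cost G i (fst (fst h)) (snd (fst h)) (snd h) \<partial>hist_law G N \<gamma> i)"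
    unfolding hist_law_def joint_space_def case_prod_beta'
    by (rule integral_distr[OF measurable_joint_paths(2)[OF assms] hm, symmetric])
  finally show "mixed_game_cost G N i \<gamma> = (\<integral>h. path_cost G i (fst (fst h)) (snd (fst h)) (snd h) \<partial>hist_law G N \<gamma> i)" .
qed

text \<open>Integration runs over the strategies of the others only, so the value visibly does not
  depend on \<open>\<gamma> i\<close>; the strategy of i enters through \<open>\<gamma>'\<close>
  alone.\<close>

definition frozen_mean :: "nat \<Rightarrow> nat \<Rightarrow> (nat \<Rightarrow> ('x, 'u, 'y) pure measure) \<Rightarrow> ('x, 'u, 'y) pure measure \<Rightarrow> real" where
  "frozen_mean i N \<gamma> \<gamma>' = (\<integral>s. \<integral>z. mean_cost i \<gamma>' (frozen i N s z) \<partial>prob_sp G \<partial>Pi\<^sub>M ({1..N} - {i}) \<gamma>)"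

lemma frozen_mean_upd: "frozen_mean i N (\<gamma>(i := \<gamma>'')) \<gamma>' = frozen_mean i N \<gamma> \<gamma>'"
  unfolding frozen_mean_def by (intro arg_cong2[where f = "integral\<^sup>L"] PiM_cong) auto

lemma integral_marginal:
  assumes "profile \<gamma>" "i \<in> {1..N}" and f: "f \<in> borel_measurable (Pi\<^sub>M {1..N} \<gamma>)" "\<And>s. \<bar>f s\<bar> \<le> (B::real)"
  shows "integral\<^sup>L (Pi\<^sub>M {1..N} \<gamma>) f = (\<integral>s. \<integral>x. f (s(i := x)) \<partial>\<gamma> i \<partial>Pi\<^sub>M ({1..N} - {i}) \<gamma>)"
proof -
  have \<gamma>: "prob_space (\<gamma> j)" for j using assms(1) mixed_D unfolding profile_def by blast
  interpret P: product_prob_space \<gamma> UNIV by (intro product_prob_spaceI \<gamma>)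
  have eq: "insert i ({1..N} - {i}) = {1..N}" using assms(2) by auto
  have "integrable (Pi\<^sub>M (insert i ({1..N} - {i})) \<gamma>) f"
    unfolding eq by (rule prob_space.integral_bounded(1)[OF joint_prob_spaces(1)[OF assms(1)] f])
  from P.product_integral_insert[OF _ _ this] show ?thesis unfolding eq by simp
qed

lemma measurable_mean_frozen:
  assumes "profile \<gamma>" "i \<in> {1..N}" "\<gamma>' \<in> mixed G 1" "{1..N} - {i} \<subseteq> I"
  shows "(\<lambda>p. mean_cost i \<gamma>' (frozen i N (fst p) (snd p))) \<in> borel_measurable (Pi\<^sub>M I \<gamma> \<Otimes>\<^sub>M prob_sp G)"
  by (intro measurable_mean_cost measurable_frozen rest_data_joint assms) (use assms(2) in auto)

text \<open>The integrand ignores the strategy of i, so integrating over it as well, against a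
  probability measure, changes nothing.\<close>

lemma frozen_mean_full:
  assumes "profile \<gamma>" "i \<in> {1..N}" "\<gamma>' \<in> mixed G 1"
  shows "frozen_mean i N \<gamma> \<gamma>' = (\<integral>s. \<integral>z. mean_cost i \<gamma>' (frozen i N s z) \<partial>prob_sp G \<partial>Pi\<^sub>M {1..N} \<gamma>)"
proof -
  have i: "i \<ge> 1" using assms(2) by simp
  interpret B: prob_space "prob_sp G" by (rule prob_sp)
  interpret Gi: prob_space "\<gamma> i" using assms(1) mixed_D unfolding profile_def by blast
  have m: "(\<lambda>s. \<integral>z. mean_cost i \<gamma>' (frozen i N s z) \<partial>prob_sp G) \<in> borel_measurable (Pi\<^sub>M {1..N} \<gamma>)"
    using measurable_mean_frozen[OF assms, of "{1..N}"]
    by (intro B.borel_measurable_lebesgue_integral) (auto simp: case_prod_beta')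
  have bd: "\<bar>\<integral>z. mean_cost i \<gamma>' (frozen i N s z) \<partial>prob_sp G\<bar> \<le> cost_limit i" for s
    by (rule B.integral_bounded(2)[OF measurable_mean_cost[OF i assms(3) measurable_frozen_const] mean_cost_bound[OF i assms(3)]])
      (use assms(2) in auto)
  show ?thesis
    unfolding frozen_mean_def by (subst integral_marginal[OF assms(1,2) m bd]) (simp add: Gi.prob_space)
qed

lemma solo_cost_frozen_mean:
  assumes "profile \<gamma>" "i \<in> {1..N}"
  shows "(\<integral>s. \<integral>z. solo_cost G i (s i) (frozen i N s z) \<partial>prob_sp G \<partial>Pi\<^sub>M {1..N} \<gamma>) = frozen_mean i N \<gamma> (\<gamma> i)"
proof -
  have i: "i \<ge> 1" "N \<ge> 1" using assms(2) by auto
  interpret B: prob_space "prob_sp G" by (rule prob_sp)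
  have \<gamma>i: "\<gamma> i \<in> mixed G 1" using assms(1) unfolding profile_def by blast
  interpret Gi: prob_space "\<gamma> i" using \<gamma>i mixed_D by blast
  interpret BG: pair_prob_space "prob_sp G" "\<gamma> i" by unfold_locales
  have "(\<lambda>p. solo_cost G i (fst p i) (frozen i N (fst p) (snd p))) \<in> borel_measurable (Pi\<^sub>M {1..N} \<gamma> \<Otimes>\<^sub>M prob_sp G)"
    by (intro measurable_solo_cost i measurable_env_seqs_coordinate measurable_frozen rest_data_joint assms
        measurable_compose[OF measurable_fst joint_prob_spaces(4)[OF assms(1)]]) (use assms in auto)
  then have m: "(\<lambda>s. \<integral>z. solo_cost G i (s i) (frozen i N s z) \<partial>prob_sp G) \<in> borel_measurable (Pi\<^sub>M {1..N} \<gamma>)"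
    by (intro B.borel_measurable_lebesgue_integral) (auto simp: case_prod_beta')
  note fz = measurable_frozen_const[OF i(2)]
  have bd: "\<bar>\<integral>z. solo_cost G i (s i) (frozen i N s z) \<partial>prob_sp G\<bar> \<le> cost_limit i" for s
    by (intro B.integral_bounded(2) solo_cost_bound[OF i(1)] measurable_solo_cost i measurable_env_seqs_coordinate[OF fz]) auto
  have "(\<integral>x. \<integral>z. solo_cost G i x (frozen i N s z) \<partial>prob_sp G \<partial>\<gamma> i) = (\<integral>z. mean_cost i (\<gamma> i) (frozen i N s z) \<partial>prob_sp G)" for s
  proof -
    have mm: "(\<lambda>p. solo_cost G i (snd p) (frozen i N s (fst p))) \<in> borel_measurable (prob_sp G \<Otimes>\<^sub>M \<gamma> i)"
      by (intro measurable_solo_cost i measurable_compose[OF measurable_snd mixed_D(4)[OF \<gamma>i]]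
          measurable_compose[OF measurable_fst measurable_env_seqs_coordinate[OF fz]])
    have "integrable (prob_sp G \<Otimes>\<^sub>M \<gamma> i) (\<lambda>(z, x). solo_cost G i x (frozen i N s z))"
      using BG.P.integral_bounded(1)[OF mm solo_cost_bound[OF i(1)]] by (simp add: case_prod_beta')
    from BG.Fubini_integral[OF this] show ?thesis unfolding mean_cost_def .
  qed
  then show ?thesis
    unfolding frozen_mean_def by (subst integral_marginal[OF assms(1,2) m bd]) simp
qed


lemma integral_frozen_independent:
  assumes A3: "A3 G" and i: "i \<in> {1..N}"
  shows "(\<integral>z. solo_path_cost G i \<phi> (frozen i N s z) z \<partial>prob_sp G) = (\<integral>z. solo_cost G i \<phi> (frozen i N s z) \<partial>prob_sp G)"
proof -
  let ?M = "prob_sp G"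
  let ?E = "restrict_space borel (env_seqs G) :: (nat \<Rightarrow> 'y) measure"
  let ?Y = "frozen i N s"
  have i1: "i \<ge> 1" "N \<ge> 1" "i \<noteq> 0" using i by auto
  interpret B: prob_space ?M by (rule prob_sp)
  define X0 where "X0 = (\<lambda>z. (env_init G z, \<lambda>t\<in>ctrl_times G. env_noise G t z, \<lambda>t\<in>ctrl_times G. out_noise G t z))"
  define X where "X j = (\<lambda>z. (init G j z, \<lambda>t\<in>ctrl_times G. noise G j t z))" for j
  define F where "F j = (if j = 0 then generated ?M X0 else generated ?M (X j))" for j :: nat
  have ind: "B.indep_sets F UNIV" using A3 unfolding A3_def F_def X0_def X_def .
  then have Fev: "F j \<subseteq> sets ?M" for j unfolding B.indep_sets_def by blast
  have Fsp: "F j \<subseteq> Pow (space ?M)" for j using Fev sets.space_closed by blast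
  have st: "Int_stable (F j)" for j unfolding F_def by (simp add: Int_stable_generated)
  \<comment> \<open>The index set is grouped into i and everything else; the environment, index 0,
    belongs to the second group.\<close>
  define A where "A = (case_bool {i} (- {i}) :: bool \<Rightarrow> nat set)"
  have ind2: "B.indep_sets (\<lambda>c. sigma_sets (space ?M) (\<Union>j\<in>A c. F j)) UNIV"
  proof (rule B.indep_sets_collect_sigma[OF _ st])
    show "B.indep_sets F (\<Union>c\<in>UNIV. A c)" by (rule B.indep_sets_mono_index[OF _ ind]) simp
    show "disjoint_family_on A UNIV" by (auto simp: disjoint_family_on_def A_def split: bool.split)
  qed
  define MA where "MA = sigma (space ?M) (F i)"
  define MB where "MB = sigma (space ?M) (\<Union>j\<in>-{i}. F j)"
  have MA: "space MA = space ?M" "sets MA = sigma_sets (space ?M) (F i)"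
    unfolding MA_def using Fsp by (auto simp: space_measure_of_conv intro: sets_measure_of)
  have MB: "space MB = space ?M" "sets MB = sigma_sets (space ?M) (\<Union>j\<in>-{i}. F j)"
    unfolding MB_def using Fsp by (auto simp: space_measure_of_conv intro!: sets_measure_of)
  have XA: "X i \<in> borel_measurable MA"
    by (rule measurable_generated[of ?M]) (use i1 MA in \<open>auto simp: F_def\<close>)
  have XB: "X j \<in> borel_measurable MB" if "j \<noteq> 0" "j \<noteq> i" for j
  proof (rule measurable_generated[of ?M])
    show "generated ?M (X j) \<subseteq> sets MB"
      using that unfolding MB(2) by (intro subsetI sigma_sets.Basic) (auto simp: F_def)
  qed (rule MB)
  have X0B: "X0 \<in> borel_measurable MB"
  proof (rule measurable_generated[of ?M])
    show "generated ?M X0 \<subseteq> sets MB"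
      using i1 unfolding MB(2) by (intro subsetI sigma_sets.Basic UN_I[of 0]) (auto simp: F_def)
  qed (rule MB)
  have initA: "init G i \<in> borel_measurable MA"
    using borel_measurable_fst[OF XA] unfolding X_def by simp
  have noiseA: "noise G i t \<in> borel_measurable MA" if "t \<in> ctrl_times G" for t
    using measurable_product_then_coordinatewise[OF borel_measurable_snd[OF XA], of t] that unfolding X_def by simp
  have "rest_data MB i N (\<lambda>_. s) (\<lambda>z. z)"
    unfolding rest_data_def
  proof (intro conjI ballI)
    fix j assume j: "j \<in> {1..N} - {i}"
    then have "j \<noteq> 0" "j \<noteq> i" by auto
    note Xj = XB[OF this]
    show "init G j \<in> borel_measurable MB" using borel_measurable_fst[OF Xj] unfolding X_def by simp
    show "noise G j t \<in> borel_measurable MB" if "t \<in> ctrl_times G" for t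
      using measurable_product_then_coordinatewise[OF borel_measurable_snd[OF Xj], of t] that unfolding X_def by simp
  next
    show "env_init G \<in> borel_measurable MB" using borel_measurable_fst[OF X0B] unfolding X0_def by simp
    fix t assume t: "t \<in> ctrl_times G"
    show "env_noise G t \<in> borel_measurable MB"
      using measurable_product_then_coordinatewise[OF borel_measurable_fst[OF borel_measurable_snd[OF X0B]], of t] t
      unfolding X0_def by simp
    show "out_noise G t \<in> borel_measurable MB"
      using measurable_product_then_coordinatewise[OF borel_measurable_snd[OF borel_measurable_snd[OF X0B]], of t] t
      unfolding X0_def by simp
  qed simp
  from measurable_frozen[OF this i1(2)] have YB: "?Y \<in> measurable MB ?E" .
  note YM = measurable_frozen_const[OF i1(2), of i s]
  \<comment> \<open>The data of i are represented by the sample point itself, seen in the coarser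
    space \<open>MA\<close>; no product space has to be formed for them.\<close>
  have idM: "(\<lambda>z. z) \<in> measurable ?M MA"
    using MA sets.sigma_sets_subset[OF Fev, of i] by (intro measurableI) (auto dest: sets.sets_into_space)
  have idE: "(\<lambda>y. y) \<in> measurable ?E ?E" by simp
  interpret D1: prob_space "distr ?M MA (\<lambda>z. z)" by (rule B.prob_space_distr[OF idM])
  interpret D2: prob_space "distr ?M ?E ?Y" by (rule B.prob_space_distr[OF YM])
  interpret D: pair_prob_space "distr ?M MA (\<lambda>z. z)" "distr ?M ?E ?Y" by unfold_locales
  have prM: "(\<lambda>z. (z, ?Y z)) \<in> measurable ?M (MA \<Otimes>\<^sub>M ?E)" using idM YM by simp
  \<comment> \<open>Independence in the form of a product law, checked on measurable
    rectangles.\<close>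
  have dist: "distr ?M MA (\<lambda>z. z) \<Otimes>\<^sub>M distr ?M ?E ?Y = distr ?M (MA \<Otimes>\<^sub>M ?E) (\<lambda>z. (z, ?Y z))"
  proof (rule pair_measure_eqI)
    fix C D assume "C \<in> sets (distr ?M MA (\<lambda>z. z))" "D \<in> sets (distr ?M ?E ?Y)"
    then have C: "C \<in> sets MA" and D: "D \<in> sets ?E" by simp_all
    have Cs: "C \<inter> space ?M = C" using sets.sets_into_space[OF C] MA(1) by auto
    have YD: "?Y -` D \<inter> space ?M \<in> sets MB" using measurable_sets[OF YB D] MB(1) by simp
    have "B.prob (C \<inter> (?Y -` D \<inter> space ?M)) = B.prob C * B.prob (?Y -` D \<inter> space ?M)"
    proof -
      have "B.indep_set (sets MA) (sets MB)"
        unfolding B.indep_set_def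
        by (rule B.indep_sets_mono_sets[OF ind2]) (auto simp: MA(2) MB(2) A_def split: bool.split)
      from B.indep_setD[OF this C YD] show ?thesis .
    qed
    moreover have "(\<lambda>z. (z, ?Y z)) -` (C \<times> D) \<inter> space ?M = C \<inter> (?Y -` D \<inter> space ?M)" using Cs by auto
    ultimately show "emeasure (distr ?M MA (\<lambda>z. z)) C * emeasure (distr ?M ?E ?Y) D
      = emeasure (distr ?M (MA \<Otimes>\<^sub>M ?E) (\<lambda>z. (z, ?Y z))) (C \<times> D)"
      using C D Cs by (simp add: emeasure_distr idM YM prM B.emeasure_eq_measure ennreal_mult'[symmetric])
  qed (simp_all add: D1.sigma_finite_measure_axioms D2.sigma_finite_measure_axioms cong: sets_pair_measure_cong)
  let ?f = "\<lambda>w y. solo_path_cost G i \<phi> y w"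
  \<comment> \<open>Joint measurability over \<open>MA\<close> holds because the sample point enters
    only through \<open>init G i\<close> and \<open>noise G i\<close>.\<close>
  have fm: "case_prod ?f \<in> borel_measurable (MA \<Otimes>\<^sub>M ?E)"
    unfolding case_prod_beta'
    by (intro measurable_solo_path_cost i1 measurable_compose[OF measurable_fst initA] measurable_compose[OF measurable_fst noiseA]
        measurable_compose[OF measurable_snd measurable_env_seqs_coordinate[OF idE]]) auto
  have fm': "case_prod ?f \<in> borel_measurable (distr ?M MA (\<lambda>z. z) \<Otimes>\<^sub>M distr ?M ?E ?Y)"
    using fm by (simp cong: measurable_cong_sets add: dist)
  have int: "integrable (distr ?M MA (\<lambda>z. z) \<Otimes>\<^sub>M distr ?M ?E ?Y) (case_prod ?f)"
    by (rule D.P.integral_bounded(1)[OF fm', where B = "cost_limit i"]) (auto intro: solo_path_cost_bound i1 simp: case_prod_beta')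
  have "(\<integral>z. ?f z (?Y z) \<partial>?M) = (\<integral>p. case_prod ?f p \<partial>distr ?M (MA \<Otimes>\<^sub>M ?E) (\<lambda>z. (z, ?Y z)))"
    using idM YM by (subst integral_distr[OF _ fm]) auto
  also have "\<dots> = (\<integral>y. \<integral>w. ?f w y \<partial>distr ?M MA (\<lambda>z. z) \<partial>distr ?M ?E ?Y)"
    unfolding dist[symmetric] by (rule D.integral_snd[OF int, symmetric])
  also have "\<dots> = (\<integral>y. solo_cost G i \<phi> y \<partial>distr ?M ?E ?Y)"
  proof -
    have "(\<integral>w. ?f w y \<partial>distr ?M MA (\<lambda>z. z)) = solo_cost G i \<phi> y" for y
      unfolding solo_cost_eq
      by (rule integral_distr[OF idM measurable_solo_path_cost[OF i1(1) _ _ initA noiseA]]) auto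
    then show ?thesis by simp
  qed
  also have "\<dots> = (\<integral>z. solo_cost G i \<phi> (?Y z) \<partial>?M)"
    by (rule integral_distr[OF YM measurable_solo_cost[OF i1(1)]]) (auto intro: measurable_env_seqs_coordinate[OF idE])
  finally show ?thesis .
qed

lemma mixed_solo_cost_frozen_close:
  assumes i: "i \<ge> 1" and e: "e > 0"
  shows "\<forall>\<^sub>F N in sequentially. \<forall>\<gamma> \<gamma>'. profile \<gamma> \<longrightarrow> \<gamma>' \<in> mixed G 1 \<longrightarrow>
    \<bar>mixed_solo_cost G i \<gamma>' (env_law G N \<gamma>) - frozen_mean i N \<gamma> \<gamma>'\<bar> \<le> e"
  using frozen_close[OF mean_cost_close[OF i e]] eventually_ge_at_top[of i]
proof eventually_elim
  case (elim N)
  then have iN: "i \<in> {1..N}" using i by auto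
  show ?case
  proof (intro allI impI)
    fix \<gamma> \<gamma>' assume \<gamma>: "profile \<gamma>" and \<gamma>': "\<gamma>' \<in> mixed G 1"
    let ?Q = "Pi\<^sub>M {1..N} \<gamma> \<Otimes>\<^sub>M prob_sp G"
    interpret Q: prob_space ?Q by (rule joint_prob_spaces(2)[OF \<gamma>])
    have m: "(\<lambda>p. mean_cost i \<gamma>' (env_path G N (fst p) (snd p))) \<in> borel_measurable ?Q"
      by (rule measurable_mean_cost[OF i \<gamma>' measurable_joint_paths(1)[OF \<gamma> iN]])
    have m': "(\<lambda>p. mean_cost i \<gamma>' (frozen i N (fst p) (snd p))) \<in> borel_measurable ?Q"
      by (rule measurable_mean_frozen[OF \<gamma> iN \<gamma>']) auto
    have "frozen_mean i N \<gamma> \<gamma>' = (\<integral>p. mean_cost i \<gamma>' (frozen i N (fst p) (snd p)) \<partial>?Q)"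
      unfolding frozen_mean_full[OF \<gamma> iN \<gamma>'] using joint_integral[OF \<gamma> m' mean_cost_bound[OF i \<gamma>']] by simp
    moreover have "\<bar>mean_cost i \<gamma>' (env_path G N (fst p) (snd p)) - mean_cost i \<gamma>' (frozen i N (fst p) (snd p))\<bar> \<le> e"
      if "p \<in> space ?Q" for p
    proof -
      have "fst p \<in> space (Pi\<^sub>M {1..N} \<gamma>)" using that by (auto simp: space_pair_measure)
      then have "\<forall>j\<in>{1..N}. fst p j \<in> pures G 1" using joint_prob_spaces(3)[OF \<gamma>] by blast
      with elim(1) iN \<gamma>' show ?thesis by (metis fst_conv snd_conv)
    qed
    ultimately show "\<bar>mixed_solo_cost G i \<gamma>' (env_law G N \<gamma>) - frozen_mean i N \<gamma> \<gamma>'\<bar> \<le> e"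
      unfolding mixed_solo_cost_eq(1)[OF \<gamma> iN \<gamma>']
      using Q.integral_close[OF m mean_cost_bound[OF i \<gamma>'] m' mean_cost_bound[OF i \<gamma>']] by simp
  qed
qed

lemma mixed_game_cost_frozen_close:
  assumes A3: "A3 G" and i: "i \<ge> 1" and e: "e > 0"
  shows "\<forall>\<^sub>F N in sequentially. \<forall>\<gamma>. profile \<gamma> \<longrightarrow>
    \<bar>mixed_game_cost G N i \<gamma> - frozen_mean i N \<gamma> (\<gamma> i)\<bar> \<le> e"
  using frozen_close[OF solo_path_cost_close[OF i e]] eventually_ge_at_top[of i]
proof eventually_elim
  case (elim N)
  then have iN: "i \<in> {1..N}" using i by auto
  then have N: "N \<ge> 1" by simp
  show ?case
  proof (intro allI impI)
    fix \<gamma> assume \<gamma>: "profile \<gamma>"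
    let ?Q = "Pi\<^sub>M {1..N} \<gamma> \<Otimes>\<^sub>M prob_sp G"
    interpret Q: prob_space ?Q by (rule joint_prob_spaces(2)[OF \<gamma>])
    have si: "(\<lambda>p. fst p i t) \<in> borel_measurable ?Q" for t
      by (rule measurable_compose[OF measurable_fst joint_prob_spaces(4)[OF \<gamma> iN]])
    note pm = measurable_solo_path_cost[OF i si _ measurable_compose[OF measurable_snd random_data(4)[OF i]]
        measurable_compose[OF measurable_snd random_data(5)[OF i]]]
    have m: "(\<lambda>p. solo_path_cost G i (fst p i) (env_path G N (fst p) (snd p)) (snd p)) \<in> borel_measurable ?Q"
      by (rule pm; (assumption | rule measurable_env_seqs_coordinate[OF measurable_joint_paths(1)[OF \<gamma> iN]]))
    have m': "(\<lambda>p. solo_path_cost G i (fst p i) (frozen i N (fst p) (snd p)) (snd p)) \<in> borel_measurable ?Q"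
      by (rule pm; (assumption | rule measurable_env_seqs_coordinate[OF measurable_frozen[OF rest_data_joint[OF \<gamma> Diff_subset] N]]))
    have "frozen_mean i N \<gamma> (\<gamma> i) = (\<integral>s. \<integral>z. solo_path_cost G i (s i) (frozen i N s z) z \<partial>prob_sp G \<partial>Pi\<^sub>M {1..N} \<gamma>)"
      unfolding solo_cost_frozen_mean[OF \<gamma> iN, symmetric] integral_frozen_independent[OF A3 iN] ..
    also have "\<dots> = (\<integral>p. solo_path_cost G i (fst p i) (frozen i N (fst p) (snd p)) (snd p) \<partial>?Q)"
      using joint_integral[OF \<gamma> m' solo_path_cost_bound[OF i]] by simp
    finally have 1: "frozen_mean i N \<gamma> (\<gamma> i) = \<dots>" .
    have 2: "mixed_game_cost G N i \<gamma> = (\<integral>p. solo_path_cost G i (fst p i) (env_path G N (fst p) (snd p)) (snd p) \<partial>?Q)"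
      unfolding mixed_game_cost_eq(1)[OF \<gamma> iN] using joint_integral[OF \<gamma> m solo_path_cost_bound[OF i]] by simp
    have "\<bar>solo_path_cost G i (fst p i) (env_path G N (fst p) (snd p)) (snd p)
      - solo_path_cost G i (fst p i) (frozen i N (fst p) (snd p)) (snd p)\<bar> \<le> e" if "p \<in> space ?Q" for p
    proof -
      have "fst p \<in> space (Pi\<^sub>M {1..N} \<gamma>)" using that by (auto simp: space_pair_measure)
      then have *: "\<forall>j\<in>{1..N}. fst p j \<in> pures G 1" using joint_prob_spaces(3)[OF \<gamma>] by blast
      with elim(1) iN show ?thesis by (auto intro!: less_imp_le)
    qed
    then show "\<bar>mixed_game_cost G N i \<gamma> - frozen_mean i N \<gamma> (\<gamma> i)\<bar> \<le> e"
      unfolding 1 2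
      by (rule Q.integral_close[OF m solo_path_cost_bound[OF i] m' solo_path_cost_bound[OF i]])
  qed
qed

lemma hist_law_prob_space:
  assumes "profile \<gamma>" "i \<in> {1..N}"
  shows "prob_space (hist_law G N \<gamma> i)" "sets (hist_law G N \<gamma> i) = sets (restrict_space borel (histories G))"
proof -
  show "prob_space (hist_law G N \<gamma> i)"
    unfolding hist_law_def joint_space_def case_prod_beta'
    by (rule prob_space.prob_space_distr[OF joint_prob_spaces(2)[OF assms(1)] measurable_joint_paths(2)[OF assms]])
qed (simp add: hist_law_def)

section \<open>Passage to the limit\<close>

context
  fixes \<gamma>N :: "nat \<Rightarrow> nat \<Rightarrow> ('x, 'u, 'y) pure measure" and \<gamma> :: "nat \<Rightarrow> ('x, 'u, 'y) pure measure" and i :: nat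
  assumes \<gamma>N: "\<And>N. N \<ge> 1 \<Longrightarrow> profile (\<gamma>N N)" and \<gamma>: "profile \<gamma>" and i: "i \<ge> 1"
    and conv: "(\<lambda>N. prokhorov (hist_dist G) (hist_law G N (\<gamma>N N) i) (hist_law G N \<gamma> i)) \<longlonglongrightarrow> 0"
begin

lemma hist_integral_tendsto:
  assumes F: "F \<in> borel_measurable (restrict_space borel (histories G))" "\<And>h. \<bar>F h\<bar> \<le> (C::real)"
    and uc: "\<And>e. e > 0 \<Longrightarrow> \<exists>n. \<exists>d>0. \<forall>x u y x' u' y'. (\<forall>t\<in>state_times G. t \<le> n \<longrightarrow> dist (x t) (x' t) < d) \<and>
      (\<forall>t\<in>ctrl_times G. t \<le> n \<longrightarrow> dist (u t) (u' t) < d \<and> dist (y t) (y' t) < d)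
      \<longrightarrow> \<bar>F ((x, u), y) - F ((x', u'), y')\<bar> < e"
  shows "(\<lambda>N. (\<integral>h. F h \<partial>hist_law G N (\<gamma>N N) i) - (\<integral>h. F h \<partial>hist_law G N \<gamma> i)) \<longlonglongrightarrow> 0"
proof (rule prokhorov_tendsto_imp_integral[OF _ F(1) F(2) _ conv, where ?N0.0 = i])
  fix N assume "N \<ge> i"
  then have "i \<in> {1..N}" "N \<ge> 1" using i by auto
  then show "prob_space (hist_law G N (\<gamma>N N) i) \<and> prob_space (hist_law G N \<gamma> i) \<and>
    sets (hist_law G N (\<gamma>N N) i) = sets (restrict_space borel (histories G)) \<and>
    sets (hist_law G N \<gamma> i) = sets (restrict_space borel (histories G))"
    using hist_law_prob_space \<gamma>N \<gamma> by auto
next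
  fix e :: real assume "e > 0"
  then obtain n d where d: "d > 0" "\<And>x u y x' u' y'. (\<forall>t\<in>state_times G. t \<le> n \<longrightarrow> dist (x t) (x' t) < d) \<and>
      (\<forall>t\<in>ctrl_times G. t \<le> n \<longrightarrow> dist (u t) (u' t) < d \<and> dist (y t) (y' t) < d)
      \<Longrightarrow> \<bar>F ((x, u), y) - F ((x', u'), y')\<bar> < e"
    using uc by metis
  obtain r where r: "r > 0" "\<forall>(x::nat \<Rightarrow> 'x) (u::nat \<Rightarrow> 'u) (y::nat \<Rightarrow> 'y) x' u' y'. hist_dist G ((x,u),y) ((x',u'),y') < r \<longrightarrow>
    (\<forall>t\<in>state_times G. t \<le> n \<longrightarrow> dist (x t) (x' t) < d) \<and>
    (\<forall>t\<in>ctrl_times G. t \<le> n \<longrightarrow> dist (u t) (u' t) < d \<and> dist (y t) (y' t) < d)"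
    using hist_dist_small[OF d(1), of G n] by blast
  show "\<exists>d>0. \<forall>a\<in>space (restrict_space borel (histories G)). \<forall>b\<in>space (restrict_space borel (histories G)).
    hist_dist G a b < d \<longrightarrow> \<bar>F a - F b\<bar> < e"
  proof (intro exI[of _ r] conjI ballI impI)
    fix a b :: "('x, 'u, 'y) hist" assume h: "hist_dist G a b < r"
    obtain x u y x' u' y' where ab: "a = ((x, u), y)" "b = ((x', u'), y')" by (metis prod.collapse)
    show "\<bar>F a - F b\<bar> < e"
      unfolding ab by (rule d(2)) (rule r(2)[rule_format, OF h[unfolded ab]])
  qed (rule r)
qed

lemma mixed_game_cost_tendsto:
  "(\<lambda>N. mixed_game_cost G N i (\<gamma>N N) - mixed_game_cost G N i \<gamma>) \<longlonglongrightarrow> 0"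
proof -
  have hm: "(\<lambda>h. path_cost G i (fst (fst h)) (snd (fst h)) (snd h)) \<in> borel_measurable (restrict_space borel (histories G))"
    by (rule measurable_path_cost_hist[OF i])
  have lim: "(\<lambda>N. (\<integral>h. path_cost G i (fst (fst h)) (snd (fst h)) (snd h) \<partial>hist_law G N (\<gamma>N N) i)
     - (\<integral>h. path_cost G i (fst (fst h)) (snd (fst h)) (snd h) \<partial>hist_law G N \<gamma> i)) \<longlonglongrightarrow> 0"
    using path_cost_close[OF i] by (intro hist_integral_tendsto[OF hm path_cost_eq(3)[OF i]]) simp
  show ?thesis
  proof (rule Lim_transform_eventually[OF lim])
    show "\<forall>\<^sub>F N in sequentially. (\<integral>h. path_cost G i (fst (fst h)) (snd (fst h)) (snd h) \<partial>hist_law G N (\<gamma>N N) i)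
     - (\<integral>h. path_cost G i (fst (fst h)) (snd (fst h)) (snd h) \<partial>hist_law G N \<gamma> i)
     = mixed_game_cost G N i (\<gamma>N N) - mixed_game_cost G N i \<gamma>"
      using eventually_ge_at_top[of i]
    proof eventually_elim
      case (elim N)
      then have "i \<in> {1..N}" "N \<ge> 1" using i by auto
      then show ?case using mixed_game_cost_eq(2) \<gamma>N \<gamma> by simp
    qed
  qed
qed

text \<open>Since \<open>\<gamma>'\<close> is the same for all N, one bounded uniformly continuous
  function of the environment path is integrated against both laws. The strategies
  \<open>\<gamma>N N i\<close> do not have this property and are compared through
  \<open>frozen_mean\<close> instead.\<close>

lemma mixed_solo_cost_tendsto:
  assumes \<gamma>': "\<gamma>' \<in> mixed G 1"
  shows "(\<lambda>N. mixed_solo_cost G i \<gamma>' (env_law G N (\<gamma>N N)) - mixed_solo_cost G i \<gamma>' (env_law G N \<gamma>)) \<longlonglongrightarrow> 0"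
proof -
  have hm: "(\<lambda>h. mean_cost i \<gamma>' (snd h)) \<in> borel_measurable (restrict_space borel (histories G))"
    by (rule measurable_mean_cost[OF i \<gamma>' measurable_snd_hist])
  have lim: "(\<lambda>N. (\<integral>h. mean_cost i \<gamma>' (snd h) \<partial>hist_law G N (\<gamma>N N) i)
     - (\<integral>h. mean_cost i \<gamma>' (snd h) \<partial>hist_law G N \<gamma> i)) \<longlonglongrightarrow> 0"
  proof (rule hist_integral_tendsto[OF hm mean_cost_bound[OF i \<gamma>']])
    fix e :: real assume "e > 0"
    then have "e / 2 > 0" by simp
    from mean_cost_close[OF i this] obtain n d where d: "d > 0"
      "\<And>a b. (\<And>k. k\<in>ctrl_times G \<Longrightarrow> k \<le> n \<Longrightarrow> dist (a k) (b k) < d) \<Longrightarrow> \<bar>mean_cost i \<gamma>' a - mean_cost i \<gamma>' b\<bar> \<le> e / 2"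
      using \<gamma>' unfolding eventually_seq_uniformity fst_conv snd_conv by metis
    show "\<exists>n. \<exists>d>0. \<forall>(x :: nat \<Rightarrow> 'x) (u :: nat \<Rightarrow> 'u) y x' u' y'. (\<forall>t\<in>state_times G. t \<le> n \<longrightarrow> dist (x t) (x' t) < d) \<and>
      (\<forall>t\<in>ctrl_times G. t \<le> n \<longrightarrow> dist (u t) (u' t) < d \<and> dist (y t) (y' t) < d)
      \<longrightarrow> \<bar>mean_cost i \<gamma>' (snd ((x, u), y)) - mean_cost i \<gamma>' (snd ((x', u'), y'))\<bar> < e"
    proof (intro exI[of _ n] exI[of _ d] conjI allI impI)
      fix x x' :: "nat \<Rightarrow> 'x" and u u' :: "nat \<Rightarrow> 'u" and y y' :: "nat \<Rightarrow> 'y"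
      assume "(\<forall>t\<in>state_times G. t \<le> n \<longrightarrow> dist (x t) (x' t) < d) \<and>
        (\<forall>t\<in>ctrl_times G. t \<le> n \<longrightarrow> dist (u t) (u' t) < d \<and> dist (y t) (y' t) < d)"
      then have "\<bar>mean_cost i \<gamma>' y - mean_cost i \<gamma>' y'\<bar> \<le> e / 2" by (intro d(2)) auto
      then show "\<bar>mean_cost i \<gamma>' (snd ((x, u), y)) - mean_cost i \<gamma>' (snd ((x', u'), y'))\<bar> < e"
        using \<open>e > 0\<close> by simp
    qed (rule d)
  qed
  show ?thesis
  proof (rule Lim_transform_eventually[OF lim])
    show "\<forall>\<^sub>F N in sequentially. (\<integral>h. mean_cost i \<gamma>' (snd h) \<partial>hist_law G N (\<gamma>N N) i)
     - (\<integral>h. mean_cost i \<gamma>' (snd h) \<partial>hist_law G N \<gamma> i)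
     = mixed_solo_cost G i \<gamma>' (env_law G N (\<gamma>N N)) - mixed_solo_cost G i \<gamma>' (env_law G N \<gamma>)"
      using eventually_ge_at_top[of i]
    proof eventually_elim
      case (elim N)
      then have "i \<in> {1..N}" "N \<ge> 1" using i by auto
      then show ?case using mixed_solo_cost_eq(2) \<gamma>N \<gamma> \<gamma>' by simp
    qed
  qed
qed

text \<open>From the cost under \<open>\<gamma>\<close> the chain leads to the SEBEU cost, its
  frozen mean and its subjective cost; there optimality replaces the strategy of i by
  \<open>\<gamma>'\<close>. It returns through the subjective cost against the environment law of
  \<open>\<gamma>\<close> and its frozen mean to the true cost after the deviation.\<close>

lemma no_profitable_deviation:
  assumes A3: "A3 G" and \<gamma>': "\<gamma>' \<in> mixed G 1"
    and opt: "\<And>N. N \<ge> i \<Longrightarrow> mixed_solo_cost G i (\<gamma>N N i) (env_law G N (\<gamma>N N)) \<le> mixed_solo_cost G i \<gamma>' (env_law G N (\<gamma>N N))"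
  shows "cost_inf G i \<gamma> \<le> cost_inf G i (\<gamma>(i := \<gamma>'))"
proof (rule ereal_le_epsilon2)
  fix e :: real assume "e > 0"
  \<comment> \<open>The chain of inequalities contains six approximations.\<close>
  define r where "r = e / 6"
  have r: "r > 0" using \<open>e > 0\<close> by (simp add: r_def)
  have dev: "profile (\<gamma>(i := \<gamma>'))" using \<gamma> \<gamma>' unfolding profile_def by auto
  have "\<forall>\<^sub>F N in sequentially. \<bar>mixed_game_cost G N i (\<gamma>N N) - mixed_game_cost G N i \<gamma>\<bar> < r"
    using tendstoD[OF mixed_game_cost_tendsto r] by (simp add: dist_real_def)
  moreover have "\<forall>\<^sub>F N in sequentially. \<bar>mixed_solo_cost G i \<gamma>' (env_law G N (\<gamma>N N)) - mixed_solo_cost G i \<gamma>' (env_law G N \<gamma>)\<bar> < r"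
    using tendstoD[OF mixed_solo_cost_tendsto[OF \<gamma>'] r] by (simp add: dist_real_def)
  moreover note mixed_solo_cost_frozen_close[OF i r] mixed_game_cost_frozen_close[OF A3 i r] eventually_ge_at_top[of i]
  ultimately have "\<forall>\<^sub>F N in sequentially. ereal (mixed_game_cost G N i \<gamma>) \<le> ereal e + ereal (mixed_game_cost G N i (\<gamma>(i := \<gamma>')))"
  proof eventually_elim
    case (elim N)
    have prof: "profile (\<gamma>N N)" using \<gamma>N elim(5) i by auto
    then have "\<gamma>N N i \<in> mixed G 1" unfolding profile_def by blast
    then have 1: "\<bar>mixed_solo_cost G i (\<gamma>N N i) (env_law G N (\<gamma>N N)) - frozen_mean i N (\<gamma>N N) (\<gamma>N N i)\<bar> \<le> r"
      using elim(3) prof by blast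
    have 2: "\<bar>mixed_game_cost G N i (\<gamma>N N) - frozen_mean i N (\<gamma>N N) (\<gamma>N N i)\<bar> \<le> r" using elim(4) prof by blast
    \<comment> \<open>This estimate uses the undeviated profile and the next one the deviated
      profile; their frozen means coincide by \<open>frozen_mean_upd\<close>, which is where the
      influence of i on the environment disappears.\<close>
    have 3: "\<bar>mixed_solo_cost G i \<gamma>' (env_law G N \<gamma>) - frozen_mean i N \<gamma> \<gamma>'\<bar> \<le> r" using elim(3) \<gamma> \<gamma>' by blast
    have 4: "\<bar>mixed_game_cost G N i (\<gamma>(i := \<gamma>')) - frozen_mean i N \<gamma> \<gamma>'\<bar> \<le> r"
      using elim(4)[rule_format, OF dev] by (simp add: frozen_mean_upd)
    have "mixed_game_cost G N i \<gamma> \<le> 6 * r + mixed_game_cost G N i (\<gamma>(i := \<gamma>'))"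
      using 1 2 3 4 elim(1,2) opt[OF elim(5)] by linarith
    then show ?case by (simp add: r_def)
  qed
  then have "limsup (\<lambda>N. ereal (mixed_game_cost G N i \<gamma>)) \<le> limsup (\<lambda>N. ereal e + ereal (mixed_game_cost G N i (\<gamma>(i := \<gamma>'))))"
    by (rule Limsup_mono)
  also have "\<dots> = ereal e + limsup (\<lambda>N. ereal (mixed_game_cost G N i (\<gamma>(i := \<gamma>'))))"
    by (rule ereal_limsup_lim_add) auto
  finally show "cost_inf G i \<gamma> \<le> cost_inf G i (\<gamma>(i := \<gamma>')) + ereal e"
    unfolding cost_inf_def by (simp add: add.commute)
qed

end

end

text \<open>Only the factors of the product measure with index in {1..N} enter, so a profile may be
  altered elsewhere to satisfy \<open>profile\<close>.\<close>

lemma laws_cong: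
  assumes "\<And>j. j \<in> {1..N} \<Longrightarrow> \<gamma> j = \<gamma>' j"
  shows "mixed_game_cost G N i \<gamma> = mixed_game_cost G N i \<gamma>'" "env_law G N \<gamma> = env_law G N \<gamma>'"
    "hist_law G N \<gamma> i = hist_law G N \<gamma>' i"
proof -
  have "Pi\<^sub>M {1..N} \<gamma> = Pi\<^sub>M {1..N} \<gamma>'" using assms by (intro PiM_cong) auto
  then show "mixed_game_cost G N i \<gamma> = mixed_game_cost G N i \<gamma>'" "env_law G N \<gamma> = env_law G N \<gamma>'"
    "hist_law G N \<gamma> i = hist_law G N \<gamma>' i"
    unfolding mixed_game_cost_def env_law_def hist_law_def joint_space_def by simp_all
qed

theorem theorem4p2:
  fixes G :: "('x::{metric_space, second_countable_topology}, 'u::{metric_space, second_countable_topology},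
      'w::{metric_space, second_countable_topology}, 'x0::{metric_space, second_countable_topology},
      'w0::{metric_space, second_countable_topology}, 'y::{metric_space, second_countable_topology},
      'k::{metric_space, second_countable_topology}, 'd::{metric_space, second_countable_topology},
      'z) game_seq"
    and \<gamma>N :: "nat \<Rightarrow> nat \<Rightarrow> ('x, 'u, 'y) pure measure"
    and \<gamma>inf :: "nat \<Rightarrow> ('x, 'u, 'y) pure measure"
  assumes "valid_games G"
    and "A1 G"
    and "A2 G"
    and "A3 G"
    and "\<And>N. N \<ge> 1 \<Longrightarrow> sebeu G N (\<gamma>N N)"
    and "joint_mixed_inf G \<gamma>inf"
    and "\<And>i. i \<ge> 1 \<Longrightarrow>
      (\<lambda>N. prokhorov (hist_dist G) (hist_law G N (\<gamma>N N) i) (hist_law G N \<gamma>inf i)) \<longlonglongrightarrow> 0"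
  shows "nash_inf G \<gamma>inf"
proof -
  interpret game_sequence G by unfold_locales fact+
  text \<open>Outside the range of decision makers the profiles may be junk; replace them there by admissible ones.\<close>
  define \<gamma>' where "\<gamma>' = (\<lambda>j. if j \<ge> 1 then \<gamma>inf j else \<gamma>inf 1)"
  define \<gamma>N' where "\<gamma>N' N = (\<lambda>j. if j \<in> {1..N} then \<gamma>N N j else \<gamma>inf 1)" for N
  have inf: "\<gamma>inf j \<in> mixed G 1" if "j \<ge> 1" for j
    using assms(6) mixed_eq[OF that] that unfolding joint_mixed_inf_def by blast
  have p: "profile \<gamma>'" using inf unfolding profile_def \<gamma>'_def by auto
  have pN: "profile (\<gamma>N' N)" if "N \<ge> 1" for N
  proof -
    have "\<gamma>N N j \<in> mixed G 1" if "j \<in> {1..N}" for j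
      using assms(5)[OF \<open>N \<ge> 1\<close>] mixed_eq[of j] that unfolding sebeu_def by auto
    then show ?thesis using inf unfolding profile_def \<gamma>N'_def by auto
  qed
  have eq: "\<gamma>' j = \<gamma>inf j" if "j \<in> {1..N}" for j N using that by (simp add: \<gamma>'_def)
  have eqN: "\<gamma>N' N j = \<gamma>N N j" if "j \<in> {1..N}" for j N using that by (simp add: \<gamma>N'_def)
  show ?thesis
    unfolding nash_inf_def
  proof (intro conjI allI impI ballI)
    show "joint_mixed_inf G \<gamma>inf" by fact
    fix i \<delta> assume i: "1 \<le> i" and "\<delta> \<in> mixed G i"
    then have \<delta>: "\<delta> \<in> mixed G 1" using mixed_eq by blast
    have "hist_law G N (\<gamma>N' N) i = hist_law G N (\<gamma>N N) i" "hist_law G N \<gamma>' i = hist_law G N \<gamma>inf i" for N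
      using laws_cong(3)[of N "\<gamma>N' N"] laws_cong(3)[of N \<gamma>'] eq eqN by blast+
    then have conv: "(\<lambda>N. prokhorov (hist_dist G) (hist_law G N (\<gamma>N' N) i) (hist_law G N \<gamma>' i)) \<longlonglongrightarrow> 0"
      using assms(7)[OF i] by simp
    have "cost_inf G i \<gamma>' \<le> cost_inf G i (\<gamma>'(i := \<delta>))"
    proof (rule no_profitable_deviation[OF pN p i conv assms(4) \<delta>])
      fix N assume "N \<ge> i"
      then have N: "i \<in> {1..N}" "N \<ge> 1" using i by auto
      have "env_law G N (\<gamma>N' N) = env_law G N (\<gamma>N N)" using laws_cong(2)[of N "\<gamma>N' N"] eqN by blast
      then show "mixed_solo_cost G i (\<gamma>N' N i) (env_law G N (\<gamma>N' N)) \<le> mixed_solo_cost G i \<delta> (env_law G N (\<gamma>N' N))"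
        using assms(5)[OF N(2)] N(1) \<open>\<delta> \<in> mixed G i\<close> unfolding sebeu_def eqN[OF N(1)] by auto
    qed
    moreover have "mixed_game_cost G N i \<gamma>' = mixed_game_cost G N i \<gamma>inf"
      "mixed_game_cost G N i (\<gamma>'(i := \<delta>)) = mixed_game_cost G N i (\<gamma>inf(i := \<delta>))" for N
      by (rule laws_cong(1); simp add: \<gamma>'_def)+
    ultimately show "cost_inf G i \<gamma>inf \<le> cost_inf G i (\<gamma>inf(i := \<delta>))"
      unfolding cost_inf_def by simp
  qed
qed

end
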